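(* Let $\mathcal P_0$ be a compact subset of $\mathcal P$, and for every $P\in\mathcal P_0$ let $\{(X_t,Y_t)\}_{t\in\mathbb T}$ be, under $(\mathbb P_k^P)_{k\in\mathbb X}$, a centered MAP with state space $\mathbb X\times\mathbb R^d$, $\mathbb X=\{1,\dots,N\}$, whose driving Markov process $\{X_t\}_{t\in\mathbb T}$ has transition semigroup $\{P_t\}_{t\in\mathbb T}$ with $P_1=P$. Assume: (1) For every $(k,\ell)\in\mathbb X^2$, the map $P\mapsto\mathcal Y^P_{k,\ell,1}$ is continuous from $\mathcal P_0$ (with the distance $\|P-P'\|_\infty$) into the set of bounded positive measures on $\mathbb R^d$ equipped with the total variation distance. (2) There exist constants $\alpha,\beta>0$ such that $\alpha\|\zeta\|^2\le\langle\zeta,\Sigma^P\zeta\rangle\le\beta\|\zeta\|^2$ for all $P\in\mathcal P_0$ and $\zeta\in\mathbb R^d$. (3a) $\sup_{P\in\mathcal P_0}\max_{k\in\mathbb X}\sup_{v\in(0,1]\cap\mathbb T}\mathbb E_k^P[\|Y_v\|^3]<\infty$. (3b) There exist $c>0$ and $\rho\in(0,1)$ such that $\sup_{P\in\mathcal P_0}\|\mathcal M^P_t(1_{\mathbb R^d})\|_0\le c\rho^t$ for all $t\in\mathbb T$, $t>0$, and there exists $t_0>0$ such that $\rho^{t_0}\max(2,cN)\le 1/4$ and $$\sup_{P\in\mathcal P_0}\ \sup_{w\in[t_0,2t_0)\cap\mathbb T}\|\widehat{G^P_w}(\zeta)\|_0\longrightarrow 0\quad\text{when }\|\zeta\|\to+\infty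 .$$ (3c) For every $t\in\mathbb T$, $t>0$, there exists an open convex subset $\mathcal D_t$ of $\mathbb R^d$, with closure $\overline{\mathcal D}_t$ and $\partial\mathcal D_t:=\overline{\mathcal D}_t\setminus\mathcal D_t$, such that for every $P\in\mathcal P_0$ the function $G^P_t$ vanishes on $\mathbb R^d\setminus\overline{\mathcal D}_t$, is continuous on $\overline{\mathcal D}_t$ and differentiable on $\mathcal D_t$, and moreover $$\sup_{P\in\mathcal P_0}\sup_{t>0}\sup_{y\in\overline{\mathcal D}_t}\|G^P_t(y)\|_0<\infty,\qquad \sup_{P\in\mathcal P_0}\sup_{y\in\partial\mathcal D_t}\|G^P_t(y)\|_0=O\big(t^{-(d+1)/2}\big)\ \ (t\to+\infty),$$ $$\sup_{P\in\mathcal P_0}\sup_{t>0}\sup_{y\in\mathcal D_t}\Big\|\frac{\partial G^P_t}{\partial y_j}(y)\Big\|_0<\infty\qquad (j=1,\dots,d).$$ Then, for every $k\in\mathbb X$, the density $f^P_{k,t}$ of the absolutely continuous part of the probability distribution of $t^{-1/2}Y_t$ under $\mathbb P_k^P$ satisfies, when $t\to+\infty$, $$\sup_{P\in\mathcal P_0}\sup_{y\in\mathbb R^d}\big|f^P_{k,t}(y)-\eta_{\Sigma^P}(y)\big|=O(t^{-1/2})+O\Big(\sup_{P\in\mathcal P_0}\sup_{y\notin\mathcal D_t}\eta_{\Sigma^P}(t^{-1/2}y)\Big).$$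
   Context: $\mathbb T$ is $\mathbb N$ or $[0,\infty)$. $\mathcal P$ is the set of irreducible and aperiodic stochastic $N\times N$ matrices, with the topology of the distance $\|P-P'\|_\infty$ (matrix norm induced by the sup norm on $\mathbb C^N$). A Markov additive process (MAP) with state space $\mathbb X\times\mathbb R^d$ is a Markov process $\{(X_t,Y_t)\}_{t\in\mathbb T}$ whose transition semigroup $\{Q_t\}$ satisfies $Q_t(k,y;\{\ell\}\times B)=Q_t(k,0;\{\ell\}\times(B-y))$ for all $k,\ell\in\mathbb X$, $y\in\mathbb R^d$, Borel $B\subset\mathbb R^d$; $\{X_t\}$ is the driving Markov process, with transition semigroup $\{P_t\}$. $\mathbb P_k^P,\mathbb E_k^P$ denote probability and expectation given $X_0=k$ (and $Y_0=0$) for the MAP associated with $P$. Centered means $\sum_k\pi(k)\mathbb E_k^P[Y_1]=0$, where $\pi$ is the invariant probability measure of $P$. For $(k,\ell)\in\mathbb X^2$ and $t\in\mathbb T$, $\mathcal Y^P_{k,\ell,t}$ is the bounded positive measure $B\mapsto\mathbb P_k^P\{X_t=\ell,Y_t\in B\}$ on $\mathbb R^d$. Its Lebesgue decomposition with respect to Lebesgue measure is $\mathcal Y^P_{k,\ell,t}(B)=\int_B g^P_{k,\ell,t}(y)\,dy+\mu^P_{k,\ell,t}(B)$ with $\mu^P_{k,\ell,t}$ singular. Set $G^P_t(y)=(g^P_{k,\ell,t}(y))_{k,\ell}$ and $\mathcal M^P_t(1_B)=(\mu^P_{k,\ell,t}(B))_{k,\ell}$. Densities are defined up to null sets, and conditions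 and conclusions on them refer to a suitable version (the version of $G^P_t$ in the regularity assumption, with $f^P_{k,t}(y)=t^{d/2}\sum_{\ell}g^P_{k,\ell,t}(t^{1/2}y)$). $\widehat{G^P_t}(\zeta)=\int_{\mathbb R^d}e^{i\langle\zeta,y\rangle}G^P_t(y)\,dy$ (entrywise). For a matrix $A$, $\|A\|_0=\max_{k,\ell}|A_{k,\ell}|$. $\Sigma^P$ is the covariance matrix of the centered Gaussian law $\mathcal N(0,\Sigma^P)$ to which $t^{-1/2}Y_t$ converges in distribution as $t\to+\infty$ under $\mathbb P_k^P$ (this limit exists, by the central limit theorem for MAPs, when $P$ is irreducible and aperiodic and $\max_k\sup_{v\in(0,1]\cap\mathbb T}\mathbb E_k^P[\|Y_v\|^2]<\infty$). $\eta_\Sigma$ is the density of $\mathcal N(0,\Sigma)$ for invertible $\Sigma$. *)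

theory Defs
  imports "HOL-Probability.Probability"
begin

definition vec_sup_norm :: "complex ^ 'n \<Rightarrow> real" where
  "vec_sup_norm v = Max (range (\<lambda>i. cmod (v $ i)))"

definition mat_inf_norm :: "complex ^ 'n ^ 'n \<Rightarrow> real" where
  "mat_inf_norm A = (SUP v\<in>{v. vec_sup_norm v \<le> 1}. vec_sup_norm (A *v v))"

definition mat_inf_dist :: "real ^ 'n ^ 'n \<Rightarrow> real ^ 'n ^ 'n \<Rightarrow> real" where
  "mat_inf_dist P P' = mat_inf_norm (\<chi> k l. complex_of_real ((P - P') $ k $ l))"

definition stochastic :: "real ^ 'n ^ 'n \<Rightarrow> bool" where
  "stochastic P \<longleftrightarrow> (\<forall>k l. 0 \<le> P $ k $ l) \<and> (\<forall>k. (\<Sum>l\<in>UNIV. P $ k $ l) = 1)"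

text \<open>The operation \<open>^\<close> on vectors of vectors is componentwise, so it is not the matrix power.\<close>

definition mat_pow :: "real ^ 'n ^ 'n \<Rightarrow> nat \<Rightarrow> real ^ 'n ^ 'n" where
  "mat_pow P m = (((**) P) ^^ m) (mat 1)"

definition irreducible_mat :: "real ^ 'n ^ 'n \<Rightarrow> bool" where
  "irreducible_mat P \<longleftrightarrow> (\<forall>k l. \<exists>m. mat_pow P m $ k $ l > 0)"

definition aperiodic_mat :: "real ^ 'n ^ 'n \<Rightarrow> bool" where
  "aperiodic_mat P \<longleftrightarrow> (\<forall>k. Gcd {m. m \<ge> 1 \<and> mat_pow P m $ k $ k > 0} = 1)"

definition ergodic_mats :: "(real ^ 'n ^ 'n) set" where
  "ergodic_mats = {P. stochastic P \<and> irreducible_mat P \<and> aperiodic_mat P}"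

definition ergodic_topology :: "(real ^ 'n ^ 'n) topology" where
  "ergodic_topology = Metric_space.mtopology ergodic_mats mat_inf_dist"

definition invariant_prob :: "real ^ 'n ^ 'n \<Rightarrow> real ^ 'n \<Rightarrow> bool" where
  "invariant_prob P \<pi> \<longleftrightarrow>
     (\<forall>k. 0 \<le> \<pi> $ k) \<and> (\<Sum>k\<in>UNIV. \<pi> $ k) = 1 \<and> \<pi> v* P = \<pi>"

lemma vec_sup_norm_ge: "cmod (v $ i) \<le> vec_sup_norm v"
  by (auto simp: vec_sup_norm_def intro!: Max_ge)

lemma vec_sup_norm_le_iff: "vec_sup_norm v \<le> c \<longleftrightarrow> (\<forall>i. cmod (v $ i) \<le> c)"
  by (auto simp: vec_sup_norm_def)

lemma vec_sup_norm_nonneg: "0 \<le> vec_sup_norm v"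
  using vec_sup_norm_ge[of v undefined] norm_ge_zero[of "v $ undefined"] by linarith

lemma mat_inf_norm_bdd:
  fixes A :: "complex ^ 'n ^ 'n"
  shows "bdd_above ((\<lambda>v. vec_sup_norm (A *v v)) ` {v. vec_sup_norm v \<le> 1})"
proof (rule bdd_aboveI2)
  fix v :: "complex ^ 'n" assume "v \<in> {v. vec_sup_norm v \<le> 1}"
  then have v: "cmod (v $ j) \<le> 1" for j by (simp add: vec_sup_norm_le_iff)
  have "cmod ((A *v v) $ i) \<le> (\<Sum>i\<in>UNIV. \<Sum>j\<in>UNIV. cmod (A $ i $ j))" for i
  proof -
    have "cmod ((A *v v) $ i) \<le> (\<Sum>j\<in>UNIV. cmod (A $ i $ j * v $ j))"
      by (simp add: matrix_vector_mult_def norm_sum)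
    also have "\<dots> \<le> (\<Sum>j\<in>UNIV. cmod (A $ i $ j))"
      by (intro sum_mono) (simp add: norm_mult mult_left_le v)
    also have "\<dots> \<le> (\<Sum>i\<in>UNIV. \<Sum>j\<in>UNIV. cmod (A $ i $ j))"
      by (rule member_le_sum[where f = "\<lambda>i. \<Sum>j\<in>UNIV. cmod (A $ i $ j)"]) (auto intro: sum_nonneg)
    finally show ?thesis .
  qed
  then show "vec_sup_norm (A *v v) \<le> (\<Sum>i\<in>UNIV. \<Sum>j\<in>UNIV. cmod (A $ i $ j))"
    by (simp add: vec_sup_norm_le_iff)
qed

lemma vec_sup_norm_le_mat_inf_norm:
  "vec_sup_norm v \<le> 1 \<Longrightarrow> vec_sup_norm (A *v v) \<le> mat_inf_norm A"
  unfolding mat_inf_norm_def by (rule cSUP_upper[OF _ mat_inf_norm_bdd]) simp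

lemma vec_sup_norm_0: "vec_sup_norm 0 = 0"
  by (simp add: vec_sup_norm_def)

lemma mat_inf_norm_least:
  "(\<And>v. vec_sup_norm v \<le> 1 \<Longrightarrow> vec_sup_norm (A *v v) \<le> c) \<Longrightarrow> mat_inf_norm A \<le> c"
  unfolding mat_inf_norm_def
  by (rule cSUP_least) (auto intro!: exI[of _ 0] simp: vec_sup_norm_0)

lemma mat_entry_le_mat_inf_norm: "cmod (A $ k $ l) \<le> mat_inf_norm A"
proof -
  have 1: "vec_sup_norm (axis l 1) \<le> 1"
    by (auto simp: vec_sup_norm_le_iff axis_def)
  have "(A *v axis l 1) $ k = A $ k $ l"
    by (simp add: matrix_vector_mult_def axis_def if_distrib cong: if_cong)
  then have "cmod (A $ k $ l) \<le> vec_sup_norm (A *v axis l 1)"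
    by (metis vec_sup_norm_ge)
  then show ?thesis using vec_sup_norm_le_mat_inf_norm[OF 1, of A] by linarith
qed

lemma mat_inf_norm_nonneg: "0 \<le> mat_inf_norm A"
  using mat_entry_le_mat_inf_norm[of A undefined undefined]
    norm_ge_zero[of "A $ undefined $ undefined"] by linarith

lemma mat_inf_norm_minus: "mat_inf_norm (- A) = mat_inf_norm A"
proof -
  have "(- A) *v v = - (A *v v)" for v
    by (simp add: matrix_vector_mult_def vec_eq_iff sum_negf)
  then show ?thesis by (simp add: mat_inf_norm_def vec_sup_norm_def)
qed

lemma mat_inf_norm_triangle: "mat_inf_norm (A + B) \<le> mat_inf_norm A + mat_inf_norm B"
proof (rule mat_inf_norm_least)
  fix v :: "complex ^ 'a" assume v: "vec_sup_norm v \<le> 1"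
  have "cmod (((A + B) *v v) $ i) \<le> mat_inf_norm A + mat_inf_norm B" for i
  proof -
    have "((A + B) *v v) $ i = (A *v v) $ i + (B *v v) $ i"
      by (simp add: matrix_vector_mult_add_rdistrib)
    then have "cmod (((A + B) *v v) $ i) \<le> cmod ((A *v v) $ i) + cmod ((B *v v) $ i)"
      by (simp add: norm_triangle_ineq)
    also have "\<dots> \<le> vec_sup_norm (A *v v) + vec_sup_norm (B *v v)"
      by (intro add_mono vec_sup_norm_ge)
    also have "\<dots> \<le> mat_inf_norm A + mat_inf_norm B"
      by (intro add_mono vec_sup_norm_le_mat_inf_norm v)
    finally show ?thesis .
  qed
  then show "vec_sup_norm ((A + B) *v v) \<le> mat_inf_norm A + mat_inf_norm B"
    by (simp add: vec_sup_norm_le_iff)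
qed

lemma Metric_space_mat_inf_dist: "Metric_space M mat_inf_dist"
proof
  fix x y z :: "real ^ 'a ^ 'a"
  let ?c = "\<lambda>A::real ^ 'a ^ 'a. (\<chi> k l. complex_of_real (A $ k $ l)) :: complex ^ 'a ^ 'a"
  show "0 \<le> mat_inf_dist x y" by (simp add: mat_inf_dist_def mat_inf_norm_nonneg)
  have "?c (y - x) = - ?c (x - y)" by (simp add: vec_eq_iff)
  then show "mat_inf_dist x y = mat_inf_dist y x"
    by (simp only: mat_inf_dist_def mat_inf_norm_minus)
  show "mat_inf_dist x y = 0 \<longleftrightarrow> x = y"
  proof
    assume "mat_inf_dist x y = 0"
    then have "cmod (?c (x - y) $ k $ l) \<le> 0" for k l
      unfolding mat_inf_dist_def using mat_entry_le_mat_inf_norm[of "?c (x - y)" k l] by linarith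
    then show "x = y" by (simp add: vec_eq_iff flip: of_real_diff)
  next
    assume "x = y"
    then have "mat_inf_dist x y \<le> 0" unfolding mat_inf_dist_def
      by (intro mat_inf_norm_least)
        (simp add: vec_sup_norm_le_iff matrix_vector_mult_def)
    with \<open>0 \<le> mat_inf_dist x y\<close> show "mat_inf_dist x y = 0" by simp
  qed
  have "?c (x - z) = ?c (x - y) + ?c (y - z)" by (simp add: vec_eq_iff)
  then show "mat_inf_dist x z \<le> mat_inf_dist x y + mat_inf_dist y z"
    unfolding mat_inf_dist_def by (simp only: mat_inf_norm_triangle)
qed

definition bounded_measures :: "(real ^ 'd) measure set" where
  "bounded_measures = {\<mu>. sets \<mu> = sets borel \<and> finite_measure \<mu>}"

text \<open>The \<open>ennreal\<close>-valued supremum makes this nonnegative also outside \<open>bounded_measures\<close>.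
  On \<open>bounded_measures\<close> it is finite, and it lies between one half of the mass of
  \<open>\<bar>\<mu> - \<nu>\<bar>\<close> and that mass.\<close>

definition tv_dist :: "(real ^ 'd) measure \<Rightarrow> (real ^ 'd) measure \<Rightarrow> real" where
  "tv_dist \<mu> \<nu> = enn2real (SUP B\<in>sets borel. ennreal \<bar>measure \<mu> B - measure \<nu> B\<bar>)"

definition tv_topology :: "(real ^ 'd) measure topology" where
  "tv_topology = Metric_space.mtopology bounded_measures tv_dist"

lemma tv_dist_SUP:
  assumes "\<mu> \<in> bounded_measures" "\<nu> \<in> bounded_measures"
  shows "ennreal (tv_dist \<mu> \<nu>) = (SUP B\<in>sets borel. ennreal \<bar>measure \<mu> B - measure \<nu> B\<bar>)"
proof -
  interpret m: finite_measure \<mu> using assms by (simp add: bounded_measures_def)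
  interpret n: finite_measure \<nu> using assms by (simp add: bounded_measures_def)
  have "\<bar>measure \<mu> B - measure \<nu> B\<bar> \<le> measure \<mu> (space \<mu>) + measure \<nu> (space \<nu>)" for B
    using m.bounded_measure[of B] n.bounded_measure[of B]
      measure_nonneg[of \<mu> B] measure_nonneg[of \<nu> B] by linarith
  then have "(SUP B\<in>sets borel. ennreal \<bar>measure \<mu> B - measure \<nu> B\<bar>)
      \<le> ennreal (measure \<mu> (space \<mu>) + measure \<nu> (space \<nu>))"
    by (intro SUP_least ennreal_leI)
  then show ?thesis unfolding tv_dist_def
    by (intro ennreal_enn2real) (auto intro: le_less_trans)
qed

lemma Metric_space_tv_dist: "Metric_space bounded_measures tv_dist"
proof
  fix \<mu> \<nu> \<kappa> :: "(real ^ 'd) measure"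
  show "0 \<le> tv_dist \<mu> \<nu>" by (simp add: tv_dist_def)
  show "tv_dist \<mu> \<nu> = tv_dist \<nu> \<mu>" by (simp add: tv_dist_def abs_minus_commute)
  have le: "\<bar>measure \<mu> B - measure \<nu> B\<bar> \<le> tv_dist \<mu> \<nu>"
    if "\<mu> \<in> bounded_measures" "\<nu> \<in> bounded_measures" "B \<in> sets borel"
    for \<mu> \<nu> :: "(real ^ 'd) measure" and B
  proof -
    have "ennreal \<bar>measure \<mu> B - measure \<nu> B\<bar> \<le> ennreal (tv_dist \<mu> \<nu>)"
      unfolding tv_dist_SUP[OF that(1,2)] by (rule SUP_upper) fact
    then show ?thesis by (simp add: ennreal_le_iff tv_dist_def)
  qed
  assume m: "\<mu> \<in> bounded_measures" and n: "\<nu> \<in> bounded_measures"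
  show "tv_dist \<mu> \<nu> = 0 \<longleftrightarrow> \<mu> = \<nu>"
  proof
    assume 0: "tv_dist \<mu> \<nu> = 0"
    interpret m: finite_measure \<mu> using m by (simp add: bounded_measures_def)
    interpret n: finite_measure \<nu> using n by (simp add: bounded_measures_def)
    show "\<mu> = \<nu>"
    proof (rule measure_eqI)
      show "sets \<mu> = sets \<nu>" using m n by (simp add: bounded_measures_def)
      fix B assume "B \<in> sets \<mu>"
      then have "B \<in> sets borel" using m by (simp add: bounded_measures_def)
      from le[OF m n this] 0 show "emeasure \<mu> B = emeasure \<nu> B"
        by (simp add: m.emeasure_eq_measure n.emeasure_eq_measure)
    qed
  next
    assume "\<mu> = \<nu>" then show "tv_dist \<mu> \<nu> = 0"
      by (simp add: tv_dist_def SUP_constant bot_ennreal)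
  qed
  assume k: "\<kappa> \<in> bounded_measures"
  have "ennreal (tv_dist \<mu> \<kappa>) \<le> ennreal (tv_dist \<mu> \<nu> + tv_dist \<nu> \<kappa>)"
    unfolding tv_dist_SUP[OF m k]
  proof (intro SUP_least ennreal_leI)
    fix B :: "(real ^ 'd) set" assume B: "B \<in> sets borel"
    show "\<bar>measure \<mu> B - measure \<kappa> B\<bar> \<le> tv_dist \<mu> \<nu> + tv_dist \<nu> \<kappa>"
      using le[OF m n B] le[OF n k B] by linarith
  qed
  then show "tv_dist \<mu> \<kappa> \<le> tv_dist \<mu> \<nu> + tv_dist \<nu> \<kappa>"
    by (subst (asm) ennreal_le_iff) (auto simp: tv_dist_def)
qed

definition lebesgue_singular :: "(real ^ 'd) measure \<Rightarrow> bool" where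
  "lebesgue_singular \<mu> \<longleftrightarrow> sets \<mu> = sets borel \<and> (\<exists>Z\<in>null_sets lborel. emeasure \<mu> (UNIV - Z) = 0)"

text \<open>The density \<open>g\<close> is one chosen (everywhere nonnegative, Borel) version.\<close>

definition lebesgue_decomposition ::
  "(real ^ 'd) measure \<Rightarrow> (real ^ 'd \<Rightarrow> real) \<Rightarrow> (real ^ 'd) measure \<Rightarrow> bool" where
  "lebesgue_decomposition \<nu> g \<mu> \<longleftrightarrow>
     g \<in> borel_measurable borel \<and> (\<forall>y. 0 \<le> g y) \<and> lebesgue_singular \<mu> \<and>
     (\<forall>B\<in>sets borel. emeasure \<nu> B = (\<integral>\<^sup>+y\<in>B. ennreal (g y) \<partial>lborel) + emeasure \<mu> B)"

text \<open>The description by the characteristic function includes degenerate Gaussian laws.\<close>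

definition centered_gaussian :: "real ^ 'd ^ 'd \<Rightarrow> (real ^ 'd) measure \<Rightarrow> bool" where
  "centered_gaussian S \<nu> \<longleftrightarrow>
     prob_space \<nu> \<and> sets \<nu> = sets borel \<and> transpose S = S \<and>
     (\<forall>\<zeta>. (LINT y|\<nu>. cis (\<zeta> \<bullet> y)) = complex_of_real (exp (- (\<zeta> \<bullet> (S *v \<zeta>)) / 2)))"

definition gaussian_density :: "real ^ 'd ^ 'd \<Rightarrow> real ^ 'd \<Rightarrow> real" where
  "gaussian_density S y =
     exp (- (y \<bullet> (matrix_inv S *v y)) / 2) / ((2 * pi) powr (real CARD('d) / 2) * sqrt (det S))"

definition converges_weakly ::
  "('a \<Rightarrow> (real ^ 'd) measure) \<Rightarrow> (real ^ 'd) measure \<Rightarrow> 'a filter \<Rightarrow> bool" where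
  "converges_weakly \<mu> \<nu> F \<longleftrightarrow>
     (\<forall>h :: real ^ 'd \<Rightarrow> real. continuous_on UNIV h \<and> bounded (range h) \<longrightarrow>
        ((\<lambda>t. LINT y|\<mu> t. h y) \<longlongrightarrow> (LINT y|\<nu>. h y)) F)"

text \<open>Time ranges over a set \<open>T\<close> of reals, namely the natural numbers or the nonnegative reals;
  this is the filter of \<open>t \<rightarrow> \<infinity>\<close> along \<open>T\<close>.\<close>

abbreviation at_top_along :: "real set \<Rightarrow> real filter" where
  "at_top_along T \<equiv> inf at_top (principal T)"

abbreviation map_space :: "('n \<times> (real ^ 'd)) measure" where
  "map_space \<equiv> count_space UNIV \<Otimes>\<^sub>M borel"

definition transition_semigroup ::
  "real set \<Rightarrow> (real \<Rightarrow> 'n::finite \<times> (real ^ 'd) \<Rightarrow> ('n \<times> (real ^ 'd)) measure) \<Rightarrow> bool" where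
  "transition_semigroup T Q \<longleftrightarrow>
     (\<forall>t\<in>T. Q t \<in> map_space \<rightarrow>\<^sub>M prob_algebra map_space) \<and>
     (\<forall>z. Q 0 z = return map_space z) \<and>
     (\<forall>s\<in>T. \<forall>t\<in>T. \<forall>z. Q (s + t) z = Q s z \<bind> Q t)"

definition additive_semigroup ::
  "real set \<Rightarrow> (real \<Rightarrow> 'n::finite \<times> (real ^ 'd) \<Rightarrow> ('n \<times> (real ^ 'd)) measure) \<Rightarrow> bool" where
  "additive_semigroup T Q \<longleftrightarrow>
     (\<forall>t\<in>T. \<forall>k l y. \<forall>B\<in>sets borel.
        emeasure (Q t (k, y)) ({l} \<times> B) = emeasure (Q t (k, 0)) ({l} \<times> ((\<lambda>z. z - y) ` B)))"

definition past ::
  "real set \<Rightarrow> 'w measure \<Rightarrow> (real \<Rightarrow> 'w \<Rightarrow> 'n::finite) \<Rightarrow> (real \<Rightarrow> 'w \<Rightarrow> real ^ 'd) \<Rightarrow> real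
     \<Rightarrow> 'w set set" where
  "past T M X Y s = sigma_sets (space M)
     {(\<lambda>\<omega>. (X u \<omega>, Y u \<omega>)) -` C \<inter> space M | u C. u \<in> T \<and> u \<le> s \<and> C \<in> sets map_space}"

text \<open>\<open>Pr k\<close> is the law under which the process starts at \<open>(k, 0)\<close>.\<close>

definition markov_additive_process ::
  "real set \<Rightarrow> (real \<Rightarrow> 'n::finite \<times> (real ^ 'd) \<Rightarrow> ('n \<times> (real ^ 'd)) measure)
     \<Rightarrow> ('n \<Rightarrow> 'w measure) \<Rightarrow> (real \<Rightarrow> 'w \<Rightarrow> 'n) \<Rightarrow> (real \<Rightarrow> 'w \<Rightarrow> real ^ 'd) \<Rightarrow> bool" where
  "markov_additive_process T Q Pr X Y \<longleftrightarrow>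
     transition_semigroup T Q \<and> additive_semigroup T Q \<and>
     (\<forall>k l. sets (Pr k) = sets (Pr l)) \<and>
     (\<forall>k. prob_space (Pr k) \<and>
        (\<forall>t\<in>T. X t \<in> Pr k \<rightarrow>\<^sub>M count_space UNIV \<and> Y t \<in> Pr k \<rightarrow>\<^sub>M borel) \<and>
        (AE \<omega> in Pr k. X 0 \<omega> = k \<and> Y 0 \<omega> = 0) \<and>
        (\<forall>s\<in>T. \<forall>t\<in>T. \<forall>A\<in>past T (Pr k) X Y s. \<forall>C\<in>sets map_space.
           emeasure (Pr k) {\<omega> \<in> A. (X (s + t) \<omega>, Y (s + t) \<omega>) \<in> C}
           = (\<integral>\<^sup>+\<omega>\<in>A. emeasure (Q t (X s \<omega>, Y s \<omega>)) C \<partial>Pr k)))"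

definition driving_semigroup ::
  "(real \<Rightarrow> 'n::finite \<times> (real ^ 'd) \<Rightarrow> ('n \<times> (real ^ 'd)) measure) \<Rightarrow> real \<Rightarrow> real ^ 'n ^ 'n" where
  "driving_semigroup Q t = (\<chi> k l. measure (Q t (k, 0)) ({l} \<times> UNIV))"

text \<open>For irreducible \<open>P\<close> the invariant probability exists and is unique, so the existential
  quantifier only names it.\<close>

definition centered_MAP ::
  "real ^ 'n ^ 'n \<Rightarrow> ('n \<Rightarrow> 'w measure) \<Rightarrow> (real \<Rightarrow> 'w \<Rightarrow> real ^ 'd) \<Rightarrow> bool" where
  "centered_MAP P Pr Y \<longleftrightarrow>
     (\<forall>k. integrable (Pr k) (Y 1)) \<and>
     (\<exists>\<pi>. invariant_prob P \<pi> \<and> (\<Sum>k\<in>UNIV. (\<pi> $ k) *\<^sub>R (LINT \<omega>|Pr k. Y 1 \<omega>)) = 0)"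

definition additive_law ::
  "('n \<Rightarrow> 'w measure) \<Rightarrow> (real \<Rightarrow> 'w \<Rightarrow> 'n::finite) \<Rightarrow> (real \<Rightarrow> 'w \<Rightarrow> real ^ 'd)
     \<Rightarrow> real \<Rightarrow> 'n \<Rightarrow> 'n \<Rightarrow> (real ^ 'd) measure" where
  "additive_law Pr X Y t k l =
     distr (restrict_space (Pr k) {\<omega> \<in> space (Pr k). X t \<omega> = l}) borel (Y t)"

definition asymptotic_covariance ::
  "real set \<Rightarrow> ('n::finite \<Rightarrow> 'w measure) \<Rightarrow> (real \<Rightarrow> 'w \<Rightarrow> real ^ 'd) \<Rightarrow> real ^ 'd ^ 'd \<Rightarrow> bool" where
  "asymptotic_covariance T Pr Y S \<longleftrightarrow>
     (\<exists>\<nu>. centered_gaussian S \<nu> \<and>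
        (\<forall>k. converges_weakly (\<lambda>t. distr (Pr k) borel (\<lambda>\<omega>. t powr (- 1 / 2) *\<^sub>R Y t \<omega>)) \<nu>
               (at_top_along T)))"

definition mat_max_norm :: "'a::real_normed_vector ^ 'n ^ 'n \<Rightarrow> real" where
  "mat_max_norm A = Max {norm (A $ k $ l) | k l. True}"

definition mat_fourier :: "(real ^ 'd \<Rightarrow> real ^ 'n ^ 'n) \<Rightarrow> real ^ 'd \<Rightarrow> complex ^ 'n ^ 'n" where
  "mat_fourier G \<zeta> =
     (\<chi> k l. LINT y|lborel. cis (\<zeta> \<bullet> y) * complex_of_real (G y $ k $ l))"

definition partial_deriv ::
  "'d \<Rightarrow> (real ^ 'd \<Rightarrow> 'a::real_normed_vector) \<Rightarrow> real ^ 'd \<Rightarrow> 'a" where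
  "partial_deriv j F y = vector_derivative (\<lambda>s. F (y + s *\<^sub>R axis j 1)) (at 0)"

text \<open>If \<open>G t\<close> is the matrix of densities of the absolutely continuous parts of the measures
  \<open>B \<mapsto> Pr k {X t = l, Y t \<in> B}\<close>, this is the density of the absolutely continuous part of
  the law of \<open>t\<^bsup>-1/2\<^esup> Y t\<close> under \<open>Pr k\<close> (sum over \<open>l\<close>, then change of variables).\<close>

definition rescaled_density ::
  "(real \<Rightarrow> real ^ 'd \<Rightarrow> real ^ 'n ^ 'n) \<Rightarrow> 'n \<Rightarrow> real \<Rightarrow> real ^ 'd \<Rightarrow> real" where
  "rescaled_density G k t y =
     t powr (real CARD('d) / 2) * (\<Sum>l\<in>UNIV. G t (t powr (1 / 2) *\<^sub>R y) $ k $ l)"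

end

(*
  Let Phi_t(zeta) be the matrix of the Fourier transforms of the measures P_k{X_t = l, Y_t in dy};
  it is a multiplicative semigroup in t.

  Large frequencies. For a fixed large n every entry of Phi_n(zeta) is the transform of a measure
  that has an absolutely continuous part of mass at least theta/2 and with bounded density. The set
  where the phase zeta.y is close to a given angle has small volume in a ball, uniformly in
  |zeta| >= delta, so the row sums of |Phi_n(zeta)| are at most 1 - kappa, uniformly in P;
  compactness gives the uniform minorization of the powers of P that this needs.

  Small frequencies. Two Poisson equations give v = 1 + i tau u + tau^2 w with
  Phi_1(tau xi) v = (1 - tau^2 h) v + O(tau^3). The norm |pi(x)| + ||x - pi(x) v|| is contracted by
  a power of Phi_1(tau xi), with rate 1 - c tau^2, and iterating gives Phi_t(zeta) 1 up to
  O(|zeta| + t |zeta|^3) exp(-c t |zeta|^2), without perturbation theory of eigenvalues.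
  The central limit theorem identifies h as half of the variance <xi, Sigma xi>.

  Densities. Convolving the law of Y_t with a Gaussian of width t^(-d-1) makes the Fourier
  inversion absolutely convergent and costs only a factor t^(d(d+1)) on exponentially small terms,
  the singular part among them. The Lipschitz bound on the density controls the effect of the
  smoothing at distance at least t^(-(d+1)/2) from the boundary of D_t; nearer to it, the density is
  compared with its boundary values.
*)
theory Submission
  imports Defs
begin

section \<open>Linear changes of variables and Gaussian integrals\<close>

text \<open>Scaling by t^(d/2) turns an error t^(-(d+1)/2) for the density of Y_t itself into the
  claimed t^(-1/2); this fixes w = t^(-(d+1)/2) as the precision of every unscaled estimate. The
  density is Lipschitz on the closure of D_t but may jump across its boundary, so a point at
  distance w from the complement sees a Lipschitz constant of order 1/w. A kernel of width w^2 then
  costs O(w), which is the origin of t^(-d-1). A closer point is compared with a boundary point,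
  where the density is O(w) and the value of the Gaussian is left over; this is the second error
  term. Uniformity in P is the obstacle throughout. All constants are explicit in numbers common to
  the compact set: m and theta with P^m >= theta entrywise, the third moment bound M, the lower
  bound alpha of the covariances, the bounds on the densities and the gap kappa. Real times are
  reduced to integer ones: the fractional part contributes O(|zeta|) at small frequencies, and an
  incomplete block costs a constant factor at large ones.\<close>

lemma measurable_vec_lambda:
  fixes f :: "'d::finite \<Rightarrow> 'a \<Rightarrow> real"
  assumes "\<And>i. f i \<in> borel_measurable M"
  shows "(\<lambda>x. (\<chi> i. f i x)) \<in> borel_measurable M"
  by (subst borel_measurable_euclidean_space)
     (use assms in \<open>auto simp: Basis_vec_def inner_axis\<close>)

text \<open>In this form, with the product measure indexed by \<open>Basis\<close>, Fubini can
  isolate a single coordinate.\<close>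

lemma nn_integral_lborel_coordinates:
  fixes f :: "real^'d \<Rightarrow> ennreal"
  assumes [measurable]: "f \<in> borel_measurable borel"
  shows "(\<integral>\<^sup>+x. f x \<partial>lborel) = (\<integral>\<^sup>+g. f (\<chi> i. g (axis i 1)) \<partial>(\<Pi>\<^sub>M b\<in>(Basis::(real^'d) set). lborel))"
proof -
  have "(\<Sum>b\<in>Basis. g b *\<^sub>R b) = (\<chi> i. g (axis i 1))" for g :: "real^'d \<Rightarrow> real"
  proof -
    have "(\<Sum>b\<in>Basis. g b *\<^sub>R b) \<bullet> axis i 1 = g (axis i 1)" for i :: 'd
      by (rule inner_sum_left_Basis) simp
    then show ?thesis by (simp add: vec_eq_iff inner_axis)
  qed
  moreover have "(\<integral>\<^sup>+x. f x \<partial>lborel)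
      = (\<integral>\<^sup>+g. f (\<Sum>b\<in>Basis. g b *\<^sub>R b) \<partial>(\<Pi>\<^sub>M b\<in>(Basis::(real^'d) set). lborel))"
    by (subst lborel_eq, subst nn_integral_distr) auto
  ultimately show ?thesis by simp
qed

lemma measurable_matrix_vector_mult [measurable]:
  "((*v) A :: real^'d \<Rightarrow> real^'d) \<in> borel_measurable borel"
  by (intro borel_measurable_continuous_onI linear_continuous_on linear_conv_bounded_linear[THEN iffD1] matrix_vector_mul_linear)

text \<open>Once coordinate \<open>m\<close> is split off by Fubini, the shear translates it by the
  fixed number x_n, and one-dimensional Lebesgue measure is translation invariant.\<close>

lemma nn_integral_lborel_shear:
  fixes f :: "real^'d \<Rightarrow> ennreal"
  assumes [measurable]: "f \<in> borel_measurable borel" and mn: "m \<noteq> n"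
  shows "(\<integral>\<^sup>+x. f (x + x $ n *\<^sub>R axis m 1) \<partial>lborel) = (\<integral>\<^sup>+x. f x \<partial>lborel)"
proof -
  interpret P: product_sigma_finite "\<lambda>b::real^'d. lborel :: real measure" ..
  let ?I = "Basis - {axis m 1} :: (real^'d) set"
  have ins: "insert (axis m 1) ?I = Basis" by auto
  have [measurable]: "(\<lambda>x. (\<chi> i. x (axis i 1)) :: real^'d) \<in> borel_measurable (Pi\<^sub>M (Basis::(real^'d) set) (\<lambda>b. lborel))"
    by (rule measurable_vec_lambda) (auto intro!: measurable_component_singleton[THEN measurable_compose, of _ _ _ "\<lambda>x. x"])
  have ne: "axis n 1 \<noteq> (axis m 1 :: real^'d)" using mn by (simp add: axis_eq_axis)
  have [measurable]: "(\<lambda>x. x + x $ n *\<^sub>R axis m 1) \<in> borel_measurable (borel :: (real^'d) measure)"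
    by (intro borel_measurable_continuous_onI continuous_intros)
  have split: "(\<integral>\<^sup>+x. h x \<partial>lborel) =
      (\<integral>\<^sup>+x. \<integral>\<^sup>+y. h (\<chi> i. (x(axis m 1 := y)) (axis i 1)) \<partial>lborel \<partial>Pi\<^sub>M ?I (\<lambda>b. lborel))"
    if [measurable]: "h \<in> borel_measurable borel" for h :: "real^'d \<Rightarrow> ennreal"
    unfolding nn_integral_lborel_coordinates[OF that]
    by (subst ins[symmetric], subst P.product_nn_integral_insert) (auto simp: ins insert_absorb)
  have upd: "(\<chi> i. (x(axis m 1 := y)) (axis i 1)) + (\<chi> i. (x(axis m 1 := y)) (axis i 1)) $ n *\<^sub>R axis m 1
     = (\<chi> i. (x(axis m 1 := x (axis n 1) + 1 * y)) (axis i 1))" for x :: "real^'d \<Rightarrow> real" and y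
    using mn by (auto simp: vec_eq_iff axis_eq_axis axis_def)
  show ?thesis
    apply (subst split, measurable)
    apply (subst split, measurable)
    apply (subst upd)
  proof (rule nn_integral_cong)
    fix x :: "real^'d \<Rightarrow> real" assume x: "x \<in> space (Pi\<^sub>M ?I (\<lambda>b. lborel))"
    have m: "(\<lambda>y. f (\<chi> i. (x(axis m 1 := y)) (axis i 1))) \<in> borel_measurable borel"
      by (intro measurable_compose[OF measurable_vec_lambda assms(1)]) auto
    show "(\<integral>\<^sup>+y. f (\<chi> i. (x(axis m 1 := x (axis n 1) + 1 * y)) (axis i 1)) \<partial>lborel)
        = (\<integral>\<^sup>+y. f (\<chi> i. (x(axis m 1 := y)) (axis i 1)) \<partial>lborel)"
      using nn_integral_real_affine[OF m, of 1 "x (axis n 1)"] by simp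
  qed
qed

text \<open>The formula is compatible with products of matrices, so elementary factors suffice:
  diagonal matrices scale the axes, transpositions permute the sides of boxes, shears preserve the
  integral. A zero row is excluded by the determinant.\<close>

lemma nn_integral_lborel_linear:
  fixes A :: "real^'d^'d" and f :: "real^'d \<Rightarrow> ennreal"
  assumes "f \<in> borel_measurable borel" "det A \<noteq> 0"
  shows "ennreal \<bar>det A\<bar> * (\<integral>\<^sup>+x. f (A *v x) \<partial>lborel) = (\<integral>\<^sup>+x. f x \<partial>lborel)"
proof -
  \<comment> \<open>The function is quantified inside the induction because the product case applies
    the hypothesis for \<open>B\<close> to the function x -> f(A x).\<close>
  have "det A \<noteq> 0 \<longrightarrow> (\<forall>f\<in>borel_measurable borel.
      ennreal \<bar>det A\<bar> * (\<integral>\<^sup>+x. f (A *v x) \<partial>lborel) = (\<integral>\<^sup>+x. f x \<partial>lborel))"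
  proof (induction A rule: induct_matrix_elementary_alt)
    case (1 A B)
    show ?case
    proof (intro impI ballI)
      fix f :: "real^'d \<Rightarrow> ennreal" assume f [measurable]: "f \<in> borel_measurable borel" and "det (A ** B) \<noteq> 0"
      then have d: "det A \<noteq> 0" "det B \<noteq> 0" by (auto simp: det_mul)
      have "ennreal \<bar>det (A ** B)\<bar> * (\<integral>\<^sup>+x. f ((A ** B) *v x) \<partial>lborel)
         = ennreal \<bar>det A\<bar> * (ennreal \<bar>det B\<bar> * (\<integral>\<^sup>+x. f (A *v (B *v x)) \<partial>lborel))"
        by (simp add: det_mul abs_mult ennreal_mult matrix_vector_mul_assoc mult.assoc)
      also have "ennreal \<bar>det B\<bar> * (\<integral>\<^sup>+x. f (A *v (B *v x)) \<partial>lborel) = (\<integral>\<^sup>+x. f (A *v x) \<partial>lborel)"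
        using 1(2) d(2) by (auto dest!: bspec[where x="\<lambda>x. f (A *v x)"])
      also have "ennreal \<bar>det A\<bar> * \<dots> = (\<integral>\<^sup>+x. f x \<partial>lborel)" using 1(1) d(1) f by auto
      finally show "ennreal \<bar>det (A ** B)\<bar> * (\<integral>\<^sup>+x. f ((A ** B) *v x) \<partial>lborel) = (\<integral>\<^sup>+x. f x \<partial>lborel)" .
    qed
  next
    case (2 A i)
    then show ?case by (metis det_zero_row(1))
  next
    case (3 A)
    show ?case
    proof (intro impI ballI)
      fix f :: "real^'d \<Rightarrow> ennreal" assume f [measurable]: "f \<in> borel_measurable borel" and d: "det A \<noteq> 0"
      have det: "det A = (\<Prod>i\<in>UNIV. A $ i $ i)" using 3 by (rule det_diagonal)
      \<comment> \<open>\<open>c\<close> reads the diagonal entry of \<open>A\<close> off a standard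
        basis vector, the form in which \<open>lborel_affine_euclidean\<close> takes its scaling
        factors.\<close>
      define c where "c b = A $ (THE i. b = axis i 1) $ (THE i. b = axis i (1::real))" for b :: "real^'d"
      have c: "c (axis i 1) = A $ i $ i" for i by (simp add: c_def axis_eq_axis)
      have nz: "c b \<noteq> 0" if b: "b \<in> Basis" for b
        using b d c by (auto simp: Basis_vec_def det)
      have bas: "(Basis :: (real^'d) set) = (\<lambda>i. axis i 1) ` UNIV" by (auto simp: Basis_vec_def)
      have inj: "inj (\<lambda>i. axis i (1::real) :: real^'d)" by (auto simp: inj_on_def axis_eq_axis)
      have T: "0 + (\<Sum>j\<in>Basis. (c j * (x \<bullet> j)) *\<^sub>R j) = A *v x" for x
      proof -
        have "(\<Sum>j\<in>Basis. (c j * (x \<bullet> j)) *\<^sub>R j) = (\<Sum>i\<in>UNIV. (A $ i $ i * x $ i) *\<^sub>R axis i 1)"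
          unfolding bas by (subst sum.reindex[OF inj]) (simp add: c inner_axis)
        also have "\<dots> = A *v x"
        proof (subst vec_eq_iff, intro allI)
          fix k
          have "(A *v x) $ k = (\<Sum>j\<in>UNIV. if j = k then A $ k $ k * x $ k else 0)"
            unfolding matrix_vector_mult_def vec_lambda_beta by (intro sum.cong refl) (simp add: 3)
          moreover have "(\<Sum>i\<in>UNIV. (A $ i $ i * x $ i) *\<^sub>R axis i 1) $ k = (\<Sum>j\<in>UNIV. if j = k then A $ k $ k * x $ k else 0)"
            unfolding sum_component by (intro sum.cong refl) (simp add: axis_def)
          ultimately show "(\<Sum>i\<in>UNIV. (A $ i $ i * x $ i) *\<^sub>R axis i 1) $ k = (A *v x) $ k" by simp
        qed
        finally show ?thesis by simp
      qed
      have p: "(\<Prod>j\<in>(Basis::(real^'d) set). \<bar>c j\<bar>) = \<bar>det A\<bar>"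
        unfolding bas by (subst prod.reindex[OF inj]) (simp add: c det abs_prod)
      have "(lborel :: (real^'d) measure) = density (distr lborel borel (\<lambda>x. 0 + (\<Sum>j\<in>Basis. (c j * (x \<bullet> j)) *\<^sub>R j))) (\<lambda>_. (\<Prod>j\<in>Basis. \<bar>c j\<bar>))"
        by (rule lborel_affine_euclidean[of c 0, OF nz])
      also have "\<dots> = density (distr lborel borel ((*v) A)) (\<lambda>_. ennreal \<bar>det A\<bar>)"
        unfolding T p ..
      finally have L: "(lborel :: (real^'d) measure) = \<dots>" .
      show "ennreal \<bar>det A\<bar> * (\<integral>\<^sup>+x. f (A *v x) \<partial>lborel) = (\<integral>\<^sup>+x. f x \<partial>lborel)"
        by (subst (2) L) (simp add: nn_integral_density nn_integral_distr nn_integral_cmult)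
    qed
  next
    case (4 m n)
    let ?A = "(\<chi> i j. mat 1 $ i $ Transposition.transpose m n j) :: real^'d^'d"
    have s: "?A *v x = (\<chi> i. x $ Transposition.transpose m n i)" for x
    proof -
      have "(\<Sum>j\<in>UNIV. mat 1 $ i $ Transposition.transpose m n j * x $ j) = x $ Transposition.transpose m n i" for i
      proof -
        have "(\<Sum>j\<in>UNIV. mat 1 $ i $ Transposition.transpose m n j * x $ j)
            = (\<Sum>j\<in>UNIV. if j = Transposition.transpose m n i then x $ j else 0)"
          by (intro sum.cong refl) (auto simp: mat_def transpose_involutory)
        then show ?thesis by simp
      qed
      then show ?thesis by (simp add: matrix_vector_mult_def)
    qed
    have dt: "\<bar>det ?A\<bar> = 1"
    proof -
      have "det ?A = of_int (sign (Transposition.transpose m n)) * det (mat 1 :: real^'d^'d)"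
        by (rule det_permute_columns) (simp add: permutes_swap_id)
      then show ?thesis by (simp add: sign_swap_id)
    qed
    have L: "(lborel :: (real^'d) measure) = distr lborel borel ((*v) ?A)"
    proof (rule lborel_eqI)
      fix l u :: "real^'d" assume lu: "\<And>b. b \<in> Basis \<Longrightarrow> l \<bullet> b \<le> u \<bullet> b"
      let ?t = "Transposition.transpose m n"
      let ?s = "\<lambda>x::real^'d. \<chi> i. x $ ?t i"
      have pre: "(*v) ?A -` box l u = box (?s l) (?s u)"
        unfolding s by (auto simp: mem_box_cart) (metis transpose_involutory)+
      have le: "l $ i \<le> u $ i" for i using lu[of "axis i 1"] by (simp add: inner_axis)
      have "emeasure (distr lborel borel ((*v) ?A)) (box l u) = emeasure lborel (box (?s l) (?s u))"
        by (subst emeasure_distr) (auto simp: pre)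
      also have "\<dots> = (\<Prod>b\<in>Basis. (?s u - ?s l) \<bullet> b)"
        by (subst emeasure_lborel_box) (auto simp: Basis_vec_def inner_axis le)
      also have "(\<Prod>b\<in>Basis. (?s u - ?s l) \<bullet> b) = (\<Prod>i\<in>UNIV. (u - l) $ ?t i)"
        by (rule prod.reindex_bij_witness[where i="\<lambda>i. axis i 1" and j="\<lambda>b. THE i. b = axis i 1"])
           (auto simp: Basis_vec_def inner_axis axis_eq_axis)
      also have "\<dots> = (\<Prod>i\<in>UNIV. (u - l) $ i)"
        by (rule prod.reindex_bij_witness[where i="?t" and j="?t"]) auto
      also have "\<dots> = (\<Prod>b\<in>Basis. (u - l) \<bullet> b)"
        by (rule prod.reindex_bij_witness[where j="\<lambda>i. axis i 1" and i="\<lambda>b. THE i. b = axis i 1"])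
           (auto simp: Basis_vec_def inner_axis axis_eq_axis)
      finally show "emeasure (distr lborel borel ((*v) ?A)) (box l u) = (\<Prod>b\<in>Basis. (u - l) \<bullet> b)" .
    qed simp
    show ?case
    proof (intro impI ballI)
      fix f :: "real^'d \<Rightarrow> ennreal" assume f [measurable]: "f \<in> borel_measurable borel"
      have "(\<integral>\<^sup>+x. f x \<partial>lborel) = (\<integral>\<^sup>+x. f (?A *v x) \<partial>lborel)"
        by (subst L) (simp add: nn_integral_distr)
      then show "ennreal \<bar>det ?A\<bar> * (\<integral>\<^sup>+x. f (?A *v x) \<partial>lborel) = (\<integral>\<^sup>+x. f x \<partial>lborel)"
        unfolding dt by simp
    qed
  next
    case (5 m n)
    let ?A = "(\<chi> i j. of_bool (i = m \<and> j = n \<or> i = j)) :: real^'d^'d"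
    have s: "?A *v x = x + x $ n *\<^sub>R axis m 1" for x
    proof -
      have "(\<Sum>j\<in>UNIV. of_bool (i = m \<and> j = n \<or> i = j) * x $ j) = x $ i + x $ n * (if i = m then 1 else 0)" for i
      proof -
        have "(\<Sum>j\<in>UNIV. of_bool (i = m \<and> j = n \<or> i = j) * x $ j)
            = (\<Sum>j\<in>UNIV. (if j = i then x $ i else 0) + (if j = n then (if i = m then x $ n else 0) else 0))"
          using 5 by (intro sum.cong refl) auto
        then show ?thesis by (simp add: sum.distrib)
      qed
      then show ?thesis by (auto simp: matrix_vector_mult_def vec_eq_iff axis_def)
    qed
    have dt: "det ?A = 1"
    proof -
      have "?A = (\<chi> k. if k = m then row m (mat 1) + 1 *s row n (mat 1) else row k (mat 1))"
        using 5 by (auto simp: vec_eq_iff row_def mat_def)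
      also have "det \<dots> = det (mat 1 :: real^'d^'d)" by (rule det_row_operation[OF 5])
      finally show ?thesis by simp
    qed
    show ?case unfolding s dt using nn_integral_lborel_shear[OF _ 5] by auto
  qed
  then show ?thesis using assms by blast
qed

text \<open>Stated as an identity of measures, the change of variables passes from nonnegative
  functions to Bochner integrals.\<close>

lemma lborel_linear:
  fixes A :: "real^'d^'d"
  assumes "det A \<noteq> 0"
  shows "lborel = density (distr lborel borel ((*v) A)) (\<lambda>_. ennreal \<bar>det A\<bar>)"
proof (rule measure_eqI)
  fix B :: "(real^'d) set" assume "B \<in> sets lborel"
  then have [measurable]: "B \<in> sets borel" by simp
  have "emeasure lborel B = (\<integral>\<^sup>+x. indicator B x \<partial>lborel)" by simp
  also have "\<dots> = ennreal \<bar>det A\<bar> * (\<integral>\<^sup>+x. indicator B (A *v x) \<partial>lborel)"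
    by (rule nn_integral_lborel_linear[OF _ assms, symmetric]) measurable
  also have "\<dots> = emeasure (density (distr lborel borel ((*v) A)) (\<lambda>_. ennreal \<bar>det A\<bar>)) B"
    by (subst emeasure_density) (simp_all add: nn_integral_distr nn_integral_cmult del: nn_integral_indicator)
  finally show "emeasure lborel B = emeasure (density (distr lborel borel ((*v) A)) (\<lambda>_. ennreal \<bar>det A\<bar>)) B" .
qed simp

lemma integral_lborel_linear:
  fixes A :: "real^'d^'d" and f :: "real^'d \<Rightarrow> 'a::{banach, second_countable_topology}"
  assumes [measurable]: "f \<in> borel_measurable borel" and "det A \<noteq> 0"
  shows "(LINT x|lborel. f x) = \<bar>det A\<bar> *\<^sub>R (LINT x|lborel. f (A *v x))"
  by (subst lborel_linear[OF assms(2)], subst integral_density) (auto simp: integral_distr)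

section \<open>Fourier transforms of Gaussian functions\<close>

lemma measurable_cis [measurable]: "cis \<in> borel_measurable borel"
  by (intro borel_measurable_continuous_onI continuous_intros)

lemma lborel_prod_integral:
  fixes f :: "real^'d \<Rightarrow> real \<Rightarrow> complex"
  assumes f: "\<And>b. b \<in> Basis \<Longrightarrow> integrable lborel (f b)"
  shows "integrable lborel (\<lambda>x::real^'d. \<Prod>b\<in>Basis. f b (x \<bullet> b))"
    and "(LINT x|lborel. (\<Prod>b\<in>(Basis::(real^'d) set). f b (x \<bullet> b))) = (\<Prod>b\<in>Basis. (LINT x|lborel. f b x))"
proof -
  interpret P: product_sigma_finite "\<lambda>b::real^'d. lborel :: real measure" ..
  have [measurable]: "f b \<in> borel_measurable borel" if "b \<in> Basis" for b
    using f[OF that] by simp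
  have i: "(\<Sum>b\<in>Basis. g b *\<^sub>R b) \<bullet> c = g c" if "c \<in> Basis" for c and g :: "real^'d \<Rightarrow> real"
    using that by (rule inner_sum_left_Basis)
  show "integrable lborel (\<lambda>x::real^'d. \<Prod>b\<in>Basis. f b (x \<bullet> b))"
    by (subst lborel_eq, subst integrable_distr_eq) (auto simp: i intro!: P.product_integrable_prod f)
  show "(LINT x|lborel. (\<Prod>b\<in>(Basis::(real^'d) set). f b (x \<bullet> b))) = (\<Prod>b\<in>Basis. (LINT x|lborel. f b x))"
    by (subst lborel_eq, subst integral_distr) (auto simp: i intro!: P.product_integral_prod f)
qed

lemma std_normal_fourier:
  "integrable lborel (\<lambda>x. complex_of_real (exp (- x\<^sup>2 / 2)) * cis (t * x))"
  "(LINT x|lborel. complex_of_real (exp (- x\<^sup>2 / 2)) * cis (t * x)) = complex_of_real (sqrt (2 * pi) * exp (- t\<^sup>2 / 2))"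
proof -
  have e: "exp (- x\<^sup>2 / 2) = sqrt (2 * pi) * std_normal_density x" for x
    by (simp add: std_normal_density_def)
  then have e': "exp (- (x\<^sup>2 / 2)) = sqrt (2 * pi) * std_normal_density x" for x by simp
  have "integrable lborel (\<lambda>x. sqrt (2*pi) * std_normal_density x)"
    by (intro integrable_mult_right) simp
  then show "integrable lborel (\<lambda>x. complex_of_real (exp (- x\<^sup>2 / 2)) * cis (t * x))"
    by (rule Bochner_Integration.integrable_bound) (auto simp: e' norm_mult simp del: of_real_exp)
  have "(LINT x|lborel. std_normal_density x *\<^sub>R iexp (t * x)) = complex_of_real (exp (- t\<^sup>2 / 2))"
    using fun_cong[OF char_std_normal_distribution, of t] unfolding char_def
    by (subst (asm) integral_density) auto
  then have "complex_of_real (sqrt (2*pi)) * (LINT x|lborel. std_normal_density x *\<^sub>R iexp (t * x)) = complex_of_real (sqrt (2 * pi) * exp (- t\<^sup>2 / 2))"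
    by simp
  also have "complex_of_real (sqrt (2*pi)) * (LINT x|lborel. std_normal_density x *\<^sub>R iexp (t * x))
     = (LINT x|lborel. complex_of_real (sqrt (2*pi)) * (std_normal_density x *\<^sub>R iexp (t * x)))"
    by (rule integral_mult_right_zero[symmetric])
  also have "\<dots> = (LINT x|lborel. complex_of_real (exp (- x\<^sup>2 / 2)) * cis (t * x))"
    unfolding e by (intro Bochner_Integration.integral_cong) (simp_all add: scaleR_conv_of_real cis_conv_exp mult_ac)
  finally show "(LINT x|lborel. complex_of_real (exp (- x\<^sup>2 / 2)) * cis (t * x)) = complex_of_real (sqrt (2 * pi) * exp (- t\<^sup>2 / 2))" .
qed

lemma norm_vec_sq_Basis: "(norm x)\<^sup>2 = (\<Sum>b\<in>Basis. (x \<bullet> b)\<^sup>2)" for x :: "'a::euclidean_space"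
  unfolding power2_norm_eq_inner by (subst euclidean_inner) (simp add: power2_eq_square)

lemma cis_sum: "finite A \<Longrightarrow> cis (sum f A) = (\<Prod>a\<in>A. cis (f a))"
  by (induction rule: finite_induct) (auto simp: cis_mult[symmetric])

lemma std_gaussian_fourier:
  fixes y :: "real^'d"
  shows "integrable lborel (\<lambda>x::real^'d. complex_of_real (exp (- (norm x)\<^sup>2 / 2)) * cis (y \<bullet> x))"
    and "(LINT x|lborel. complex_of_real (exp (- (norm (x::real^'d))\<^sup>2 / 2)) * cis (y \<bullet> x))
      = complex_of_real ((2 * pi) powr (real CARD('d) / 2) * exp (- (norm y)\<^sup>2 / 2))"
proof -
  have e: "complex_of_real (exp (- (norm x)\<^sup>2 / 2)) * cis (y \<bullet> x)
     = (\<Prod>b\<in>Basis. complex_of_real (exp (- (x \<bullet> b)\<^sup>2 / 2)) * cis ((y \<bullet> b) * (x \<bullet> b)))" for x :: "real^'d"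
    by (simp add: norm_vec_sq_Basis euclidean_inner[of y x] cis_sum prod.distrib exp_sum
        sum_divide_distrib sum_negf[symmetric] flip: of_real_prod)
  show "integrable lborel (\<lambda>x::real^'d. complex_of_real (exp (- (norm x)\<^sup>2 / 2)) * cis (y \<bullet> x))"
    unfolding e by (intro lborel_prod_integral std_normal_fourier)
  have "(LINT x|lborel. complex_of_real (exp (- (norm (x::real^'d))\<^sup>2 / 2)) * cis (y \<bullet> x))
     = (\<Prod>b\<in>(Basis::(real^'d) set). complex_of_real (sqrt (2 * pi) * exp (- (y \<bullet> b)\<^sup>2 / 2)))"
    unfolding e by (subst lborel_prod_integral(2)[OF std_normal_fourier(1)]) (simp only: std_normal_fourier(2))
  also have "\<dots> = complex_of_real (sqrt (2 * pi) ^ CARD('d) * exp (- (norm y)\<^sup>2 / 2))"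
    by (simp add: prod.distrib exp_sum norm_vec_sq_Basis sum_divide_distrib sum_negf[symmetric] flip: of_real_prod)
  also have "sqrt (2 * pi) ^ CARD('d) = (2 * pi) powr (real CARD('d) / 2)"
    by (simp add: powr_half_sqrt[symmetric] powr_realpow[symmetric] powr_powr)
  finally show "(LINT x|lborel. complex_of_real (exp (- (norm (x::real^'d))\<^sup>2 / 2)) * cis (y \<bullet> x))
      = complex_of_real ((2 * pi) powr (real CARD('d) / 2) * exp (- (norm y)\<^sup>2 / 2))" .
qed

definition posdef :: "real^'d^'d \<Rightarrow> bool" where
  "posdef S \<longleftrightarrow> transpose S = S \<and> (\<forall>x. x \<noteq> 0 \<longrightarrow> 0 < x \<bullet> (S *v x))"

lemma posdef_sym: "posdef S \<Longrightarrow> x \<bullet> (S *v y) = y \<bullet> (S *v x)"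
  unfolding posdef_def by (metis dot_lmul_matrix inner_commute vector_transpose_matrix)

text \<open>The columns of \<open>W\<close> are a maximal family that is orthonormal for the inner product of \<open>S\<close>.\<close>

lemma posdef_orthonormalize:
  fixes S :: "real^'d^'d"
  assumes "posdef S"
  shows "\<exists>W. det W \<noteq> 0 \<and> transpose W ** S ** W = mat 1"
proof -
  note sym = posdef_sym[OF assms]
  have pos: "x \<noteq> 0 \<Longrightarrow> 0 < x \<bullet> (S *v x)" for x using assms by (auto simp: posdef_def)
  define on where "on C \<longleftrightarrow> finite C \<and> (\<forall>a\<in>C. \<forall>b\<in>C. a \<bullet> (S *v b) = of_bool (a = b))" for C :: "(real^'d) set"
  have coef: "b \<bullet> (S *v (\<Sum>c\<in>C. u c *\<^sub>R c)) = u b" if "on C" "b \<in> C" for C u b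
  proof -
    have "b \<bullet> (S *v (\<Sum>c\<in>C. u c *\<^sub>R c)) = (\<Sum>c\<in>C. u c * (b \<bullet> (S *v c)))"
      by (simp add: linear_sum[OF matrix_vector_mul_linear] inner_sum_right matrix_vector_mult_scaleR)
    also have "\<dots> = (\<Sum>c\<in>C. if c = b then u c else 0)"
      using that by (intro sum.cong) (auto simp: on_def)
    finally show ?thesis using that by (simp add: on_def)
  qed
  have ind: "independent C" if C: "on C" for C
    unfolding independent_explicit_module
  proof (safe)
    fix t u v assume t: "finite t" "t \<subseteq> C" "(\<Sum>v\<in>t. u v *\<^sub>R v) = 0" "v \<in> t"
    have "on t" using C t(1,2) unfolding on_def by blast
    from coef[OF this t(4), of u] t(3) show "u v = 0" by simp
  qed
  have card: "card C \<le> CARD('d)" if "on C" for C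
    using ind[OF that] independent_card_le by fastforce
  have "on {}" by (simp add: on_def)
  then obtain C where C: "on C" and max: "\<And>C'. on C' \<Longrightarrow> card C' \<le> card C"
    using ex_has_greatest_nat[of on "{}" card "Suc CARD('d)"] card by (auto simp: le_imp_less_Suc)
  have span: "span C = UNIV"
  proof (rule ccontr)
    assume "span C \<noteq> UNIV"
    then obtain x where x: "x \<notin> span C" by auto
    \<comment> \<open>\<open>p\<close> is the projection of \<open>x\<close> on the span for the
      inner product of \<open>S\<close>; the normalized remainder would enlarge the maximal
      family.\<close>
    define p where "p = (\<Sum>c\<in>C. (c \<bullet> (S *v x)) *\<^sub>R c)"
    define q where "q = x - p"
    have "p \<in> span C" unfolding p_def by (intro span_sum span_scale span_base)
    then have "q \<noteq> 0" "q \<notin> span C" using x span_add[of q C p] unfolding q_def by auto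
    have cq: "c \<bullet> (S *v q) = 0" if "c \<in> C" for c
      using coef[OF C that, of "\<lambda>c. c \<bullet> (S *v x)"]
      by (simp add: q_def p_def matrix_vector_mult_diff_distrib inner_diff_right)
    define r where "r = (1 / sqrt (q \<bullet> (S *v q))) *\<^sub>R q"
    have "r \<bullet> (S *v r) = 1"
      using pos[OF \<open>q \<noteq> 0\<close>] by (simp add: r_def matrix_vector_mult_scaleR divide_simps flip: power2_eq_square)
    moreover have "c \<bullet> (S *v r) = 0" "r \<bullet> (S *v c) = 0" if "c \<in> C" for c
      using cq[OF that] sym[of q c] by (auto simp: r_def matrix_vector_mult_scaleR)
    moreover have "r \<notin> C"
    proof
      assume "r \<in> C"
      then have "sqrt (q \<bullet> (S *v q)) *\<^sub>R r \<in> span C" by (intro span_scale span_base)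
      moreover have "sqrt (q \<bullet> (S *v q)) *\<^sub>R r = q" using pos[OF \<open>q \<noteq> 0\<close>] by (simp add: r_def)
      ultimately show False using \<open>q \<notin> span C\<close> by simp
    qed
    ultimately have "on (insert r C)" using C by (auto simp: on_def)
    from max[OF this] C \<open>r \<notin> C\<close> show False by (simp add: on_def)
  qed
  have "card C = CARD('d)"
    using dim_eq_card_independent[OF ind[OF C]] dim_span[of C] span by simp
  moreover have "finite C" using C by (simp add: on_def)
  ultimately obtain h where h: "bij_betw h (UNIV::'d set) C"
    using finite_same_card_bij[of "UNIV::'d set" C] by auto
  define W where "W = (\<chi> i j. h j $ i)"
  have "(transpose W ** S ** W) $ i $ j = h i \<bullet> (S *v h j)" for i j
    unfolding matrix_mul_assoc[symmetric]
    by (simp add: matrix_matrix_mult_def transpose_def W_def inner_vec_def matrix_vector_mult_def)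
  moreover have "h i \<bullet> (S *v h j) = of_bool (i = j)" for i j
    using C h by (auto simp: on_def bij_betw_def inj_on_def)
  ultimately have W: "transpose W ** S ** W = mat 1"
    by (simp add: vec_eq_iff mat_def)
  then have "det (transpose W ** S ** W) = 1" by simp
  then have "det W \<noteq> 0" by (auto simp: det_mul)
  with W show ?thesis by blast
qed

lemma matrix_inv_eqI:
  fixes A B :: "real^'n^'n"
  assumes "A ** B = mat 1"
  shows "matrix_inv A = B"
proof -
  have "B ** A = mat 1" using assms matrix_left_right_inverse by blast
  then show ?thesis
    unfolding matrix_inv_def
    by (intro some_equality) (use assms in \<open>metis matrix_mul_assoc matrix_mul_lid matrix_mul_rid\<close>)+
qed

text \<open>The substitution x -> W x turns the quadratic form into the squared norm. The inverse of
  \<open>S\<close> is W times its transpose and |det W| is 1 / sqrt (det S), which turns the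
  standard result back into \<open>gaussian_density\<close>; its normalization leaves the factor (2
  pi)^d.\<close>

lemma gaussian_fourier:
  fixes S :: "real^'d^'d" and y :: "real^'d"
  assumes "posdef S"
  shows "integrable lborel (\<lambda>x. exp (- (x \<bullet> (S *v x)) / 2))"
    and "(LINT x|lborel. complex_of_real (exp (- (x \<bullet> (S *v x)) / 2)) * cis (y \<bullet> x))
      = complex_of_real ((2 * pi) ^ CARD('d) * gaussian_density S y)"
proof -
  obtain W where dW: "det W \<noteq> 0" and W: "transpose W ** S ** W = mat 1"
    using posdef_orthonormalize[OF assms] by blast
  have WW: "S ** (W ** transpose W) = mat 1"
    using W by (metis matrix_left_right_inverse matrix_mul_assoc)
  then have inv: "matrix_inv S = W ** transpose W" by (rule matrix_inv_eqI)
  have "det (transpose W ** S ** W) = 1" using W by simp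
  then have dS: "det S * (det W)\<^sup>2 = 1" by (simp add: det_mul power2_eq_square mult_ac)
  then have dS': "det S = 1 / (det W)\<^sup>2" using dW by (simp add: field_simps)
  have q: "(W *v x) \<bullet> (S *v (W *v x)) = (norm x)\<^sup>2" for x
  proof -
    have "(W *v x) \<bullet> (S *v (W *v x)) = x \<bullet> ((transpose W ** S ** W) *v x)"
      by (metis dot_lmul_matrix inner_commute matrix_vector_mul_assoc vector_transpose_matrix transpose_transpose)
    then show ?thesis by (simp add: W power2_norm_eq_inner)
  qed
  have yW: "y \<bullet> (W *v x) = (transpose W *v y) \<bullet> x" for x
    by (metis dot_lmul_matrix transpose_matrix_vector)
  have n: "(norm (transpose W *v y))\<^sup>2 = y \<bullet> (matrix_inv S *v y)"
    unfolding inv power2_norm_eq_inner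
    by (metis dot_lmul_matrix inner_commute matrix_vector_mul_assoc transpose_matrix_vector)
  have [measurable]: "(\<lambda>x. exp (- (x \<bullet> (S *v x)) / 2)) \<in> borel_measurable borel" by measurable
  have "integrable lborel (\<lambda>x::real^'d. complex_of_real (exp (- (norm x)\<^sup>2 / 2)) * cis (0 \<bullet> x))"
    by (rule std_gaussian_fourier)
  from integrable_norm[OF this] have I: "integrable lborel (\<lambda>x::real^'d. exp (- (norm x)\<^sup>2 / 2))"
    by (simp add: norm_mult)
  show "integrable lborel (\<lambda>x. exp (- (x \<bullet> (S *v x)) / 2))"
    using I by (subst lborel_linear[OF dW], subst integrable_density) (simp_all add: integrable_distr_eq q)
  have "(LINT x|lborel. complex_of_real (exp (- (x \<bullet> (S *v x)) / 2)) * cis (y \<bullet> x))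
    = \<bar>det W\<bar> *\<^sub>R (LINT x|lborel. complex_of_real (exp (- (norm (x::real^'d))\<^sup>2 / 2)) * cis ((transpose W *v y) \<bullet> x))"
    unfolding q[symmetric] yW[symmetric]
    by (rule integral_lborel_linear[OF _ dW]) measurable
  also have "\<dots> = complex_of_real (\<bar>det W\<bar> * (2 * pi) powr (real CARD('d) / 2) * exp (- (y \<bullet> (matrix_inv S *v y)) / 2))"
    unfolding std_gaussian_fourier(2) n by (simp add: scaleR_conv_of_real)
  also have "\<bar>det W\<bar> * (2 * pi) powr (real CARD('d) / 2) * exp (- (y \<bullet> (matrix_inv S *v y)) / 2)
     = (2 * pi) ^ CARD('d) * gaussian_density S y"
  proof -
    have "sqrt (det S) = 1 / \<bar>det W\<bar>" by (simp add: dS' real_sqrt_divide)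
    moreover have "(2 * pi) ^ CARD('d) = (2 * pi) powr (real CARD('d) / 2) * (2 * pi) powr (real CARD('d) / 2)"
      by (simp add: powr_add[symmetric] powr_realpow)
    ultimately show ?thesis by (simp add: gaussian_density_def)
  qed
  finally show "(LINT x|lborel. complex_of_real (exp (- (x \<bullet> (S *v x)) / 2)) * cis (y \<bullet> x))
      = complex_of_real ((2 * pi) ^ CARD('d) * gaussian_density S y)" .
qed

section \<open>Smoothing by a Gaussian kernel\<close>

lemma mat_mult_vec: "mat c *v (x :: real^'d) = c *\<^sub>R x"
proof -
  have "(\<Sum>j\<in>UNIV. (if i = j then c else 0) * x $ j) = c * x $ i" for i
    by (simp add: if_distrib[of "\<lambda>a. a * _"] cong: if_cong)
  then show ?thesis by (simp add: vec_eq_iff matrix_vector_mult_def mat_def)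
qed

lemma posdef_mat: "0 < c \<Longrightarrow> posdef (mat c :: real^'d^'d)"
  by (auto simp: posdef_def transpose_mat mat_mult_vec)

lemma gaussian_density_mat:
  fixes x :: "real^'d"
  assumes "0 < c"
  shows "gaussian_density (mat c) x = exp (- (norm x)\<^sup>2 / (2 * c)) / ((2 * pi) powr (real CARD('d) / 2) * c powr (real CARD('d) / 2))"
proof -
  have "mat c ** mat (1/c) = (mat 1 :: real^'d^'d)"
    using assms by (auto intro!: matrix_eq[THEN iffD2] simp: matrix_vector_mul_assoc[symmetric] mat_mult_vec)
  then have "matrix_inv (mat c) = (mat (1/c) :: real^'d^'d)" by (rule matrix_inv_eqI)
  moreover have "det (mat c :: real^'d^'d) = c ^ CARD('d)"
    by (subst det_diagonal) (auto simp: mat_def)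
  moreover have "sqrt (c ^ CARD('d)) = c powr (real CARD('d) / 2)"
    using assms by (simp add: powr_half_sqrt[symmetric] powr_realpow[symmetric] powr_powr)
  ultimately show ?thesis
    by (simp add: gaussian_density_def mat_mult_vec power2_norm_eq_inner)
qed

lemma gaussian_integral:
  assumes "0 < c"
  shows "integrable lborel (\<lambda>x::real^'d. exp (- c * (norm x)\<^sup>2 / 2))"
    and "(LINT x|lborel. exp (- c * (norm (x::real^'d))\<^sup>2 / 2)) = (2 * pi / c) powr (real CARD('d) / 2)"
proof -
  have q: "x \<bullet> (mat c *v x) = c * (norm x)\<^sup>2" for x :: "real^'d"
    by (simp add: mat_mult_vec power2_norm_eq_inner)
  show "integrable lborel (\<lambda>x::real^'d. exp (- c * (norm x)\<^sup>2 / 2))"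
    using gaussian_fourier(1)[OF posdef_mat[OF assms], where 'd='d] by (simp add: q)
  have "complex_of_real (LINT x|lborel. exp (- c * (norm (x::real^'d))\<^sup>2 / 2))
      = (LINT x|lborel. complex_of_real (exp (- (x \<bullet> (mat c *v (x::real^'d))) / 2)) * cis (0 \<bullet> x))"
    by (simp add: q flip: of_real_exp)
  also have "\<dots> = complex_of_real ((2 * pi) ^ CARD('d) * gaussian_density (mat c :: real^'d^'d) 0)"
    by (rule gaussian_fourier(2)[OF posdef_mat[OF assms]])
  finally have "(LINT x|lborel. exp (- c * (norm (x::real^'d))\<^sup>2 / 2)) = (2 * pi) ^ CARD('d) * gaussian_density (mat c :: real^'d^'d) 0"
    by (simp only: of_real_eq_iff)
  moreover have "(2 * pi) ^ CARD('d) = (2 * pi) powr (real CARD('d) / 2) * (2 * pi) powr (real CARD('d) / 2)"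
    by (simp add: powr_add[symmetric] powr_realpow)
  ultimately show "(LINT x|lborel. exp (- c * (norm (x::real^'d))\<^sup>2 / 2)) = (2 * pi / c) powr (real CARD('d) / 2)"
    using assms by (simp add: gaussian_density_mat powr_divide)
qed

text \<open>Absorbs a linear factor into a Gaussian: half of the exponent of exp(-u^2/2) is spent on
  the factor u.\<close>

lemma le_exp_sq: "u \<le> exp (u\<^sup>2 / 4)" for u :: real
proof -
  have "0 \<le> (1 - u / 2)\<^sup>2" by simp
  then have "u \<le> 1 + u\<^sup>2 / 4" by (simp add: power2_eq_square algebra_simps)
  also have "\<dots> \<le> exp (u\<^sup>2 / 4)" by (rule exp_ge_add_one_self)
  finally show ?thesis .
qed

text \<open>By Fourier inversion the difference is the integral of exp(-<x,Sx>/2) against cis(y.x) -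
  cis(z.x), which is at most |y-z| |x|. The factor |x| is absorbed at the price of halving
  \<open>a\<close>. Only the lower bound \<open>a\<close> enters the constant, so it serves all
  covariance matrices of the family at once.\<close>

lemma gaussian_density_lipschitz:
  fixes S :: "real^'d^'d"
  assumes S: "posdef S" and a: "0 < a" "\<And>x. a * (norm x)\<^sup>2 \<le> x \<bullet> (S *v x)"
  shows "\<bar>gaussian_density S y - gaussian_density S z\<bar>
    \<le> (1 / sqrt a) * (4 * pi / a) powr (real CARD('d) / 2) / (2 * pi) ^ CARD('d) * norm (y - z)"
proof -
  let ?e = "\<lambda>x. complex_of_real (exp (- (x \<bullet> (S *v x)) / 2))"
  have I: "integrable lborel (\<lambda>x. ?e x * cis (y \<bullet> x))" for y
    by (rule Bochner_Integration.integrable_bound[OF gaussian_fourier(1)[OF S]]) (auto simp: norm_mult)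
  have b: "norm (?e x * cis (y \<bullet> x) - ?e x * cis (z \<bullet> x)) \<le> norm (y - z) / sqrt a * exp (- (a/2) * (norm x)\<^sup>2 / 2)" for x
  proof -
    have "cis (y \<bullet> x) - cis (z \<bullet> x) = cis (z \<bullet> x) * (cis ((y - z) \<bullet> x) - 1)"
      by (simp add: algebra_simps cis_mult inner_diff_left)
    then have "norm (cis (y \<bullet> x) - cis (z \<bullet> x)) = norm (cis ((y - z) \<bullet> x) - 1)"
      by (simp add: norm_mult)
    also have "\<dots> \<le> \<bar>(y - z) \<bullet> x\<bar>"
      using iexp_approx1[of "(y - z) \<bullet> x" 0] by (simp add: cis_conv_exp)
    also have "\<dots> \<le> norm (y - z) * norm x" by (rule Cauchy_Schwarz_ineq2)
    finally have 1: "norm (cis (y \<bullet> x) - cis (z \<bullet> x)) \<le> norm (y - z) * norm x" .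
    have 2: "exp (- (x \<bullet> (S *v x)) / 2) \<le> exp (- (a * (norm x)\<^sup>2) / 2)" using a(2)[of x] by simp
    have "norm (?e x * cis (y \<bullet> x) - ?e x * cis (z \<bullet> x)) = exp (- (x \<bullet> (S *v x)) / 2) * norm (cis (y \<bullet> x) - cis (z \<bullet> x))"
      by (simp add: norm_mult flip: right_diff_distrib)
    also have "\<dots> \<le> exp (- (a * (norm x)\<^sup>2) / 2) * (norm (y - z) * norm x)"
      by (intro mult_mono 1 2) auto
    also have "\<dots> = norm (y - z) / sqrt a * (exp (- (a * (norm x)\<^sup>2) / 2) * (sqrt a * norm x))"
      using a by simp
    also have "\<dots> \<le> norm (y - z) / sqrt a * (exp (- (a * (norm x)\<^sup>2) / 2) * exp ((sqrt a * norm x)\<^sup>2 / 4))"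
      by (intro mult_left_mono le_exp_sq) (use a in auto)
    also have "exp (- (a * (norm x)\<^sup>2) / 2) * exp ((sqrt a * norm x)\<^sup>2 / 4) = exp (- (a/2) * (norm x)\<^sup>2 / 2)"
      using a by (simp add: exp_add[symmetric] power_mult_distrib)
    finally show ?thesis .
  qed
  have "(2 * pi) ^ CARD('d) * \<bar>gaussian_density S y - gaussian_density S z\<bar>
      = norm (complex_of_real ((2 * pi) ^ CARD('d) * gaussian_density S y) - complex_of_real ((2 * pi) ^ CARD('d) * gaussian_density S z))"
    by (simp add: norm_mult norm_power flip: right_diff_distrib of_real_diff)
  also have "\<dots> = norm (LINT x|lborel. ?e x * cis (y \<bullet> x) - ?e x * cis (z \<bullet> x))"
    unfolding gaussian_fourier(2)[OF S, symmetric] by (subst Bochner_Integration.integral_diff[OF I I]) simp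
  also have "\<dots> \<le> (LINT x|lborel. norm (y - z) / sqrt a * exp (- (a/2) * (norm (x::real^'d))\<^sup>2 / 2))"
    by (rule Bochner_Integration.integral_norm_bound_integral)
       (rule Bochner_Integration.integrable_diff[OF I I] integrable_mult_right gaussian_integral(1) b half_gt_zero a)+
  also have "\<dots> = norm (y - z) / sqrt a * (4 * pi / a) powr (real CARD('d) / 2)"
    using gaussian_integral(2)[of "a/2", where 'd='d] a by simp
  finally have "\<bar>gaussian_density S y - gaussian_density S z\<bar>
     \<le> norm (y - z) / sqrt a * (4 * pi / a) powr (real CARD('d) / 2) / (2 * pi) ^ CARD('d)"
    by (subst pos_le_divide_eq) (simp_all add: mult.commute)
  then show ?thesis by (simp add: mult_ac)
qed

lemma lborel_reflect:
  fixes f :: "real^'d \<Rightarrow> 'a::{banach, second_countable_topology}"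
  assumes [measurable]: "f \<in> borel_measurable borel"
  shows "integrable lborel (\<lambda>z. f (y - z)) \<longleftrightarrow> integrable lborel f"
    and "(LINT z|lborel. f (y - z)) = (LINT z|lborel. f z)"
proof -
  have L: "(lborel :: (real^'d) measure) = distr lborel borel (\<lambda>z. y - z)"
    using lborel_affine[of "-1" y] by (simp add: density_1)
  show "integrable lborel (\<lambda>z. f (y - z)) \<longleftrightarrow> integrable lborel f"
    by (subst (2) L, subst integrable_distr_eq) auto
  show "(LINT z|lborel. f (y - z)) = (LINT z|lborel. f z)"
    by (subst (2) L, subst integral_distr) auto
qed

text \<open>The constant 2^(d/2) in the first moment is the price for absorbing the factor |x|: the
  Gaussian that remains has twice the variance.\<close>

lemma gaussian_kernel:
  assumes "0 < e"
  defines "K \<equiv> gaussian_density (mat (e\<^sup>2) :: real^'d^'d)"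
  shows "K \<in> borel_measurable borel" "\<And>x. 0 \<le> K x" "\<And>x. K x \<le> (2 * pi) powr (- real CARD('d) / 2) * e powr (- real CARD('d))"
    and "integrable lborel K" "(LINT x|lborel. K x) = 1"
    and "integrable lborel (\<lambda>x. norm x * K x)"
    and "(LINT x|lborel. norm x * K x) \<le> e * 2 powr (real CARD('d) / 2)"
proof -
  let ?d = "real CARD('d)"
  let ?k = "(2 * pi) powr (?d / 2) * e powr ?d"
  have e2: "(e\<^sup>2) powr (?d / 2) = e powr ?d"
    using assms by (simp add: powr_powr powr_realpow[symmetric] del: powr_numeral)
  have K: "K x = exp (- (1/e\<^sup>2) * (norm x)\<^sup>2 / 2) / ?k" for x
    using assms by (simp add: K_def gaussian_density_mat e2 field_simps)
  have k: "0 < ?k" using assms by simp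
  show m: "K \<in> borel_measurable borel" unfolding K[abs_def] by measurable
  show nn: "0 \<le> K x" for x using assms unfolding K by simp
  show "K x \<le> (2 * pi) powr (- real CARD('d) / 2) * e powr (- real CARD('d))" for x
  proof -
    have "K x \<le> 1 / ?k" unfolding K using k by (intro divide_right_mono) auto
    then show ?thesis by (simp add: powr_minus field_simps)
  qed
  have p: "(2 * pi / (1/e\<^sup>2)) powr (?d / 2) = ?k"
    using assms by (simp add: powr_mult e2)
  note G = gaussian_integral[of "1/e\<^sup>2", where 'd='d]
  show "integrable lborel K"
    unfolding K[abs_def] using assms by (intro integrable_divide G) simp
  show "(LINT x|lborel. K x) = 1"
    unfolding K using G(2) p k assms by (simp add: integral_divide_zero)
  have b: "norm x * K x \<le> e * (exp (- (1/(2*e\<^sup>2)) * (norm x)\<^sup>2 / 2) / ?k)" for x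
  proof -
    have "norm x * K x = e * ((norm x / e) * exp (- (1/e\<^sup>2) * (norm x)\<^sup>2 / 2) / ?k)"
      using assms unfolding K by simp
    also have "\<dots> \<le> e * (exp ((norm x / e)\<^sup>2 / 4) * exp (- (1/e\<^sup>2) * (norm x)\<^sup>2 / 2) / ?k)"
      by (intro mult_left_mono divide_right_mono mult_right_mono le_exp_sq) (use assms k in auto)
    also have "exp ((norm x / e)\<^sup>2 / 4) * exp (- (1/e\<^sup>2) * (norm x)\<^sup>2 / 2) = exp (- (1/(2*e\<^sup>2)) * (norm x)\<^sup>2 / 2)"
      using assms by (simp add: exp_add[symmetric] power_divide field_simps)
    finally show ?thesis .
  qed
  note G2 = gaussian_integral[of "1/(2*e\<^sup>2)", where 'd='d]
  have J: "integrable lborel (\<lambda>x::real^'d. e * (exp (- (1/(2*e\<^sup>2)) * (norm x)\<^sup>2 / 2) / ?k))"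
    using assms by (intro integrable_mult_right integrable_divide G2) simp
  show i: "integrable lborel (\<lambda>x. norm x * K x)"
  proof (rule Bochner_Integration.integrable_bound[OF J], use m in measurable, intro AE_I2)
    fix x
    have "norm (norm x * K x) = norm x * K x" using nn by simp
    also note b[of x]
    also have "e * (exp (- (1/(2*e\<^sup>2)) * (norm x)\<^sup>2 / 2) / ?k) \<le> norm (e * (exp (- (1/(2*e\<^sup>2)) * (norm x)\<^sup>2 / 2) / ?k))"
      unfolding real_norm_def by (rule abs_ge_self)
    finally show "norm (norm x * K x) \<le> norm (e * (exp (- (1/(2*e\<^sup>2)) * (norm x)\<^sup>2 / 2) / ?k))" .
  qed
  have "(LINT x|lborel. norm x * K x) \<le> (LINT x|lborel. e * (exp (- (1/(2*e\<^sup>2)) * (norm (x::real^'d))\<^sup>2 / 2) / ?k))"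
    by (rule integral_mono[OF i J b])
  also have "\<dots> = e * ((4 * pi * e\<^sup>2) powr (?d/2) / ?k)"
    using G2(2) assms by (simp add: mult.assoc)
  also have "(4 * pi * e\<^sup>2) powr (?d/2) = 2 powr (?d/2) * ?k"
    using assms by (simp add: powr_mult e2 flip: powr_mult[of 2 2])
  finally show "(LINT x|lborel. norm x * K x) \<le> e * 2 powr (?d / 2)" using k assms by simp
qed

text \<open>The Lipschitz bound is required only between \<open>y\<close> and the other points. The
  densities treated later may jump across the boundary of a domain, where a bound between arbitrary
  points would fail. The error is \<open>L\<close> times the first moment of the kernel.\<close>

lemma smoothing_error:
  fixes h :: "real^'d \<Rightarrow> real"
  assumes e: "0 < e" and [measurable]: "h \<in> borel_measurable borel" and L: "\<And>z. \<bar>h y - h z\<bar> \<le> L * norm (y - z)"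
    and bdd: "\<And>z. \<bar>h z\<bar> \<le> B"
  shows "\<bar>h y - (LINT z|lborel. h z * gaussian_density (mat (e\<^sup>2)) (y - z))\<bar> \<le> L * (e * 2 powr (real CARD('d) / 2))"
proof -
  let ?K = "gaussian_density (mat (e\<^sup>2)) :: real^'d \<Rightarrow> real"
  note [measurable] = gaussian_kernel(1)[OF e, where 'd='d]
  \<comment> \<open>A point at distance one from \<open>y\<close> turns the hypothesis into the
    nonnegativity of \<open>L\<close>.\<close>
  have L0: "0 \<le> L"
    using order_trans[OF abs_ge_zero L[of "y + axis undefined 1"]] by simp
  have I: "integrable lborel (\<lambda>z. ?K (y - z))" "(LINT z|lborel. ?K (y - z)) = 1"
    using lborel_reflect[of ?K y] gaussian_kernel(4,5)[OF e, where 'd='d] by auto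
  have J: "integrable lborel (\<lambda>z. norm (y - z) * ?K (y - z))"
    using lborel_reflect(1)[of "\<lambda>z. norm z * ?K z" y] gaussian_kernel(6)[OF e, where 'd='d] by auto
  have hi: "integrable lborel (\<lambda>z. h z * ?K (y - z))"
    by (rule Bochner_Integration.integrable_bound[OF integrable_mult_right[OF I(1), of B]])
       (auto simp: abs_mult gaussian_kernel(2)[OF e] intro!: mult_mono order_trans[OF bdd])
  have "h y - (LINT z|lborel. h z * ?K (y - z)) = (LINT z|lborel. h y * ?K (y - z) - h z * ?K (y - z))"
    using I hi by (subst Bochner_Integration.integral_diff) auto
  then have "\<bar>h y - (LINT z|lborel. h z * ?K (y - z))\<bar> = norm (LINT z|lborel. (h y - h z) * ?K (y - z))"
    by (simp add: left_diff_distrib)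
  also have "\<dots> \<le> (LINT z|lborel. L * (norm (y - z) * ?K (y - z)))"
  proof (rule Bochner_Integration.integral_norm_bound_integral)
    show "integrable lborel (\<lambda>z. (h y - h z) * ?K (y - z))"
      using I hi by (auto simp: left_diff_distrib)
    show "integrable lborel (\<lambda>z. L * (norm (y - z) * ?K (y - z)))" using J by simp
    show "norm ((h y - h z) * ?K (y - z)) \<le> L * (norm (y - z) * ?K (y - z))" for z
      using mult_right_mono[OF L[of z] gaussian_kernel(2)[OF e, of "y - z"]]
      by (simp add: abs_mult gaussian_kernel(2)[OF e] mult_ac)
  qed
  also have "\<dots> = L * (LINT z|lborel. norm z * ?K z)"
    using lborel_reflect(2)[of "\<lambda>z. norm z * ?K z" y] by simp
  also have "\<dots> \<le> L * (e * 2 powr (real CARD('d) / 2))"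
    by (intro mult_left_mono gaussian_kernel(7)[OF e] L0)
  finally show ?thesis .
qed

text \<open>Monotone approximation carries the Lebesgue decomposition from sets to functions; it is
  applied to a translated Gaussian kernel.\<close>

lemma nn_integral_decomposition:
  assumes dec: "\<And>B. B \<in> sets borel \<Longrightarrow> emeasure \<nu> B = (\<integral>\<^sup>+y\<in>B. ennreal (h y) \<partial>lborel) + emeasure \<mu> B"
    and [measurable]: "h \<in> borel_measurable borel" and [measurable_cong]: "sets \<nu> = sets borel" "sets \<mu> = sets borel"
    and f: "f \<in> borel_measurable borel"
  shows "(\<integral>\<^sup>+y. f y \<partial>\<nu>) = (\<integral>\<^sup>+y. ennreal (h y) * f y \<partial>lborel) + (\<integral>\<^sup>+y. f y \<partial>(\<mu> :: 'a::euclidean_space measure))"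
  using f
proof (induction rule: borel_measurable_induct)
  case (cong f g)
  then show ?case by (auto cong: nn_integral_cong)
next
  case (set A)
  then show ?case using dec[of A] by simp
next
  case (mult u c)
  then show ?case by (simp add: nn_integral_cmult distrib_left mult.left_commute[of _ c])
next
  case (add u v)
  then show ?case by (simp add: nn_integral_add distrib_left ac_simps)
next
  case (seq U)
  note [measurable] = seq(1)
  have "(\<integral>\<^sup>+y. (SUP i. U i) y \<partial>\<nu>) = (SUP i. \<integral>\<^sup>+y. U i y \<partial>\<nu>)"
    unfolding SUP_apply by (rule nn_integral_monotone_convergence_SUP) (use seq in auto)
  moreover have "(\<integral>\<^sup>+y. (SUP i. U i) y \<partial>\<mu>) = (SUP i. \<integral>\<^sup>+y. U i y \<partial>\<mu>)"
    unfolding SUP_apply by (rule nn_integral_monotone_convergence_SUP) (use seq in auto)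
  moreover have "(\<integral>\<^sup>+y. ennreal (h y) * (SUP i. U i) y \<partial>lborel) = (SUP i. \<integral>\<^sup>+y. ennreal (h y) * U i y \<partial>lborel)"
    unfolding SUP_apply SUP_mult_left_ennreal
    by (rule nn_integral_monotone_convergence_SUP)
       (use seq in \<open>auto simp: incseq_def le_fun_def intro!: mult_left_mono\<close>)
  moreover have "(SUP i. (\<integral>\<^sup>+y. ennreal (h y) * U i y \<partial>lborel) + (\<integral>\<^sup>+y. U i y \<partial>\<mu>))
     = (SUP i. \<integral>\<^sup>+y. ennreal (h y) * U i y \<partial>lborel) + (SUP i. \<integral>\<^sup>+y. U i y \<partial>\<mu>)"
    by (rule ennreal_SUP_add)
       (use seq in \<open>auto simp: incseq_def le_fun_def intro!: nn_integral_mono mult_left_mono\<close>)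
  ultimately show ?case by (simp add: seq.IH)
qed

text \<open>The kernel is itself the Fourier transform of a Gaussian, up to the factor (2 pi)^d.
  Fubini applies because that Gaussian is integrable and \<open>\<nu>\<close> is finite, and the
  inner integral is then the characteristic function.\<close>

lemma smoothed_inversion:
  fixes \<nu> :: "(real^'d) measure"
  assumes "prob_space \<nu>" and [measurable_cong]: "sets \<nu> = sets borel" and e: "0 < e"
  shows "complex_of_real ((2 * pi) ^ CARD('d) * (LINT z|\<nu>. gaussian_density (mat (e\<^sup>2)) (y - z)))
     = (LINT x|lborel. (LINT z|\<nu>. cis (x \<bullet> z)) * complex_of_real (exp (- (e\<^sup>2 * (norm x)\<^sup>2) / 2)) * cis (- (x \<bullet> y)))"
proof -
  interpret prob_space \<nu> by fact
  interpret pair_sigma_finite \<nu> "lborel :: (real^'d) measure" ..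
  let ?g = "\<lambda>x::real^'d. complex_of_real (exp (- (e\<^sup>2 * (norm x)\<^sup>2) / 2))"
  have pd: "posdef (mat (e\<^sup>2) :: real^'d^'d)" using e by (intro posdef_mat) simp
  have q: "x \<bullet> (mat (e\<^sup>2) *v x) = e\<^sup>2 * (norm x)\<^sup>2" for x :: "real^'d"
    by (simp add: mat_mult_vec power2_norm_eq_inner)
  have gi: "integrable lborel (\<lambda>x::real^'d. exp (- (e\<^sup>2 * (norm x)\<^sup>2) / 2))"
    using gaussian_fourier(1)[OF pd] unfolding q .
  have even: "gaussian_density (mat (e\<^sup>2)) (y - z) = gaussian_density (mat (e\<^sup>2)) (z - y)" for z :: "real^'d"
    using e by (simp add: gaussian_density_mat norm_minus_commute)
  have "complex_of_real ((2 * pi) ^ CARD('d) * (LINT z|\<nu>. gaussian_density (mat (e\<^sup>2)) (y - z)))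
     = (LINT z|\<nu>. complex_of_real ((2 * pi) ^ CARD('d) * gaussian_density (mat (e\<^sup>2)) (y - z)))"
    by (subst integral_mult_right_zero[symmetric]) (rule integral_complex_of_real[symmetric])
  also have "\<dots> = (LINT z|\<nu>. LINT x|lborel. ?g x * cis ((z - y) \<bullet> x))"
    unfolding even gaussian_fourier(2)[OF pd, symmetric] q ..
  also have "\<dots> = (LINT x|lborel. LINT z|\<nu>. ?g x * cis ((z - y) \<bullet> x))"
  proof (rule Fubini_integral[symmetric], rule Fubini_integrable)
    show "(\<lambda>(z, x). ?g x * cis ((z - y) \<bullet> x)) \<in> borel_measurable (\<nu> \<Otimes>\<^sub>M lborel)"
      by measurable
    show "integrable \<nu> (\<lambda>z. LINT x|lborel. norm (case (z, x) of (z, x) \<Rightarrow> ?g x * cis ((z - y) \<bullet> x)))"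
      by (simp add: norm_mult)
    show "AE z in \<nu>. integrable lborel (\<lambda>x. case (z, x) of (z, x) \<Rightarrow> ?g x * cis ((z - y) \<bullet> x))"
      by (intro AE_I2, simp, rule Bochner_Integration.integrable_bound[OF gi]) (auto simp: norm_mult)
  qed
  also have "\<dots> = (LINT x|lborel. (LINT z|\<nu>. cis (x \<bullet> z)) * ?g x * cis (- (x \<bullet> y)))"
  proof (intro Bochner_Integration.integral_cong refl)
    fix x :: "real^'d"
    have "(LINT z|\<nu>. ?g x * cis ((z - y) \<bullet> x)) = (LINT z|\<nu>. (?g x * cis (- (x \<bullet> y))) * cis (x \<bullet> z))"
      by (intro Bochner_Integration.integral_cong refl) (simp add: inner_diff_left inner_diff_right inner_commute[of _ x] cis_mult mult.assoc)
    also have "\<dots> = (?g x * cis (- (x \<bullet> y))) * (LINT z|\<nu>. cis (x \<bullet> z))" by (rule integral_mult_right_zero)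
    finally show "(LINT z|\<nu>. ?g x * cis ((z - y) \<bullet> x)) = (LINT z|\<nu>. cis (x \<bullet> z)) * ?g x * cis (- (x \<bullet> y))"
      by (simp add: mult_ac)
  qed
  finally show ?thesis .
qed

text \<open>The Fourier integrals of the smoothed law and of the Gaussian are subtracted under the
  integral sign; integrating the two Gaussian majorants gives the powers of \<open>p\<close> and
  \<open>e\<close>. The smoothed law splits into the contributions of \<open>h\<close> and
  \<open>\<mu>\<close>, and the latter is at most the mass of \<open>\<mu>\<close> times a bound for
  the height of the kernel.\<close>

lemma smoothed_density_bound:
  fixes \<nu> \<mu> :: "(real^'d) measure" and S :: "real^'d^'d"
  assumes nu: "prob_space \<nu>" "sets \<nu> = sets borel" and mu: "finite_measure \<mu>" "sets \<mu> = sets borel"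
    and h: "h \<in> borel_measurable borel" "\<And>y. 0 \<le> h y"
    and dec: "\<And>B. B \<in> sets borel \<Longrightarrow> emeasure \<nu> B = (\<integral>\<^sup>+y\<in>B. ennreal (h y) \<partial>lborel) + emeasure \<mu> B"
    and S: "posdef S" and e: "0 < e" and p: "0 < p"
    and bound: "\<And>x. norm ((LINT z|\<nu>. cis (x \<bullet> z)) * complex_of_real (exp (- (e\<^sup>2 * (norm x)\<^sup>2) / 2))
          - complex_of_real (exp (- (x \<bullet> (S *v x)) / 2)))
        \<le> a * exp (- p * (norm x)\<^sup>2 / 2) + b * exp (- (e\<^sup>2) * (norm x)\<^sup>2 / 2)"
  shows "\<bar>(LINT z|lborel. h z * gaussian_density (mat (e\<^sup>2)) (y - z)) - gaussian_density S y\<bar>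
     \<le> a * p powr (- real CARD('d) / 2) + (b + measure \<mu> UNIV) * e powr (- real CARD('d))"
proof -
  interpret nu: prob_space \<nu> by fact
  interpret mu: finite_measure \<mu> by fact
  note [measurable_cong] = nu(2) mu(2)
  note [measurable] = h(1)
  let ?d = "real CARD('d)"
  let ?g = "\<lambda>x::real^'d. complex_of_real (exp (- (e\<^sup>2 * (norm x)\<^sup>2) / 2))"
  let ?s = "\<lambda>x::real^'d. complex_of_real (exp (- (x \<bullet> (S *v x)) / 2))"
  let ?f = "\<lambda>x::real^'d. LINT z|\<nu>. cis (x \<bullet> z)"
  let ?K = "gaussian_density (mat (e\<^sup>2)) :: real^'d \<Rightarrow> real"
  \<comment> \<open>Inversion carries the factor c^2 and each Gaussian integral only one factor c,
    so a factor c >= 1 is left over and may be dropped.\<close>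
  define c where "c = (2 * pi) powr (?d / 2)"
  note K = gaussian_kernel[OF e, where 'd='d]
  note [measurable] = K(1)
  have c2: "(2 * pi) ^ CARD('d) = c * c"
    by (simp add: c_def powr_add[symmetric] powr_realpow)
  have c1: "1 \<le> c" unfolding c_def by (rule ge_one_powr_ge_zero) (use pi_ge_two in auto)
  have gi: "integrable lborel (\<lambda>x::real^'d. exp (- (e\<^sup>2 * (norm x)\<^sup>2) / 2))"
    using gaussian_integral(1)[of "e\<^sup>2", where 'd='d] e by simp
  have [measurable]: "?f \<in> borel_measurable borel"
    by measurable
  have f1: "norm (?f x) \<le> 1" for x
    by (rule order_trans[OF integral_norm_bound]) (simp add: nu.prob_space)
  have i1: "integrable lborel (\<lambda>x. ?f x * ?g x * cis (- (x \<bullet> y)))"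
    by (rule Bochner_Integration.integrable_bound[OF gi])
       (auto simp: norm_mult intro!: mult_left_le_one_le f1)
  have i2: "integrable lborel (\<lambda>x. ?s x * cis (- y \<bullet> x))"
    by (rule Bochner_Integration.integrable_bound[OF gaussian_fourier(1)[OF S]]) (auto simp: norm_mult)
  have even: "gaussian_density S (- y) = gaussian_density S y"
    by (simp add: gaussian_density_def linear_neg[OF matrix_vector_mul_linear])
  have "(2 * pi) ^ CARD('d) * \<bar>(LINT z|\<nu>. ?K (y - z)) - gaussian_density S y\<bar>
     = norm (complex_of_real ((2 * pi) ^ CARD('d) * (LINT z|\<nu>. ?K (y - z))) - complex_of_real ((2 * pi) ^ CARD('d) * gaussian_density S (- y)))"
    unfolding even by (simp add: norm_mult norm_power flip: right_diff_distrib of_real_diff)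
  also have "\<dots> = norm (LINT x|lborel. ?f x * ?g x * cis (- (x \<bullet> y)) - ?s x * cis (- y \<bullet> x))"
    unfolding smoothed_inversion[OF nu e] gaussian_fourier(2)[OF S, symmetric]
    by (subst Bochner_Integration.integral_diff[OF i1 i2]) simp
  also have "\<dots> \<le> (LINT x|lborel. a * exp (- p * (norm (x::real^'d))\<^sup>2 / 2) + b * exp (- (e\<^sup>2) * (norm x)\<^sup>2 / 2))"
  proof (rule Bochner_Integration.integral_norm_bound_integral)
    show "integrable lborel (\<lambda>x. ?f x * ?g x * cis (- (x \<bullet> y)) - ?s x * cis (- y \<bullet> x))" using i1 i2 by simp
    show "integrable lborel (\<lambda>x::real^'d. a * exp (- p * (norm x)\<^sup>2 / 2) + b * exp (- (e\<^sup>2) * (norm x)\<^sup>2 / 2))"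
      using e p by (intro Bochner_Integration.integrable_add integrable_mult_right gaussian_integral) auto
    fix x :: "real^'d"
    have "?f x * ?g x * cis (- (x \<bullet> y)) - ?s x * cis (- y \<bullet> x) = (?f x * ?g x - ?s x) * cis (- (x \<bullet> y))"
      by (simp add: left_diff_distrib inner_commute)
    then show "norm (?f x * ?g x * cis (- (x \<bullet> y)) - ?s x * cis (- y \<bullet> x))
      \<le> a * exp (- p * (norm x)\<^sup>2 / 2) + b * exp (- (e\<^sup>2) * (norm x)\<^sup>2 / 2)"
      using bound[of x] by (simp add: norm_mult)
  qed
  also have "\<dots> = a * (2 * pi / p) powr (?d / 2) + b * (2 * pi / e\<^sup>2) powr (?d / 2)"
    using e p gaussian_integral[of p, where 'd='d] gaussian_integral[of "e\<^sup>2", where 'd='d]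
    by (subst Bochner_Integration.integral_add) auto
  also have "(2 * pi / p) powr (?d / 2) = c * p powr (- ?d / 2)"
    using p by (simp add: c_def powr_divide powr_minus_divide)
  also have "(2 * pi / e\<^sup>2) powr (?d / 2) = c * e powr (- ?d)"
  proof -
    have "(e\<^sup>2) powr (?d / 2) = e powr ?d"
      using e by (simp add: powr_powr powr_realpow[symmetric] del: powr_numeral)
    then show ?thesis using e by (simp add: c_def powr_divide powr_minus_divide)
  qed
  finally have "c * (c * \<bar>(LINT z|\<nu>. ?K (y - z)) - gaussian_density S y\<bar>)
      \<le> c * (a * p powr (- ?d / 2) + b * e powr (- ?d))"
    unfolding c2 by (simp only: distrib_left mult_ac)
  then have "c * \<bar>(LINT z|\<nu>. ?K (y - z)) - gaussian_density S y\<bar>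
      \<le> a * p powr (- ?d / 2) + b * e powr (- ?d)"
    by (rule mult_left_le_imp_le) (use c1 in simp)
  then have 1: "\<bar>(LINT z|\<nu>. ?K (y - z)) - gaussian_density S y\<bar> \<le> a * p powr (- ?d / 2) + b * e powr (- ?d)"
    using mult_right_mono[OF c1, of "\<bar>(LINT z|\<nu>. ?K (y - z)) - gaussian_density S y\<bar>"] by simp
  have Kb: "?K x \<le> e powr (- ?d)" for x
  proof -
    have "(2 * pi) powr (- ?d / 2) * e powr (- ?d) \<le> 1 * e powr (- ?d)"
      using c1 by (intro mult_right_mono) (auto simp: c_def powr_minus inverse_le_1_iff)
    with K(3)[of x] show ?thesis by simp
  qed
  have int: "integrable M (\<lambda>z. ?K (y - z))" if "finite_measure M" "sets M = sets borel" for M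
  proof -
    interpret finite_measure M by fact
    note [measurable_cong] = that(2)
    show ?thesis by (rule integrable_const_bound[of _ "e powr (- ?d)"]) (auto simp: K(2) Kb)
  qed
  note inu = int[OF nu.finite_measure_axioms nu(2)] and imu = int[OF mu]
  have ih: "integrable lborel (\<lambda>z. h z * ?K (y - z)) \<and> (LINT z|\<nu>. ?K (y - z)) = (LINT z|lborel. h z * ?K (y - z)) + (LINT z|\<mu>. ?K (y - z))"
  proof -
    have "ennreal (LINT z|\<nu>. ?K (y - z)) = (\<integral>\<^sup>+z. ennreal (?K (y - z)) \<partial>\<nu>)"
      by (rule nn_integral_eq_integral[symmetric, OF inu]) (auto simp: K(2))
    also have "\<dots> = (\<integral>\<^sup>+z. ennreal (h z) * ennreal (?K (y - z)) \<partial>lborel) + (\<integral>\<^sup>+z. ennreal (?K (y - z)) \<partial>\<mu>)"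
      by (rule nn_integral_decomposition[OF _ h(1) nu(2) mu(2)]) (use dec in auto)
    also have "(\<integral>\<^sup>+z. ennreal (?K (y - z)) \<partial>\<mu>) = ennreal (LINT z|\<mu>. ?K (y - z))"
      by (rule nn_integral_eq_integral[OF imu]) (auto simp: K(2))
    finally have eq: "ennreal (LINT z|\<nu>. ?K (y - z)) = (\<integral>\<^sup>+z. ennreal (h z * ?K (y - z)) \<partial>lborel) + ennreal (LINT z|\<mu>. ?K (y - z))"
      by (simp add: ennreal_mult h K(2))
    then have "(\<integral>\<^sup>+z. ennreal (h z * ?K (y - z)) \<partial>lborel) \<noteq> \<infinity>"
      by (metis ennreal_add_eq_top ennreal_neq_top infinity_ennreal_def)
    then have I: "integrable lborel (\<lambda>z. h z * ?K (y - z))"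
      by (intro integrableI_nonneg) (auto simp: h K(2) less_top)
    from eq have "ennreal (LINT z|\<nu>. ?K (y - z)) = ennreal ((LINT z|lborel. h z * ?K (y - z)) + (LINT z|\<mu>. ?K (y - z)))"
      by (subst (asm) nn_integral_eq_integral[OF I]) (auto simp: h K(2) Bochner_Integration.integral_nonneg)
    with I show ?thesis
      by (subst (asm) ennreal_inj) (auto simp: h K(2) intro!: Bochner_Integration.integral_nonneg add_nonneg_nonneg)
  qed
  have sp: "space \<mu> = UNIV" using sets_eq_imp_space_eq[OF mu(2)] by simp
  have "0 \<le> (LINT z|\<mu>. ?K (y - z))" by (intro Bochner_Integration.integral_nonneg K(2))
  moreover have "(LINT z|\<mu>. ?K (y - z)) \<le> (LINT z|\<mu>. e powr (- ?d))"
    by (rule integral_mono[OF imu _ Kb]) simp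
  moreover have "(LINT z|\<mu>. e powr (- ?d)) = measure \<mu> UNIV * e powr (- ?d)"
    using sp by simp
  ultimately show ?thesis using 1 ih by (simp add: distrib_right sp abs_le_iff)
qed

section \<open>Characteristic functions of bounded densities\<close>

lemma cis_neq_1:
  assumes "0 < x" "x < 2 * pi"
  shows "cis x \<noteq> 1"
proof
  assume "cis x = 1"
  then have "cos x = 1" by (metis cis.sel(1) one_complex.sel(1))
  moreover have "cos x = 1 - 2 * (sin (x/2))\<^sup>2" using cos_double_sin[of "x/2"] by simp
  moreover have "0 < sin (x/2)" using assms by (intro sin_gt_zero) auto
  ultimately show False by simp
qed

lemma norm_cis_diff_1: "(norm (cis x - 1))\<^sup>2 = 2 * (1 - cos x)"
  by (simp add: cmod_power2 power2_diff algebra_simps)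

text \<open>The set of points of the ball whose phase is close to \<open>a\<close> modulo \<open>2 * pi\<close> has \<open>J\<close> disjoint
  translates in a slightly larger ball, so its volume is small, uniformly in the frequency.\<close>

lemma volume_near_phase:
  fixes d R c :: real
  assumes "0 < d" "0 \<le> R" "0 < c"
  shows "\<exists>e>0. \<forall>\<zeta>::real^'d. \<forall>a. d \<le> norm \<zeta> \<longrightarrow> measure lborel {y. norm y \<le> R \<and> 1 - cos (\<zeta> \<bullet> y - a) \<le> e} \<le> c"
proof -
  let ?B = "cball 0 (R + 2 * pi / d) :: (real^'d) set"
  obtain J0 :: nat where J0: "measure lborel ?B / c \<le> real J0" using real_arch_simple by blast
  \<comment> \<open>\<open>J\<close> is at least the volume of \<open>?B\<close> over
    \<open>c\<close>, so \<open>J\<close> disjoint translates of one set inside \<open>?B\<close>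
    have volume at most \<open>c\<close> each. The summand 2 keeps \<open>{1..<J}\<close>
    nonempty.\<close>
  define J where "J = J0 + 2"
  have J: "measure lborel ?B \<le> real J * c" "2 \<le> J"
    using J0 \<open>0 < c\<close> by (auto simp: J_def field_simps)
  define t where "t = 2 * pi / real J"
  have t0: "0 < t" using J by (simp add: t_def)
  \<comment> \<open>\<open>r\<close> is the least distance from 1 of the nontrivial J-th roots of
    unity. Below, \<open>e\<close> is chosen so that a phase accepted with tolerance
    \<open>e\<close> lies less than r/2 from its target on the circle.\<close>
  define r where "r = Min ((\<lambda>k. norm (cis (real k * t) - 1)) ` {1..<J})"
  have fin: "finite ((\<lambda>k. norm (cis (real k * t) - 1)) ` {1..<J})" "(\<lambda>k. norm (cis (real k * t) - 1)) ` {1..<J} \<noteq> {}"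
    using J by auto
  have nz: "cis (real k * t) \<noteq> 1" if "k \<in> {1..<J}" for k
  proof (rule cis_neq_1)
    show "0 < real k * t" using that t0 by simp
    have "real k * t < real J * t" using that t0 by simp
    also have "real J * t = 2 * pi" using J by (simp add: t_def)
    finally show "real k * t < 2 * pi" .
  qed
  have r0: "0 < r" unfolding r_def using fin nz by (subst Min_gr_iff) auto
  have r: "r \<le> norm (cis (real k * t) - 1)" if "k \<in> {1..<J}" for k
    unfolding r_def using fin that by (intro Min_le) auto
  define e where "e = r\<^sup>2 / 16"
  have e0: "0 < e" using r0 by (simp add: e_def)
  have close: "norm (cis x - 1) < r / 2" if "1 - cos x \<le> e" for x
  proof -
    have "(norm (cis x - 1))\<^sup>2 \<le> 2 * e" using that by (simp add: norm_cis_diff_1)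
    also have "\<dots> < (r / 2)\<^sup>2" using r0 by (simp add: e_def power_divide)
    finally show ?thesis by (rule power_less_imp_less_base) (use r0 in simp)
  qed
  have "measure lborel {y. norm y \<le> R \<and> 1 - cos (\<zeta> \<bullet> y - a) \<le> e} \<le> c" if z: "d \<le> norm \<zeta>" for \<zeta> :: "real^'d" and a
  proof -
    define E where "E = {y. norm y \<le> R \<and> 1 - cos (\<zeta> \<bullet> y - a) \<le> e}"
    have E[measurable]: "E \<in> sets borel" unfolding E_def by measurable
    \<comment> \<open>Translation by \<open>h\<close> along \<open>\<zeta>\<close> shifts the phase
      by exactly \<open>t\<close>; the shifts used have length at most 2 pi / d because the
      frequency has norm at least \<open>d\<close>.\<close>
    define h where "h = (t / (norm \<zeta>)\<^sup>2) *\<^sub>R \<zeta>"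
    have n0: "0 < norm \<zeta>" using z \<open>0 < d\<close> by linarith
    have zh: "\<zeta> \<bullet> h = t" using n0 by (simp add: h_def power2_norm_eq_inner)
    have nh: "norm h = t / norm \<zeta>" using n0 t0 by (simp add: h_def power2_eq_square)
    define F where "F j = (\<lambda>y. - (real j *\<^sub>R h) + y) -` E" for j
    have F[measurable]: "F j \<in> sets borel" for j
      unfolding F_def using measurable_sets[OF _ E, of "(\<lambda>y. - (real j *\<^sub>R h) + y)" borel] by (simp del: add_uminus_conv_diff uminus_add_conv_diff)
    have emF: "emeasure lborel (F j) = emeasure lborel E" for j
    proof -
      have "emeasure lborel E = emeasure (distr lborel borel ((+) (- (real j *\<^sub>R h)))) E"
        by (simp only: lborel_distr_plus)
      also have "\<dots> = emeasure lborel (F j)"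
        by (subst emeasure_distr) (simp_all add: F_def del: add_uminus_conv_diff uminus_add_conv_diff)
      finally show ?thesis ..
    qed
    have sub: "F j \<subseteq> ?B" if "j < J" for j
    proof
      fix y assume "y \<in> F j"
      then have "norm (y - real j *\<^sub>R h) \<le> R" by (simp add: F_def E_def)
      moreover have "norm (real j *\<^sub>R h) \<le> 2 * pi / d"
      proof -
        have "norm (real j *\<^sub>R h) = real j * t / norm \<zeta>" by (simp add: nh)
        also have "\<dots> \<le> real J * t / d" using that z \<open>0 < d\<close> t0 by (intro frac_le mult_right_mono) auto
        also have "\<dots> = 2 * pi / d" using J by (simp add: t_def)
        finally show ?thesis .
      qed
      ultimately show "y \<in> ?B" using norm_triangle_sub[of y "real j *\<^sub>R h"] by simp
    qed
    have "disjoint_family_on F {..<J}"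
    proof (rule ccontr)
      assume "\<not> disjoint_family_on F {..<J}"
      then obtain i j y where ij: "i < J" "j < J" "i < j" and y: "y \<in> F i" "y \<in> F j"
        by (auto simp: disjoint_family_on_def) (metis linorder_neqE_nat)
      \<comment> \<open>A common point of two translates gives two points of the circle, both less
        than r/2 from 1, that differ by a rotation through a nontrivial multiple of
        \<open>t\<close>; the choice of \<open>r\<close> excludes this.\<close>
      define x where "x = \<zeta> \<bullet> y - real j * t - a"
      have c1: "norm (cis x - 1) < r / 2"
        using y(2) by (intro close) (auto simp: F_def E_def x_def inner_diff_right zh algebra_simps)
      have "norm (cis (x + real (j - i) * t) - 1) < r / 2"
        using y(1) ij by (intro close) (auto simp: F_def E_def x_def inner_diff_right zh algebra_simps of_nat_diff)
      then have "norm (cis (x + real (j - i) * t) - cis x) < r"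
        using c1 norm_triangle_ineq4[of "cis (x + real (j - i) * t) - 1" "cis x - 1"] by simp
      moreover have "cis (x + real (j - i) * t) - cis x = cis x * (cis (real (j - i) * t) - 1)"
        by (simp add: algebra_simps cis_mult)
      ultimately have "norm (cis (real (j - i) * t) - 1) < r" by (simp add: norm_mult)
      moreover have "j - i \<in> {1..<J}" using ij by auto
      ultimately show False using r by fastforce
    qed
    then have "(\<Sum>j<J. emeasure lborel (F j)) = emeasure lborel (\<Union>j<J. F j)"
      by (intro sum_emeasure) auto
    also have "\<dots> \<le> emeasure lborel ?B" using sub by (intro emeasure_mono) auto
    finally have le: "of_nat J * emeasure lborel E \<le> emeasure lborel ?B" by (simp add: emF)
    have "E \<subseteq> cball 0 R" by (auto simp: E_def)
    then have "emeasure lborel E \<le> emeasure lborel (cball 0 R :: (real^'d) set)" by (intro emeasure_mono) auto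
    then have fE: "emeasure lborel E \<noteq> \<infinity>"
      using emeasure_lborel_cball_finite[of "0::real^'d" R] by (auto simp: top_unique)
    have "emeasure lborel ?B = ennreal (measure lborel ?B)"
      by (rule emeasure_eq_ennreal_measure) (use emeasure_lborel_cball_finite[of "0::real^'d" "R + 2 * pi / d"] in auto)
    then have "real J * measure lborel E \<le> measure lborel ?B"
      using le fE by (simp add: emeasure_eq_ennreal_measure emeasure_lborel_cball_finite ennreal_of_nat_eq_real_of_nat less_top[symmetric] flip: ennreal_mult)
    then have "real J * measure lborel E \<le> real J * c" using J by linarith
    then have "measure lborel E \<le> c" by (rule mult_left_le_imp_le) (use J in simp)
    then show ?thesis by (simp only: E_def)
  qed
  then show ?thesis using e0 by blast
qed

text \<open>Rotating by the argument \<open>a\<close> of the integral, the defect of the modulus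
  from the total mass becomes the integral of 1 - cos(\<zeta>.y - a). Of the mass \<open>q\<close>
  carried by \<open>h\<close>, at most q/4 lies outside a ball by the first moment, and at most q/4
  on the small set of nearly constant phase because \<open>h\<close> is at most \<open>M\<close>; on
  what is left, of mass at least q/2, the integrand exceeds \<open>e\<close>.\<close>

lemma fourier_gap:
  fixes M q C \<delta> :: real
  assumes "0 \<le> M" "0 < q" "0 \<le> C" "0 < \<delta>"
  shows "\<exists>\<kappa>>0. \<forall>\<nu> \<mu> h. \<forall>\<zeta>::real^'d.
    finite_measure \<nu> \<longrightarrow> sets \<nu> = sets borel \<longrightarrow> h \<in> borel_measurable borel \<longrightarrow> (\<forall>y. 0 \<le> h y \<and> h y \<le> M) \<longrightarrow>
    (\<forall>B\<in>sets borel. emeasure \<nu> B = (\<integral>\<^sup>+y\<in>B. ennreal (h y) \<partial>lborel) + emeasure \<mu> B) \<longrightarrow>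
    emeasure \<mu> UNIV + ennreal q \<le> emeasure \<nu> UNIV \<longrightarrow> (\<integral>\<^sup>+y. ennreal (norm y) \<partial>\<nu>) \<le> ennreal C \<longrightarrow> \<delta> \<le> norm \<zeta> \<longrightarrow>
    norm (LINT y|\<nu>. cis (\<zeta> \<bullet> y)) \<le> measure \<nu> UNIV - \<kappa>"
proof -
  \<comment> \<open>Markov's inequality leaves at most the mass C/R <= q/4 outside the ball of
    radius \<open>R\<close>.\<close>
  define R where "R = 4 * C / q + 1"
  have R: "0 < R" "C / R \<le> q / 4" using assms by (auto simp: R_def field_simps add_pos_nonneg)
  \<comment> \<open>On a set of this volume a density bounded by \<open>M\<close> has mass at most
    q/4; the summand 1 covers the case M = 0.\<close>
  obtain e where e: "0 < e" and vol: "\<And>\<zeta>::real^'d. \<And>a. \<delta> \<le> norm \<zeta> \<Longrightarrow>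
      measure lborel {y. norm y \<le> R \<and> 1 - cos (\<zeta> \<bullet> y - a) \<le> e} \<le> q / (4 * (M + 1))"
    using volume_near_phase[of \<delta> R "q / (4 * (M + 1))", where 'd='d] assms R by auto
  show ?thesis
  proof (intro exI[of _ "e * (q / 2)"] conjI allI impI)
    show "0 < e * (q / 2)" using e assms by simp
    fix \<nu> \<mu> :: "(real^'d) measure" and h and \<zeta> :: "real^'d"
    assume "finite_measure \<nu>" and [measurable_cong]: "sets \<nu> = sets borel" and [measurable]: "h \<in> borel_measurable borel"
      and h: "\<forall>y. 0 \<le> h y \<and> h y \<le> M"
      and dec: "\<forall>B\<in>sets borel. emeasure \<nu> B = (\<integral>\<^sup>+y\<in>B. ennreal (h y) \<partial>lborel) + emeasure \<mu> B"
      and q: "emeasure \<mu> UNIV + ennreal q \<le> emeasure \<nu> UNIV"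
      and C: "(\<integral>\<^sup>+y. ennreal (norm y) \<partial>\<nu>) \<le> ennreal C" and z: "\<delta> \<le> norm \<zeta>"
    interpret finite_measure \<nu> by fact
    have sp: "space \<nu> = UNIV" using sets_eq_imp_space_eq[OF \<open>sets \<nu> = sets borel\<close>] by simp
    have ci: "integrable \<nu> (\<lambda>y. cis (\<zeta> \<bullet> y))" by (rule integrable_const_bound[of _ 1]) auto
    define z where "z = (LINT y|\<nu>. cis (\<zeta> \<bullet> y))"
    define a where "a = Arg z"
    have za: "z = complex_of_real (norm z) * cis a" using rcis_cmod_Arg[of z] by (simp add: a_def rcis_def)
    let ?p = "\<lambda>y. 1 - cos (\<zeta> \<bullet> y - a)"
    have pn: "0 \<le> ?p y" for y by simp
    have pi: "integrable \<nu> ?p" by (rule integrable_const_bound[of _ 2]) (auto simp: abs_le_iff intro!: AE_I2 order_trans[OF cos_ge_minus_one])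
    have "measure \<nu> UNIV - norm z = (LINT y|\<nu>. ?p y)"
    proof -
      have "complex_of_real (norm z) = cis (- a) * z" by (subst za) (simp add: mult.left_commute cis_mult)
      also have "\<dots> = (LINT y|\<nu>. cis (- a) * cis (\<zeta> \<bullet> y))" unfolding z_def by (rule integral_mult_right_zero[symmetric])
      also have "\<dots> = (LINT y|\<nu>. cis (\<zeta> \<bullet> y - a))" by (simp add: cis_mult)
      finally have "norm z = Re (LINT y|\<nu>. cis (\<zeta> \<bullet> y - a))" by (metis Re_complex_of_real)
      also have "\<dots> = (LINT y|\<nu>. cos (\<zeta> \<bullet> y - a))"
        by (subst integral_Re[symmetric]) (auto intro!: integrable_const_bound[of _ 1])
      finally have "norm z = (LINT y|\<nu>. cos (\<zeta> \<bullet> y - a))" .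
      moreover have "(LINT y|\<nu>. ?p y) = measure \<nu> UNIV - (LINT y|\<nu>. cos (\<zeta> \<bullet> y - a))"
        by (subst Bochner_Integration.integral_diff) (auto intro!: integrable_const_bound[of _ 1] simp: sp)
      ultimately show ?thesis by simp
    qed
    moreover have "e * (q / 2) \<le> (LINT y|\<nu>. ?p y)"
    proof -
      define A :: "(real^'d) set" where "A = {y. norm y \<le> R}"
      define E where "E = {y. norm y \<le> R \<and> ?p y \<le> e}"
      define G where "G = {y. e < ?p y}"
      have [measurable]: "A \<in> sets borel" "E \<in> sets borel" "G \<in> sets borel" unfolding A_def E_def G_def by measurable
      let ?I = "\<lambda>B. \<integral>\<^sup>+y\<in>B. ennreal (h y) \<partial>lborel"
      have tail: "emeasure \<nu> (- A) \<le> ennreal (q / 4)"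
      proof -
        have "ennreal R * emeasure \<nu> (- A) = (\<integral>\<^sup>+y. ennreal R * indicator (- A) y \<partial>\<nu>)"
          by (subst nn_integral_cmult_indicator) auto
        also have "\<dots> \<le> (\<integral>\<^sup>+y. ennreal (norm y) \<partial>\<nu>)"
          by (intro nn_integral_mono) (auto simp: A_def split: split_indicator intro!: ennreal_leI)
        also have "\<dots> \<le> ennreal C" by (rule C)
        finally have "R * measure \<nu> (- A) \<le> C" using R assms
          by (simp add: emeasure_eq_measure flip: ennreal_mult)
        then have "measure \<nu> (- A) \<le> C / R" using R by (simp add: field_simps)
        then have "measure \<nu> (- A) \<le> q / 4" using R(2) by linarith
        then show ?thesis by (simp add: emeasure_eq_measure ennreal_leI)
      qed
      have muf: "emeasure \<mu> UNIV \<noteq> \<infinity>" using q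
        by (metis ennreal_add_eq_top emeasure_finite infinity_ennreal_def sp top.extremum_uniqueI)
      have tot: "ennreal q \<le> ?I UNIV"
      proof -
        have "emeasure \<mu> UNIV + ennreal q \<le> emeasure \<mu> UNIV + ?I UNIV" using q dec by (simp add: add.commute)
        then show ?thesis using muf by (simp add: ennreal_add_left_cancel_le)
      qed
      have EI: "?I UNIV \<le> ?I G + (?I E + ?I (- A))"
      proof -
        have "?I UNIV \<le> (\<integral>\<^sup>+y. ennreal (h y) * indicator G y + (ennreal (h y) * indicator E y + ennreal (h y) * indicator (- A) y) \<partial>lborel)"
          by (intro nn_integral_mono) (auto simp: A_def E_def G_def split: split_indicator)
        also have "\<dots> = ?I G + (?I E + ?I (- A))" by (simp add: nn_integral_add)
        finally show ?thesis .
      qed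
      have e1: "?I E \<le> ennreal (q / 4)"
      proof -
        have "?I E \<le> (\<integral>\<^sup>+y. ennreal (M + 1) * indicator E y \<partial>lborel)"
          using h by (intro nn_integral_mono) (auto split: split_indicator intro!: ennreal_leI order_trans[OF conjunct2[OF spec[OF h]]])
        also have "\<dots> = ennreal (M + 1) * emeasure lborel E" by (rule nn_integral_cmult_indicator) auto
        also have "emeasure lborel E = ennreal (measure lborel E)"
        proof (rule emeasure_eq_ennreal_measure)
          have "emeasure lborel E \<le> emeasure lborel (cball 0 R :: (real^'d) set)" by (intro emeasure_mono) (auto simp: E_def)
          then show "emeasure lborel E \<noteq> top" using emeasure_lborel_cball_finite[of "0::real^'d" R] by (auto simp: top_unique)
        qed
        also have "ennreal (M + 1) * \<dots> \<le> ennreal (M + 1) * ennreal (q / (4 * (M + 1)))"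
          by (intro mult_left_mono ennreal_leI) (use vol[OF z, of a] in \<open>auto simp: E_def\<close>)
        also have "\<dots> = ennreal ((M + 1) * (q / (4 * (M + 1))))" using assms by (intro ennreal_mult[symmetric]) auto
        also have "(M + 1) * (q / (4 * (M + 1))) = q / 4" using assms by (simp add: divide_simps)
        finally show ?thesis .
      qed
      have e2: "?I (- A) \<le> ennreal (q / 4)"
      proof -
        have "?I (- A) \<le> emeasure \<nu> (- A)" using dec by (auto intro: add_increasing2)
        with tail show ?thesis by simp
      qed
      have e3: "?I G \<le> emeasure \<nu> G" using dec by (auto intro: add_increasing2)
      have "ennreal q \<le> emeasure \<nu> G + (ennreal (q / 4) + ennreal (q / 4))"
        by (rule order_trans[OF tot order_trans[OF EI add_mono[OF e3 add_mono[OF e1 e2]]]])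
      also have "\<dots> = ennreal (measure \<nu> G + (q / 4 + q / 4))"
        using assms by (simp add: emeasure_eq_measure ennreal_plus[symmetric] del: ennreal_plus)
      finally have "ennreal q \<le> ennreal (measure \<nu> G + (q / 4 + q / 4))" .
      then have "q \<le> measure \<nu> G + (q / 4 + q / 4)" using assms by (subst (asm) ennreal_le_iff) auto
      then have "q / 2 \<le> measure \<nu> G" by simp
      then have "e * (q / 2) \<le> (LINT y|\<nu>. e * indicator G y)" using e by (simp add: sp)
      also have "\<dots> \<le> (LINT y|\<nu>. ?p y)"
      proof (rule integral_mono[OF _ pi])
        show "integrable \<nu> (\<lambda>y. e * indicator G y)"
          by (rule integrable_const_bound[of _ e]) (use e in \<open>auto simp: indicator_def\<close>)
      qed (auto simp: G_def pn split: split_indicator)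
      finally show ?thesis .
    qed
    ultimately show "norm (LINT y|\<nu>. cis (\<zeta> \<bullet> y)) \<le> measure \<nu> UNIV - e * (q / 2)" by (simp add: z_def)
  qed
qed

section \<open>Uniform minorization of ergodic matrices\<close>

lemma mat_pow_0 [simp]: "mat_pow P 0 = mat 1"
  and mat_pow_Suc: "mat_pow P (Suc m) = P ** mat_pow P m"
  by (simp_all add: mat_pow_def)

lemma mat_pow_add: "mat_pow P (m + n) = mat_pow P m ** mat_pow P n"
  by (induction m) (simp_all add: mat_pow_Suc matrix_mul_assoc)

lemma stochastic_mult:
  assumes "stochastic A" "stochastic B"
  shows "stochastic (A ** B)"
proof -
  have "(\<Sum>l\<in>UNIV. (A ** B) $ k $ l) = 1" for k
  proof -
    have "(\<Sum>l\<in>UNIV. (A ** B) $ k $ l) = (\<Sum>j\<in>UNIV. \<Sum>l\<in>UNIV. A $ k $ j * B $ j $ l)"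
      unfolding matrix_matrix_mult_def vec_lambda_beta by (rule sum.swap)
    also have "\<dots> = (\<Sum>j\<in>UNIV. A $ k $ j)"
      using assms by (simp add: stochastic_def flip: sum_distrib_left)
    finally show ?thesis using assms by (simp add: stochastic_def)
  qed
  then show ?thesis using assms
    by (auto simp: stochastic_def matrix_matrix_mult_def intro!: sum_nonneg)
qed

lemma stochastic_mat_pow: "stochastic P \<Longrightarrow> stochastic (mat_pow P m)"
proof (induction m)
  case 0
  show ?case by (simp add: stochastic_def mat_def)
qed (simp add: mat_pow_Suc stochastic_mult)

lemma stochastic_lower_bound:
  assumes "stochastic P" "\<And>k l. c \<le> A $ k $ l"
  shows "c \<le> (P ** A) $ k $ l"
proof -
  have "c = (\<Sum>j\<in>UNIV. P $ k $ j * c)" using assms(1) by (simp add: stochastic_def flip: sum_distrib_right)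
  also have "\<dots> \<le> (\<Sum>j\<in>UNIV. P $ k $ j * A $ j $ l)"
    using assms by (intro sum_mono mult_left_mono) (auto simp: stochastic_def)
  finally show ?thesis by (simp add: matrix_matrix_mult_def)
qed

text \<open>Left multiplication by a stochastic matrix averages over rows, so a uniform lower bound
  on the entries survives in all later powers. This later allows one exponent for a whole compact
  set.\<close>

lemma mat_pow_lower_bound_mono:
  assumes "stochastic P" "\<And>k l. c \<le> mat_pow P m $ k $ l" "m \<le> n"
  shows "c \<le> mat_pow P n $ k $ l"
proof -
  have "c \<le> mat_pow P (j + m) $ k $ l" for j k l
    by (induction j arbitrary: k l) (auto simp: assms mat_pow_Suc intro!: stochastic_lower_bound)
  from this[of "n - m"] show ?thesis using assms(3) by simp
qed

lemma mat_pow_pos_trans: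
  assumes "stochastic P" "0 < mat_pow P m $ k $ j" "0 < mat_pow P n $ j $ l"
  shows "0 < mat_pow P (m + n) $ k $ l"
proof -
  have nn: "0 \<le> mat_pow P m $ k $ j" for m k j using stochastic_mat_pow[OF assms(1)] by (auto simp: stochastic_def)
  have "0 < mat_pow P m $ k $ j * mat_pow P n $ j $ l" using assms by simp
  also have "\<dots> \<le> (\<Sum>j\<in>UNIV. mat_pow P m $ k $ j * mat_pow P n $ j $ l)"
    by (rule member_le_sum[where f = "\<lambda>j. mat_pow P m $ k $ j * mat_pow P n $ j $ l"]) (auto intro: nn mult_nonneg_nonneg)
  finally show ?thesis by (simp add: mat_pow_add matrix_matrix_mult_def)
qed

text \<open>The least positive difference of two elements divides every element, hence it is one;
  if \<open>a\<close> and \<open>a + 1\<close> are in the semigroup, so is everything from \<open>a * a\<close> on.\<close>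

lemma numerical_semigroup_cofinite:
  fixes S :: "nat set"
  assumes add: "\<And>a b. a \<in> S \<Longrightarrow> b \<in> S \<Longrightarrow> a + b \<in> S" and gcd: "Gcd S = 1"
  shows "\<exists>N. \<forall>n\<ge>N. n \<in> insert 0 S"
proof -
  let ?T = "insert 0 S"
  have addT: "a \<in> ?T \<Longrightarrow> b \<in> ?T \<Longrightarrow> a + b \<in> ?T" for a b using add by auto
  have mulT: "a \<in> ?T \<Longrightarrow> q * a \<in> ?T" for a q by (induction q) (use addT in auto)
  define D where "D = {d. 0 < d \<and> (\<exists>a\<in>?T. a + d \<in> ?T)}"
  have "\<exists>s\<in>S. s \<noteq> 0" using gcd by (metis Gcd_0_iff subsetI singleton_iff zero_neq_one)
  then have "\<exists>d. d \<in> D" by (auto simp: D_def)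
  define d where "d = (LEAST d. d \<in> D)"
  have dD: "d \<in> D" unfolding d_def using \<open>\<exists>d. d \<in> D\<close> by (rule LeastI_ex)
  have least: "d \<le> e" if "e \<in> D" for e unfolding d_def using that by (rule Least_le)
  obtain a where a: "a \<in> ?T" "a + d \<in> ?T" and d0: "0 < d" using dD unfolding D_def by blast
  have "d dvd s" if "s \<in> S" for s
  proof -
    define q r where "q = s div d" and "r = s mod d"
    have s: "s = q * d + r" by (simp add: q_def r_def)
    have "r = 0"
    proof (rule ccontr)
      assume "r \<noteq> 0"
      \<comment> \<open>Both q(a + d) + r = s + qa and q(a + d) lie in the semigroup, so
        \<open>r\<close> is a positive difference smaller than the least one.\<close>
      have "q * (a + d) + r = s + q * a" by (simp add: s algebra_simps)
      also have "\<dots> \<in> ?T" using that a by (intro addT mulT) auto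
      finally have "q * (a + d) + r \<in> ?T" .
      moreover have "q * (a + d) \<in> ?T" by (rule mulT[OF a(2)])
      ultimately have "r \<in> D" using \<open>r \<noteq> 0\<close> unfolding D_def by blast
      with least[of r] mod_less_divisor[OF d0, of s] show False by (simp add: r_def)
    qed
    then show ?thesis by (simp add: s)
  qed
  then have "d dvd Gcd S" by (rule Gcd_greatest)
  then have d1: "d = 1" using gcd by simp
  have "n \<in> ?T" if "n \<ge> a * a" for n
  proof (cases "a = 0")
    case True
    then have "1 \<in> ?T" using a(2) d1 True by simp
    from mulT[OF this, of n] show ?thesis by simp
  next
    case False
    define q r where "q = n div a" and "r = n mod a"
    have "a \<le> q" unfolding q_def using False that by (simp add: less_eq_div_iff_mult_less_eq)
    moreover have "r < a" using False by (simp add: r_def)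
    ultimately have "n = (q - r) * a + r * (a + d)"
      by (simp add: d1 algebra_simps) (simp add: q_def r_def flip: distrib_right)
    also have "\<dots> \<in> ?T" by (rule addT[OF mulT[OF a(1)] mulT[OF a(2)]])
    finally show ?thesis .
  qed
  then show ?thesis by blast
qed

text \<open>The return times to \<open>k\<close> are closed under addition and have greatest common
  divisor one, hence contain all large times; followed by a path from \<open>k\<close> to
  \<open>l\<close> they make every entry positive.\<close>

lemma ergodic_mat_pow_pos:
  fixes P :: "real^'n^'n"
  assumes "P \<in> ergodic_mats"
  shows "\<exists>m. \<forall>n\<ge>m. \<forall>k l. 0 < mat_pow P n $ k $ l"
proof -
  have P: "stochastic P" "irreducible_mat P" "aperiodic_mat P" using assms by (auto simp: ergodic_mats_def)
  have "\<exists>m. \<forall>n\<ge>m. 0 < mat_pow P n $ k $ k" for k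
  proof -
    let ?S = "{m. m \<ge> 1 \<and> mat_pow P m $ k $ k > 0}"
    have "\<exists>N. \<forall>n\<ge>N. n \<in> insert 0 ?S"
      by (rule numerical_semigroup_cofinite) (use P in \<open>auto simp: aperiodic_mat_def intro: mat_pow_pos_trans\<close>)
    then obtain N where "\<forall>n\<ge>N. n \<in> insert 0 ?S" by blast
    then have "0 < mat_pow P n $ k $ k" if "n \<ge> Suc N" for n using that by (auto dest!: spec[of _ n])
    then show ?thesis by blast
  qed
  then obtain a where a: "\<And>k n. n \<ge> a k \<Longrightarrow> 0 < mat_pow P n $ k $ k" by metis
  from P(2) obtain b where b: "\<And>k l. 0 < mat_pow P (b k l) $ k $ l" unfolding irreducible_mat_def by metis
  define m where "m = Max (range a) + Max (range (\<lambda>(k, l). b k l))"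
  have "0 < mat_pow P n $ k $ l" if "n \<ge> m" for n k l
  proof -
    have "a k \<le> Max (range a)" "b k l \<le> Max (range (\<lambda>(k, l). b k l))" by (auto intro!: Max_ge image_eqI[of _ _ "(k, l)"])
    then have "a k + b k l \<le> n" using that unfolding m_def by linarith
    then have "0 < mat_pow P (n - b k l) $ k $ k" using a by simp
    from mat_pow_pos_trans[OF P(1) this b[of k l]] show ?thesis using \<open>a k + b k l \<le> n\<close> by simp
  qed
  then show ?thesis by blast
qed

lemma continuous_on_mat_pow: "continuous_on UNIV (\<lambda>P::real^'n^'n. mat_pow P m $ k $ l)"
proof (induction m arbitrary: k l)
  case (Suc m)
  have "continuous_on UNIV (\<lambda>P::real^'n^'n. \<Sum>j\<in>UNIV. P $ k $ j * mat_pow P m $ j $ l)"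
    by (intro continuous_on_sum continuous_on_mult Suc.IH continuous_on_component continuous_on_id)
  then show ?case by (simp add: mat_pow_Suc matrix_matrix_mult_def)
qed simp

text \<open>The distance dominates the differences of all entries, so the identity is continuous
  into the Euclidean space and transports compactness.\<close>

lemma compactin_ergodic_imp_compact:
  fixes P0 :: "(real^'n^'n) set"
  assumes "compactin ergodic_topology P0"
  shows "compact P0" "P0 \<subseteq> ergodic_mats"
proof -
  interpret Metric_space "ergodic_mats :: (real^'n^'n) set" mat_inf_dist by (rule Metric_space_mat_inf_dist)
  show "P0 \<subseteq> ergodic_mats" using compactin_subset_topspace[OF assms] by (simp add: ergodic_topology_def)
  have "continuous_map ergodic_topology euclidean (\<lambda>P::real^'n^'n. P)"
    unfolding ergodic_topology_def continuous_map_def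
  proof (intro conjI allI impI)
    fix U :: "(real^'n^'n) set" assume "openin euclidean U"
    then have U: "open U" by simp
    show "openin mtopology {x \<in> topspace mtopology. x \<in> U}"
      unfolding openin_mtopology
    proof (intro conjI allI impI)
      fix x :: "real^'n^'n" assume x: "x \<in> {x \<in> topspace mtopology. x \<in> U}"
      then obtain e where e: "0 < e" "ball x e \<subseteq> U" using openE[OF U, of x] by auto
      define C where "C = real (CARD('n) * CARD('n))"
      have C: "0 < C" by (simp add: C_def)
      have "dist x y < e" if "mat_inf_dist x y < e / C" for y
      proof -
        have ent: "\<bar>x $ k $ l - y $ k $ l\<bar> \<le> mat_inf_dist x y" for k l
          using mat_entry_le_mat_inf_norm[of "\<chi> k l. complex_of_real ((x - y) $ k $ l)" k l]
          by (simp add: mat_inf_dist_def flip: of_real_diff)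
        have "dist x y \<le> (\<Sum>k\<in>UNIV. norm ((x - y) $ k))" unfolding dist_norm by (subst norm_vec_def) (rule L2_set_le_sum, simp)
        also have "\<dots> \<le> (\<Sum>k\<in>UNIV. \<Sum>l\<in>UNIV. \<bar>(x - y) $ k $ l\<bar>)" by (intro sum_mono norm_le_l1_cart)
        also have "\<dots> \<le> (\<Sum>k\<in>(UNIV::'n set). \<Sum>l\<in>(UNIV::'n set). mat_inf_dist x y)" by (intro sum_mono) (simp add: ent)
        also have "\<dots> = C * mat_inf_dist x y" by (simp add: C_def)
        also have "\<dots> < e" using that C by (simp add: field_simps)
        finally show ?thesis .
      qed
      then have "mball x (e / C) \<subseteq> {x \<in> topspace mtopology. x \<in> U}" using e by auto
      then show "\<exists>r>0. mball x r \<subseteq> {x \<in> topspace mtopology. x \<in> U}" using e C by (meson divide_pos_pos)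
    qed auto
  qed auto
  from image_compactin[OF assms this] show "compact P0" by simp
qed

text \<open>The sets \<open>U m\<close> of matrices with entrywise positive m-th power are open and
  cover \<open>P0\<close>. Finitely many of them suffice, positivity persists for larger exponents,
  and a continuous positive function on a compact set has a positive minimum.\<close>

lemma uniform_minorization:
  fixes P0 :: "(real^'n^'n) set"
  assumes "compactin ergodic_topology P0"
  shows "\<exists>m \<theta>. 0 < \<theta> \<and> \<theta> < 1 \<and> 1 \<le> m \<and> (\<forall>P\<in>P0. \<forall>n\<ge>m. \<forall>k l. \<theta> \<le> mat_pow P n $ k $ l)"
proof -
  note co = compactin_ergodic_imp_compact[OF assms]
  have st: "stochastic P" if "P \<in> P0" for P using co(2) that by (auto simp: ergodic_mats_def)
  define U where "U m = (\<Inter>k. \<Inter>l. {P::real^'n^'n. 0 < mat_pow P m $ k $ l})" for m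
  have "open (U m)" for m
    unfolding U_def by (intro open_INT ballI open_Collect_less continuous_on_mat_pow continuous_on_const) simp_all
  moreover have "P0 \<subseteq> (\<Union>m. U m)"
    using ergodic_mat_pow_pos co(2) by (fastforce simp: U_def)
  ultimately obtain F where F: "finite F" "P0 \<subseteq> (\<Union>m\<in>F. U m)"
    using compactE_image[OF co(1), of UNIV U] by auto
  define m where "m = Max (insert 1 F)"
  have m1: "1 \<le> m" unfolding m_def using F by simp
  have pos: "0 < mat_pow P m $ k $ l" if P: "P \<in> P0" for P k l
  proof -
    from F P obtain i where i: "i \<in> F" "P \<in> U i" by blast
    define c where "c = Min (range (\<lambda>(k, l). mat_pow P i $ k $ l))"
    have "0 < c" unfolding c_def using i by (subst Min_gr_iff) (auto simp: U_def)
    moreover have "c \<le> mat_pow P i $ k $ l" for k l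
      unfolding c_def by (auto intro!: Min_le image_eqI[of _ _ "(k, l)"])
    moreover have "i \<le> m" unfolding m_def using F i by simp
    ultimately show ?thesis using mat_pow_lower_bound_mono[OF st[OF P]] less_le_trans by blast
  qed
  have "\<exists>c>0. \<forall>P\<in>P0. c \<le> mat_pow P m $ k $ l" for k l
  proof (cases "P0 = {}")
    case False
    from continuous_attains_inf[OF co(1) False continuous_on_subset[OF continuous_on_mat_pow[of m k l]]] pos
    show ?thesis by blast
  qed (auto intro: exI[of _ 1])
  then obtain c where c: "\<And>k l. 0 < c k l" "\<And>k l P. P \<in> P0 \<Longrightarrow> c k l \<le> mat_pow P m $ k $ l" by metis
  define t where "t = min (1/2) (Min (range (\<lambda>(k, l). c k l)))"
  have "0 < Min (range (\<lambda>(k, l). c k l))" by (subst Min_gr_iff) (auto simp: c)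
  then have "0 < t" "t < 1" by (auto simp: t_def)
  moreover have "t \<le> mat_pow P m $ k $ l" if "P \<in> P0" for P k l
  proof -
    have "t \<le> c k l" unfolding t_def by (intro min.coboundedI2 Min_le) (auto intro!: image_eqI[of _ _ "(k, l)"])
    with c(2)[OF that, of k l] show ?thesis by simp
  qed
  ultimately show ?thesis using m1 mat_pow_lower_bound_mono st by blast
qed

section \<open>Perturbation of a stochastic matrix\<close>

lemma vec_sup_norm_add: "vec_sup_norm (x + y) \<le> vec_sup_norm x + vec_sup_norm y"
  unfolding vec_sup_norm_le_iff
  by (auto intro!: order_trans[OF norm_triangle_ineq] add_mono vec_sup_norm_ge)

lemma vec_sup_norm_scale: "vec_sup_norm (c *s x) \<le> cmod c * vec_sup_norm x"
  unfolding vec_sup_norm_le_iff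
  by (auto simp: norm_mult intro!: mult_left_mono vec_sup_norm_ge)

lemma vec_sup_norm_diff: "vec_sup_norm (x - y) \<le> vec_sup_norm x + vec_sup_norm y"
  unfolding vec_sup_norm_le_iff
  by (auto intro!: order_trans[OF norm_triangle_ineq4] add_mono vec_sup_norm_ge)

lemma vec_sup_norm_mult_vec:
  assumes "\<And>k. (\<Sum>l\<in>UNIV. cmod (A $ k $ l)) \<le> c"
  shows "vec_sup_norm (A *v x) \<le> c * vec_sup_norm x"
  unfolding vec_sup_norm_le_iff
proof
  fix k
  have "cmod ((A *v x) $ k) \<le> (\<Sum>l\<in>UNIV. cmod (A $ k $ l) * cmod (x $ l))"
    unfolding matrix_vector_mult_def vec_lambda_beta by (rule order_trans[OF norm_sum]) (simp add: norm_mult)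
  also have "\<dots> \<le> (\<Sum>l\<in>UNIV. cmod (A $ k $ l) * vec_sup_norm x)"
    by (intro sum_mono mult_left_mono vec_sup_norm_ge) auto
  also have "\<dots> \<le> c * vec_sup_norm x"
    unfolding sum_distrib_right[symmetric] by (intro mult_right_mono assms vec_sup_norm_nonneg)
  finally show "cmod ((A *v x) $ k) \<le> c * vec_sup_norm x" .
qed

definition cvec :: "real^'n \<Rightarrow> complex^'n" where "cvec x = (\<chi> k. complex_of_real (x $ k))"
definition cmat :: "real^'n^'n \<Rightarrow> complex^'n^'n" where "cmat A = (\<chi> k l. complex_of_real (A $ k $ l))"

lemma cvec_nth [simp]: "cvec x $ k = complex_of_real (x $ k)" by (simp add: cvec_def)
lemma cmat_nth [simp]: "cmat A $ k $ l = complex_of_real (A $ k $ l)" by (simp add: cmat_def)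

lemma cmat_mult_cvec: "cmat A *v cvec x = cvec (A *v x)"
  by (simp add: vec_eq_iff matrix_vector_mult_def)

lemma cmat_mult: "cmat (A ** B) = cmat A ** cmat B"
  by (simp add: vec_eq_iff matrix_matrix_mult_def)

lemma vec_sup_norm_cvec_le_iff: "vec_sup_norm (cvec x) \<le> c \<longleftrightarrow> (\<forall>k. \<bar>x $ k\<bar> \<le> c)"
  by (simp add: vec_sup_norm_le_iff)

lemma vec_sup_norm_one [simp]: "vec_sup_norm (1 :: complex^'n) = 1"
  by (simp add: vec_sup_norm_def)

lemma cmat_mat_pow:
  fixes P :: "real^'n^'n"
  shows "((*v) (cmat P) ^^ m) x = cmat (mat_pow P m) *v x"
proof (induction m)
  case 0
  have "cmat (mat 1) = (mat 1 :: complex^'n^'n)" by (simp add: vec_eq_iff mat_def)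
  then show ?case by simp
qed (simp add: mat_pow_Suc cmat_mult matrix_vector_mul_assoc)

text \<open>The matrix with all rows equal to \<open>p\<close> annihilates \<open>z\<close>, so
  \<theta> times it may be subtracted from \<open>Q\<close>. Since the entries of \<open>p\<close>
  are at most one, the difference is still nonnegative, and its row sums are 1 - \<theta>.\<close>

lemma doeblin_contraction:
  fixes Q :: "real^'n^'n" and p :: "real^'n"
  assumes st: "stochastic Q" and p: "\<And>k. 0 \<le> p $ k" "(\<Sum>k\<in>UNIV. p $ k) = 1"
    and Q: "\<And>k l. \<theta> \<le> Q $ k $ l" "0 \<le> \<theta>" and z: "(\<Sum>k\<in>UNIV. complex_of_real (p $ k) * z $ k) = 0"
  shows "vec_sup_norm (cmat Q *v z) \<le> (1 - \<theta>) * vec_sup_norm z"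
proof -
  have p1: "p $ l \<le> 1" for l
    using member_le_sum[of l UNIV "\<lambda>k. p $ k"] p by simp
  let ?M = "\<chi> k l. complex_of_real (Q $ k $ l - \<theta> * p $ l)"
  have "cmat Q *v z = ?M *v z"
  proof -
    have "(cmat Q *v z) $ k = (?M *v z) $ k" for k
    proof -
      have "(?M *v z) $ k = (\<Sum>l\<in>UNIV. complex_of_real (Q $ k $ l) * z $ l) - complex_of_real \<theta> * (\<Sum>k\<in>UNIV. complex_of_real (p $ k) * z $ k)"
        by (simp add: matrix_vector_mult_def sum_subtractf left_diff_distrib sum_distrib_left mult.assoc)
      then show ?thesis by (simp add: z matrix_vector_mult_def)
    qed
    then show ?thesis by (simp add: vec_eq_iff)
  qed
  moreover have "vec_sup_norm (?M *v z) \<le> (1 - \<theta>) * vec_sup_norm z"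
  proof (rule vec_sup_norm_mult_vec)
    fix k
    have "\<theta> * p $ l \<le> Q $ k $ l" for l
      using mult_left_mono[OF p1 Q(2), of l] Q(1)[of k l] by simp
    then have "(\<Sum>l\<in>UNIV. cmod (?M $ k $ l)) = (\<Sum>l\<in>UNIV. Q $ k $ l - \<theta> * p $ l)"
      by (intro sum.cong) (simp_all flip: of_real_diff of_real_mult)
    also have "\<dots> = 1 - \<theta>" using st p by (simp add: sum_subtractf stochastic_def flip: sum_distrib_left)
    finally show "(\<Sum>l\<in>UNIV. cmod (?M $ k $ l)) \<le> 1 - \<theta>" by simp
  qed
  ultimately show ?thesis by simp
qed

lemma cvec_mat_pow: "cvec (mat_pow P m *v x) = cmat (mat_pow P m) *v cvec x"
  by (simp add: cmat_mult_cvec)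

lemma stochastic_vec_sup_norm: "stochastic Q \<Longrightarrow> vec_sup_norm (cmat Q *v z) \<le> vec_sup_norm z"
  using vec_sup_norm_mult_vec[of "cmat Q" 1 z] by (auto simp: stochastic_def)

text \<open>A centered vector fixed by \<open>P\<close> is contracted by the m-th power, hence zero;
  this gives solvability. Iterating x = y + P x for \<open>m\<close> steps bounds \<open>x\<close>
  by m |y| + (1 - \<theta>) |x|, which yields the constant m / \<theta>.\<close>

lemma poisson_equation:
  fixes P :: "real^'n^'n" and p y :: "real^'n"
  assumes st: "stochastic P" and p: "invariant_prob P p"
    and Q: "\<And>k l. \<theta> \<le> mat_pow P m $ k $ l" "0 < \<theta>" and y: "p \<bullet> y = 0"
  shows "\<exists>x. x - P *v x = y \<and> p \<bullet> x = 0 \<and> vec_sup_norm (cvec x) \<le> real m / \<theta> * vec_sup_norm (cvec y)"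
proof -
  have p': "\<And>k. 0 \<le> p $ k" "(\<Sum>k\<in>UNIV. p $ k) = 1" and pP: "p v* P = p"
    using p by (auto simp: invariant_prob_def)
  have pPx: "p \<bullet> (P *v x) = p \<bullet> x" for x by (metis dot_lmul_matrix pP)
  have p1: "p \<bullet> 1 = 1" using p'(2) by (simp add: inner_vec_def)
  have contr: "vec_sup_norm (cvec (mat_pow P m *v x)) \<le> (1 - \<theta>) * vec_sup_norm (cvec x)" if "p \<bullet> x = 0" for x
    unfolding cvec_mat_pow
  proof (rule doeblin_contraction[OF stochastic_mat_pow[OF st] p' Q(1)])
    have "(\<Sum>k\<in>UNIV. complex_of_real (p $ k) * cvec x $ k) = complex_of_real (p \<bullet> x)" by (simp add: inner_vec_def)
    then show "(\<Sum>k\<in>UNIV. complex_of_real (p $ k) * cvec x $ k) = 0" using that by simp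
  qed (use Q in auto)
  \<comment> \<open>The rank-one term removes the kernel of x - P x, which consists of the
    constants, and leaves the operator unchanged on centered vectors.\<close>
  define L where "L x = x - P *v x + (p \<bullet> x) *\<^sub>R 1" for x
  have lin: "linear L"
    unfolding L_def
    by (intro linear_compose_add linear_compose_sub matrix_vector_mul_linear linear_ident)
       (auto intro!: linearI simp: inner_add_right scaleR_add_left)
  have pL: "p \<bullet> L x = p \<bullet> x" for x by (simp add: L_def inner_add_right inner_diff_right pPx p1)
  have "inj L"
    unfolding linear_injective_0[OF lin]
  proof (intro allI impI)
    fix x assume "L x = 0"
    with pL[of x] have px: "p \<bullet> x = 0" by simp
    with \<open>L x = 0\<close> have Px: "P *v x = x" by (simp add: L_def)
    have "mat_pow P j *v x = x" for j
      by (induction j) (simp_all add: mat_pow_Suc Px flip: matrix_vector_mul_assoc)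
    with contr[OF px] have "\<theta> * vec_sup_norm (cvec x) \<le> 0" by (simp add: left_diff_distrib)
    then have "vec_sup_norm (cvec x) \<le> 0" using Q(2) by (simp add: mult_le_0_iff)
    then show "x = 0" by (simp add: vec_sup_norm_cvec_le_iff vec_eq_iff)
  qed
  then have "surj L" using lin linear_injective_imp_surjective by blast
  then obtain x where x: "L x = y" by (metis surjD)
  have px: "p \<bullet> x = 0" using pL[of x] x y by simp
  have "x - P *v x = y" using x px by (simp add: L_def)
  then have xe: "x = y + P *v x" by (simp only: diff_eq_eq)
  have "vec_sup_norm (cvec (x - mat_pow P j *v x)) \<le> real j * vec_sup_norm (cvec y)" for j
  proof (induction j)
    case 0
    then show ?case by (simp add: vec_sup_norm_cvec_le_iff vec_sup_norm_nonneg)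
  next
    case (Suc j)
    have "x - mat_pow P (Suc j) *v x = y + P *v (x - mat_pow P j *v x)"
      using xe by (simp add: mat_pow_Suc matrix_vector_mult_diff_distrib flip: matrix_vector_mul_assoc)
    then have "cvec (x - mat_pow P (Suc j) *v x) = cvec y + cmat P *v cvec (x - mat_pow P j *v x)"
      by (simp add: cmat_mult_cvec vec_eq_iff)
    then have "vec_sup_norm (cvec (x - mat_pow P (Suc j) *v x)) \<le> vec_sup_norm (cvec y) + vec_sup_norm (cvec (x - mat_pow P j *v x))"
      by (simp only:) (rule order_trans[OF vec_sup_norm_add add_left_mono[OF stochastic_vec_sup_norm[OF st]]])
    with Suc show ?case by (simp add: algebra_simps)
  qed
  note le = this[of m]
  have "cvec x = cvec (x - mat_pow P m *v x) + cvec (mat_pow P m *v x)" by (simp add: vec_eq_iff)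
  then have "vec_sup_norm (cvec x) \<le> vec_sup_norm (cvec (x - mat_pow P m *v x)) + vec_sup_norm (cvec (mat_pow P m *v x))"
    by (simp only:) (rule vec_sup_norm_add)
  then have "vec_sup_norm (cvec x) \<le> real m * vec_sup_norm (cvec y) + (1 - \<theta>) * vec_sup_norm (cvec x)"
    using le contr[OF px] by linarith
  then have "vec_sup_norm (cvec x) \<le> real m / \<theta> * vec_sup_norm (cvec y)"
    using Q(2) by (simp add: field_simps)
  moreover have "x - P *v x = y" using x px by (simp add: L_def)
  ultimately show ?thesis using px by blast
qed

text \<open>\<open>A t\<close> stands for the Fourier matrix at time one and frequency t \<xi> with
  a fixed unit vector \<xi>, \<open>B1\<close> and \<open>B2\<close> for the matrices of first and
  second moments in that direction, and \<open>center\<close> for the centering of the process. The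
  constants defined below involve only \<open>m\<close>, \<open>\<theta>\<close>, \<open>K\<close>
  and a lower bound for the quadratic decay, so they are common to all directions and all matrices
  of the family.\<close>

locale perturbed_chain =
  fixes P :: "real^'n^'n" and p :: "real^'n" and m :: nat and \<theta> K :: real
    and B1 B2 :: "real^'n^'n" and A :: "real \<Rightarrow> complex^'n^'n"
  assumes st: "stochastic P" and inv: "invariant_prob P p"
    and minor: "\<And>k l. \<theta> \<le> mat_pow P m $ k $ l" and \<theta>: "0 < \<theta>" "\<theta> < 1" and m: "1 \<le> m" and K: "1 \<le> K"
    and B1: "\<And>k. (\<Sum>l\<in>UNIV. \<bar>B1 $ k $ l\<bar>) \<le> K" and B2: "\<And>k. (\<Sum>l\<in>UNIV. \<bar>B2 $ k $ l\<bar>) \<le> K"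
    and A: "\<And>t k. 0 \<le> t \<Longrightarrow> t \<le> 1 \<Longrightarrow> (\<Sum>l\<in>UNIV. cmod (A t $ k $ l)) \<le> 1"
    and R: "\<And>t k. 0 \<le> t \<Longrightarrow> t \<le> 1 \<Longrightarrow> (\<Sum>l\<in>UNIV. cmod (A t $ k $ l - (complex_of_real (P $ k $ l)
          + \<i> * t * B1 $ k $ l - t\<^sup>2 / 2 * B2 $ k $ l))) \<le> K * t ^ 3"
    and center: "p \<bullet> (B1 *v 1) = 0"
begin

text \<open>\<open>U\<close>, \<open>W\<close>, \<open>H\<close> and \<open>V\<close> bound u, w, h
  and the vector v. The summands of \<open>C0\<close> bound, in this order, the Taylor remainder
  applied to v, the third-order terms in \<open>B1\<close> w and \<open>B2\<close> u, the
  fourth-order term in \<open>B2\<close> w, and t^2 h (v - 1).\<close>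

definition "U = real m / \<theta> * K"
definition "H = K * U + K"
definition "W = real m / \<theta> * (2 * H)"
definition "V = 1 + U + W"
definition "C0 = K * V + K * W + K * U + K * W + H * V"

lemma const_nonneg: "0 \<le> U" "0 \<le> H" "0 \<le> W" "1 \<le> V" "0 \<le> C0"
proof -
  show U: "0 \<le> U" using \<theta> K by (simp add: U_def)
  then show H: "0 \<le> H" using K by (simp add: H_def)
  then show W: "0 \<le> W" using \<theta> by (simp add: W_def)
  then show V: "1 \<le> V" using U by (simp add: V_def)
  show "0 \<le> C0" using U H W V K by (simp add: C0_def)
qed

lemma p: "\<And>k. 0 \<le> p $ k" "(\<Sum>k\<in>UNIV. p $ k) = 1" "p v* P = p"
  using inv by (auto simp: invariant_prob_def)

lemma p_inner_le: "\<bar>p \<bullet> x\<bar> \<le> vec_sup_norm (cvec x)"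
proof -
  have "\<bar>p \<bullet> x\<bar> \<le> (\<Sum>k\<in>UNIV. \<bar>p $ k * x $ k\<bar>)" unfolding inner_vec_def inner_real_def by (rule sum_abs)
  also have "\<dots> \<le> (\<Sum>k\<in>UNIV. p $ k * vec_sup_norm (cvec x))"
    using p(1) vec_sup_norm_ge[of "cvec x"] by (intro sum_mono) (auto simp: abs_mult intro!: mult_left_mono)
  also have "\<dots> = vec_sup_norm (cvec x)" using p by (simp flip: sum_distrib_right)
  finally show ?thesis .
qed

lemma B_bound:
  "vec_sup_norm (cvec (B1 *v x)) \<le> K * vec_sup_norm (cvec x)"
  "vec_sup_norm (cvec (B2 *v x)) \<le> K * vec_sup_norm (cvec x)"
  using vec_sup_norm_mult_vec[of "cmat B1" K "cvec x"] vec_sup_norm_mult_vec[of "cmat B2" K "cvec x"] B1 B2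
  by (auto simp: cmat_mult_cvec)

lemma cvec_1 [simp]: "cvec 1 = 1" by (simp add: vec_eq_iff)

text \<open>These are the equations that make the coefficients of t and t^2 agree in A v = (1 - t^2
  h) v for v = 1 + i t u + t^2 w. The sign in front of \<open>B1 *v u\<close> comes from i * i. The
  conditions that \<open>p\<close> annihilates u and w fix the additive constants.\<close>

definition corrector :: "real^'n \<Rightarrow> real^'n \<Rightarrow> real \<Rightarrow> bool" where
  "corrector u w h \<longleftrightarrow> u - P *v u = B1 *v 1 \<and> p \<bullet> u = 0 \<and> vec_sup_norm (cvec u) \<le> U \<and>
     w - P *v w = h *\<^sub>R 1 - (B1 *v u + (1/2) *\<^sub>R (B2 *v 1)) \<and> p \<bullet> w = 0 \<and> vec_sup_norm (cvec w) \<le> W \<and> \<bar>h\<bar> \<le> H"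

lemma corrector_exists: "\<exists>u w h. corrector u w h"
proof -
  obtain u where u: "u - P *v u = B1 *v 1" "p \<bullet> u = 0" and uU: "vec_sup_norm (cvec u) \<le> real m / \<theta> * vec_sup_norm (cvec (B1 *v 1))"
    using poisson_equation[OF st inv minor \<theta>(1) center] by blast
  have "real m / \<theta> * vec_sup_norm (cvec (B1 *v 1)) \<le> U"
    unfolding U_def using B_bound(1)[of 1] \<theta> by (intro mult_left_mono) auto
  with uU have uU: "vec_sup_norm (cvec u) \<le> U" by simp
  define b where "b = B1 *v u + (1/2) *\<^sub>R (B2 *v 1)"
  \<comment> \<open>The second Poisson equation is solvable only for a centered right side, which
    determines \<open>h\<close>.\<close>
  define h where "h = p \<bullet> b"
  have "cvec b = cvec (B1 *v u) + complex_of_real (1/2) *s cvec (B2 *v 1)"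
    by (simp add: b_def vec_eq_iff)
  then have "vec_sup_norm (cvec b) \<le> vec_sup_norm (cvec (B1 *v u)) + cmod (complex_of_real (1/2)) * vec_sup_norm (cvec (B2 *v 1))"
    using vec_sup_norm_add vec_sup_norm_scale by (metis add_left_mono order_trans)
  also have "\<dots> \<le> K * vec_sup_norm (cvec u) + 1/2 * (K * vec_sup_norm (cvec (1::real^'n)))"
    using B_bound(1)[of u] B_bound(2)[of 1] by simp
  also have "\<dots> \<le> H"
  proof -
    have "K * vec_sup_norm (cvec u) \<le> K * U" by (intro mult_left_mono uU) (use K in simp)
    then have "K * vec_sup_norm (cvec u) + K / 2 \<le> K * U + K" using K by linarith
    then show ?thesis by (simp add: H_def)
  qed
  finally have bH: "vec_sup_norm (cvec b) \<le> H" .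
  have hH: "\<bar>h\<bar> \<le> H" using p_inner_le[of b] bH by (simp add: h_def)
  have p1: "p \<bullet> 1 = 1" using p(2) by (simp add: inner_vec_def)
  have "p \<bullet> (h *\<^sub>R 1 - b) = 0" by (simp add: inner_diff_right p1 h_def)
  from poisson_equation[OF st inv minor \<theta>(1) this]
  obtain w where w: "w - P *v w = h *\<^sub>R 1 - b" "p \<bullet> w = 0" and wW: "vec_sup_norm (cvec w) \<le> real m / \<theta> * vec_sup_norm (cvec (h *\<^sub>R 1 - b))"
    by blast
  have "vec_sup_norm (cvec (h *\<^sub>R 1 - b)) \<le> 2 * H"
    unfolding vec_sup_norm_cvec_le_iff
  proof
    fix k show "\<bar>(h *\<^sub>R 1 - b) $ k\<bar> \<le> 2 * H"
      using hH bH vec_sup_norm_ge[of "cvec b" k] by simp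
  qed
  then have "real m / \<theta> * vec_sup_norm (cvec (h *\<^sub>R 1 - b)) \<le> W"
    unfolding W_def using \<theta> by (intro mult_left_mono) auto
  with wW have "vec_sup_norm (cvec w) \<le> W" by simp
  then show ?thesis unfolding corrector_def using u uU w hH b_def by blast
qed

definition approx_vec :: "real^'n \<Rightarrow> real^'n \<Rightarrow> real \<Rightarrow> complex^'n" where
  "approx_vec u w t = (\<chi> k. 1 + \<i> * t * u $ k + t\<^sup>2 * w $ k)"

context
  fixes u w h assumes cor: "corrector u w h"
begin

lemma uw: "\<bar>u $ k\<bar> \<le> U" "\<bar>w $ k\<bar> \<le> W" "\<bar>h\<bar> \<le> H"
  using cor by (auto simp: corrector_def vec_sup_norm_cvec_le_iff)

lemma approx_vec_diff_1:
  assumes "0 \<le> t" "t \<le> 1"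
  shows "vec_sup_norm (approx_vec u w t - 1) \<le> (U + W) * t"
  unfolding vec_sup_norm_le_iff
proof
  fix k
  have "t\<^sup>2 * \<bar>w $ k\<bar> \<le> t * W"
    using assms uw(2)[of k] by (intro mult_mono) (auto simp: power2_eq_square mult_left_le_one_le)
  moreover have "t * \<bar>u $ k\<bar> \<le> t * U" using assms uw(1)[of k] by (intro mult_left_mono)
  moreover have "cmod ((approx_vec u w t - 1) $ k) \<le> cmod (\<i> * t * u $ k) + cmod (complex_of_real (t\<^sup>2 * w $ k))"
    by (simp add: approx_vec_def norm_triangle_ineq del: norm_mult)
  ultimately show "cmod ((approx_vec u w t - 1) $ k) \<le> (U + W) * t"
    using assms by (simp add: norm_mult norm_power abs_mult algebra_simps)
qed

lemma approx_vec_bound: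
  assumes "0 \<le> t" "t \<le> 1"
  shows "vec_sup_norm (approx_vec u w t) \<le> V"
proof -
  have "vec_sup_norm (approx_vec u w t) \<le> vec_sup_norm (1 :: complex^'n) + vec_sup_norm (approx_vec u w t - 1)"
    using vec_sup_norm_add[of "1 :: complex^'n" "approx_vec u w t - 1"] by simp
  also have "\<dots> \<le> 1 + (U + W) * t" using approx_vec_diff_1[OF assms] by simp
  also have "\<dots> \<le> V" using assms const_nonneg by (simp add: V_def mult_left_le)
  finally show ?thesis .
qed

text \<open>The corrector equations cancel the orders zero, one and two. What remains is the Taylor
  remainder and terms of order three and four, all at most a multiple of t^3 because t <= 1.\<close>

lemma approx_eigenvector:
  assumes t: "0 \<le> t" "t \<le> 1"
  shows "vec_sup_norm (A t *v approx_vec u w t - complex_of_real (1 - t\<^sup>2 * h) *s approx_vec u w t) \<le> C0 * t ^ 3"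
  unfolding vec_sup_norm_le_iff
proof
  fix k
  let ?v = "approx_vec u w t"
  define r where "r l = A t $ k $ l - (complex_of_real (P $ k $ l) + \<i> * t * B1 $ k $ l - t\<^sup>2 / 2 * B2 $ k $ l)" for l
  define \<rho> where "\<rho> = (\<Sum>l\<in>UNIV. r l * ?v $ l)"
  let ?o = complex_of_real
  have P1: "(\<Sum>l\<in>UNIV. P $ k $ l) = 1" using st by (simp add: stochastic_def)
  have nthv: "(M *v x) $ k = (\<Sum>l\<in>UNIV. M $ k $ l * x $ l)" for M :: "real^'n^'n" and x by (simp add: matrix_vector_mult_def)
  have e1: "u $ k - (P *v u) $ k = (B1 *v 1) $ k"
    using cor unfolding corrector_def by (metis vector_minus_component)
  have e2: "w $ k - (P *v w) $ k = h - ((B1 *v u) $ k + (B2 *v 1) $ k / 2)"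
    using cor unfolding corrector_def by (auto simp: vec_eq_iff)
  have "(A t *v ?v) $ k = (\<Sum>l\<in>UNIV. (?o (P $ k $ l) + \<i> * t * B1 $ k $ l - t\<^sup>2 / 2 * B2 $ k $ l) * ?v $ l + r l * ?v $ l)"
    unfolding matrix_vector_mult_def vec_lambda_beta r_def by (intro sum.cong refl) (simp add: algebra_simps)
  also have "\<dots> = (\<Sum>l\<in>UNIV. (?o (P $ k $ l) + \<i> * t * B1 $ k $ l - t\<^sup>2 / 2 * B2 $ k $ l) * ?v $ l) + \<rho>"
    by (simp add: sum.distrib \<rho>_def)
  also have "(\<Sum>l\<in>UNIV. (?o (P $ k $ l) + \<i> * t * B1 $ k $ l - t\<^sup>2 / 2 * B2 $ k $ l) * ?v $ l)
     = (?o 1 + \<i> * t * ?o ((P *v u) $ k) + t\<^sup>2 * ?o ((P *v w) $ k))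
       + \<i> * t * (?o ((B1 *v 1) $ k) + \<i> * t * ?o ((B1 *v u) $ k) + t\<^sup>2 * ?o ((B1 *v w) $ k))
       - t\<^sup>2 / 2 * (?o ((B2 *v 1) $ k) + \<i> * t * ?o ((B2 *v u) $ k) + t\<^sup>2 * ?o ((B2 *v w) $ k))"
    unfolding nthv P1[symmetric] of_real_sum sum_distrib_left sum.distrib[symmetric] sum_subtractf[symmetric]
    by (intro sum.cong refl) (simp add: approx_vec_def algebra_simps)
  finally have Av: "(A t *v ?v) $ k = \<dots> + \<rho>" .
  have uk: "u $ k = (P *v u) $ k + (B1 *v 1) $ k" using e1 by simp
  have wk: "w $ k = (P *v w) $ k + h - (B1 *v u) $ k - (B2 *v 1) $ k / 2" using e2 by simp
  have "(A t *v ?v - ?o (1 - t\<^sup>2 * h) *s ?v) $ k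
     = \<rho> + \<i> * t ^ 3 * ?o ((B1 *v w) $ k) - \<i> / 2 * t ^ 3 * ?o ((B2 *v u) $ k) - t ^ 4 / 2 * ?o ((B2 *v w) $ k)
       + t\<^sup>2 * h * (\<i> * t * u $ k + t\<^sup>2 * w $ k)"
  proof -
    \<comment> \<open>With the entries named as complex numbers, the claim is a polynomial identity
      in \<open>T\<close> after u and w are eliminated by the corrector equations.\<close>
    define a1 where "a1 = ?o ((P *v u) $ k)"
    define a2 where "a2 = ?o ((P *v w) $ k)"
    define b1 where "b1 = ?o ((B1 *v 1) $ k)"
    define b2 where "b2 = ?o ((B1 *v u) $ k)"
    define b3 where "b3 = ?o ((B1 *v w) $ k)"
    define c1 where "c1 = ?o ((B2 *v 1) $ k)"
    define c2 where "c2 = ?o ((B2 *v u) $ k)"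
    define c3 where "c3 = ?o ((B2 *v w) $ k)"
    define T where "T = ?o t"
    define h' where "h' = ?o h"
    have v: "?v $ k = 1 + \<i> * T * (a1 + b1) + T\<^sup>2 * (a2 + h' - b2 - c1 / 2)"
      by (simp add: approx_vec_def uk wk a1_def a2_def b1_def b2_def c1_def T_def h'_def)
    have "(A t *v ?v) $ k = (1 + \<i> * T * a1 + T\<^sup>2 * a2) + \<i> * T * (b1 + \<i> * T * b2 + T\<^sup>2 * b3)
       - T\<^sup>2 / 2 * (c1 + \<i> * T * c2 + T\<^sup>2 * c3) + \<rho>"
      unfolding Av by (simp add: a1_def a2_def b1_def b2_def b3_def c1_def c2_def c3_def T_def)
    moreover have "(A t *v ?v - ?o (1 - t\<^sup>2 * h) *s ?v) $ k = (A t *v ?v) $ k - (1 - T\<^sup>2 * h') * ?v $ k"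
      by (simp add: T_def h'_def algebra_simps)
    ultimately have "(A t *v ?v - ?o (1 - t\<^sup>2 * h) *s ?v) $ k = (1 + \<i> * T * a1 + T\<^sup>2 * a2) + \<i> * T * (b1 + \<i> * T * b2 + T\<^sup>2 * b3)
       - T\<^sup>2 / 2 * (c1 + \<i> * T * c2 + T\<^sup>2 * c3) + \<rho> - (1 - T\<^sup>2 * h') * ?v $ k"
      by (simp only:)
    also have "\<dots> = \<rho> + \<i> * T ^ 3 * b3 - \<i> / 2 * T ^ 3 * c2 - T ^ 4 / 2 * c3
       + T\<^sup>2 * h' * (\<i> * T * (a1 + b1) + T\<^sup>2 * (a2 + h' - b2 - c1 / 2))"
      unfolding v by (simp add: field_simps power2_eq_square power3_eq_cube power4_eq_xxxx)
    finally show ?thesis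
      by (simp add: uk wk a1_def a2_def b1_def b2_def b3_def c1_def c2_def c3_def T_def h'_def)
  qed
  also have "cmod \<dots> \<le> cmod \<rho> + cmod (\<i> * t ^ 3 * ?o ((B1 *v w) $ k)) + cmod (\<i> / 2 * t ^ 3 * ?o ((B2 *v u) $ k))
      + cmod (t ^ 4 / 2 * ?o ((B2 *v w) $ k)) + cmod (t\<^sup>2 * h * (\<i> * t * u $ k + t\<^sup>2 * w $ k))"
    by (intro order_trans[OF norm_triangle_ineq] order_trans[OF norm_triangle_ineq4] add_mono order_refl)
  also have "\<dots> \<le> K * V * t ^ 3 + K * W * t ^ 3 + K * U * t ^ 3 + K * W * t ^ 3 + H * V * t ^ 3"
  proof (intro add_mono)
    have "cmod \<rho> \<le> (\<Sum>l\<in>UNIV. cmod (r l) * V)" unfolding \<rho>_def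
      by (rule order_trans[OF norm_sum], intro sum_mono)
         (auto simp: norm_mult intro!: mult_left_mono order_trans[OF vec_sup_norm_ge approx_vec_bound[OF t]])
    also have "\<dots> \<le> (K * t ^ 3) * V" unfolding sum_distrib_right[symmetric] r_def
      using const_nonneg by (intro mult_right_mono R t) auto
    finally show "cmod \<rho> \<le> K * V * t ^ 3" by (simp add: mult_ac)
    have b: "\<bar>(B1 *v w) $ k\<bar> \<le> K * W" "\<bar>(B2 *v u) $ k\<bar> \<le> K * U" "\<bar>(B2 *v w) $ k\<bar> \<le> K * W"
    proof -
      have "K * vec_sup_norm (cvec w) \<le> K * W" "K * vec_sup_norm (cvec u) \<le> K * U"
        using cor K by (auto simp: corrector_def)
      then show "\<bar>(B1 *v w) $ k\<bar> \<le> K * W" "\<bar>(B2 *v u) $ k\<bar> \<le> K * U" "\<bar>(B2 *v w) $ k\<bar> \<le> K * W"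
        using B_bound(1)[of w] B_bound(2)[of u] B_bound(2)[of w] vec_sup_norm_ge[of "cvec (B1 *v w)" k]
          vec_sup_norm_ge[of "cvec (B2 *v u)" k] vec_sup_norm_ge[of "cvec (B2 *v w)" k] by auto
    qed
    show "cmod (\<i> * t ^ 3 * ?o ((B1 *v w) $ k)) \<le> K * W * t ^ 3"
      using mult_right_mono[OF b(1), of "t ^ 3"] t by (simp add: norm_mult norm_power abs_mult mult_ac)
    have "cmod (\<i> / 2 * t ^ 3 * ?o ((B2 *v u) $ k)) = t ^ 3 * \<bar>(B2 *v u) $ k\<bar> / 2"
      using t by (simp add: norm_mult norm_power norm_divide)
    also have "\<dots> \<le> t ^ 3 * \<bar>(B2 *v u) $ k\<bar>" using t by simp
    also have "\<dots> \<le> K * U * t ^ 3" using mult_left_mono[OF b(2), of "t ^ 3"] t by (simp add: mult_ac)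
    finally show "cmod (\<i> / 2 * t ^ 3 * ?o ((B2 *v u) $ k)) \<le> K * U * t ^ 3" .
    have "cmod (t ^ 4 / 2 * ?o ((B2 *v w) $ k)) = t ^ 4 * \<bar>(B2 *v w) $ k\<bar> / 2"
      using t by (simp add: norm_mult norm_power norm_divide)
    also have "\<dots> \<le> t ^ 4 * \<bar>(B2 *v w) $ k\<bar>" using t by simp
    also have "\<dots> \<le> t ^ 3 * (K * W)" using t b(3) power_decreasing[of 3 4 t] by (intro mult_mono) auto
    finally show "cmod (t ^ 4 / 2 * ?o ((B2 *v w) $ k)) \<le> K * W * t ^ 3" by (simp add: mult_ac)
    have "cmod (\<i> * t * u $ k + t\<^sup>2 * w $ k) \<le> (U + W) * t"
      using order_trans[OF vec_sup_norm_ge approx_vec_diff_1[OF t], of k] by (simp add: approx_vec_def)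
    then have "cmod (t\<^sup>2 * h * (\<i> * t * u $ k + t\<^sup>2 * w $ k)) \<le> t\<^sup>2 * H * ((U + W) * t)"
      using uw(3) const_nonneg t
      by (subst norm_mult, intro mult_mono) (auto simp: norm_mult norm_power intro: mult_left_mono)
    also have "\<dots> = H * (U + W) * t ^ 3" by (simp add: power2_eq_square power3_eq_cube mult_ac)
    also have "\<dots> \<le> H * V * t ^ 3" using const_nonneg t by (intro mult_mono) (auto simp: V_def)
    finally show "cmod (t\<^sup>2 * h * (\<i> * t * u $ k + t\<^sup>2 * w $ k)) \<le> H * V * t ^ 3" .
  qed
  also have "\<dots> = C0 * t ^ 3" by (simp add: C0_def algebra_simps)
  finally show "cmod ((A t *v ?v - ?o (1 - t\<^sup>2 * h) *s ?v) $ k) \<le> C0 * t ^ 3" .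
qed

end

end

section \<open>Powers of the perturbed matrix\<close>

context perturbed_chain begin

definition "pf x = (\<Sum>k\<in>UNIV. complex_of_real (p $ k) * x $ k)"

lemma pf_add: "pf (x + y) = pf x + pf y"
  and pf_diff: "pf (x - y) = pf x - pf y"
  and pf_scale: "pf (c *s x) = c * pf x"
  by (simp_all add: pf_def sum.distrib sum_subtractf algebra_simps sum_distrib_left)

lemma pf_le: "cmod (pf x) \<le> vec_sup_norm x"
proof -
  have "cmod (pf x) \<le> (\<Sum>k\<in>UNIV. p $ k * vec_sup_norm x)"
    unfolding pf_def by (rule order_trans[OF norm_sum], intro sum_mono)
      (auto simp: norm_mult p(1) intro!: mult_left_mono vec_sup_norm_ge)
  also have "\<dots> = vec_sup_norm x" using p by (simp flip: sum_distrib_right)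
  finally show ?thesis .
qed

lemma pf_cmat: "pf (cmat P *v x) = pf x"
proof -
  have "pf (cmat P *v x) = (\<Sum>l\<in>UNIV. (\<Sum>k\<in>UNIV. complex_of_real (p $ k) * complex_of_real (P $ k $ l)) * x $ l)"
    unfolding pf_def matrix_vector_mult_def
    by (simp add: sum_distrib_left sum_distrib_right mult.assoc) (rule sum.swap)
  also have "\<dots> = (\<Sum>l\<in>UNIV. complex_of_real ((p v* P) $ l) * x $ l)"
    by (simp add: vector_matrix_mult_def mult.commute)
  finally show ?thesis by (simp add: p(3) pf_def)
qed

lemma pf_cmat_pow: "pf (cmat (mat_pow P j) *v x) = pf x"
  by (simp only: cmat_mat_pow[symmetric]) (induction j, simp_all add: pf_cmat)

definition "Apow t n = ((*v) (A t)) ^^ n"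

lemma Apow_0 [simp]: "Apow t 0 x = x" and Apow_Suc: "Apow t (Suc n) x = A t *v Apow t n x"
  by (simp_all add: Apow_def)

lemma Apow_add: "Apow t (i + j) x = Apow t i (Apow t j x)"
  by (simp add: Apow_def funpow_add)

lemma Apow_Suc2: "Apow t (Suc n) x = Apow t n (A t *v x)"
  by (simp add: Apow_def funpow_swap1)

lemma Apow_plus: "Apow t n (x + y) = Apow t n x + Apow t n y"
  by (induction n) (simp_all add: Apow_Suc matrix_vector_right_distrib)

lemma Apow_minus: "Apow t n (x - y) = Apow t n x - Apow t n y"
  by (induction n) (simp_all add: Apow_Suc matrix_vector_mult_diff_distrib)

lemma Apow_scale: "Apow t n (c *s x) = c *s Apow t n x"
  by (induction n) (simp_all add: Apow_Suc vector_scalar_commute)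

lemma A_contr: "0 \<le> t \<Longrightarrow> t \<le> 1 \<Longrightarrow> vec_sup_norm (A t *v x) \<le> vec_sup_norm x"
  using vec_sup_norm_mult_vec[OF A, of t x] by simp

lemma Apow_contr: "0 \<le> t \<Longrightarrow> t \<le> 1 \<Longrightarrow> vec_sup_norm (Apow t n x) \<le> vec_sup_norm x"
  by (induction n) (auto simp: Apow_Suc intro: order_trans[OF A_contr])

text \<open>For t <= 1 the first-order term, the second-order term and the remainder are each at
  most K t.\<close>

lemma A_minus_P:
  assumes "0 \<le> t" "t \<le> 1"
  shows "vec_sup_norm (A t *v x - cmat P *v x) \<le> 3 * K * t * vec_sup_norm x"
proof -
  have "(\<Sum>l\<in>UNIV. cmod ((A t - cmat P) $ k $ l)) \<le> 3 * K * t" for k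
  proof -
    have "cmod ((A t - cmat P) $ k $ l) \<le> cmod (A t $ k $ l - (complex_of_real (P $ k $ l)
          + \<i> * t * B1 $ k $ l - t\<^sup>2 / 2 * B2 $ k $ l)) + t * \<bar>B1 $ k $ l\<bar> + t * \<bar>B2 $ k $ l\<bar>" for l
    proof -
      have "(A t - cmat P) $ k $ l = (A t $ k $ l - (complex_of_real (P $ k $ l)
          + \<i> * t * B1 $ k $ l - t\<^sup>2 / 2 * B2 $ k $ l)) + \<i> * t * B1 $ k $ l - t\<^sup>2 / 2 * B2 $ k $ l"
        by simp
      also have "cmod \<dots> \<le> cmod (A t $ k $ l - (complex_of_real (P $ k $ l)
          + \<i> * t * B1 $ k $ l - t\<^sup>2 / 2 * B2 $ k $ l)) + cmod (\<i> * t * B1 $ k $ l) + cmod (t\<^sup>2 / 2 * B2 $ k $ l)"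
        by (intro order_trans[OF norm_triangle_ineq4] order_trans[OF norm_triangle_ineq] add_mono order_refl)
      also have "cmod (\<i> * t * B1 $ k $ l) = t * \<bar>B1 $ k $ l\<bar>" using assms by (simp add: norm_mult)
      also have "cmod (complex_of_real (t\<^sup>2 / 2 * B2 $ k $ l)) \<le> t * \<bar>B2 $ k $ l\<bar>"
      proof -
        have "t\<^sup>2 / 2 \<le> t" using assms by (simp add: power2_eq_square mult_le_one)
             (smt (verit) mult_left_le)
        then show ?thesis unfolding norm_of_real abs_mult using assms by (intro mult_mono) auto
      qed
      finally show ?thesis by simp
    qed
    then have "(\<Sum>l\<in>UNIV. cmod ((A t - cmat P) $ k $ l)) \<le> (\<Sum>l\<in>UNIV. cmod (A t $ k $ l - (complex_of_real (P $ k $ l)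
          + \<i> * t * B1 $ k $ l - t\<^sup>2 / 2 * B2 $ k $ l)) + t * \<bar>B1 $ k $ l\<bar> + t * \<bar>B2 $ k $ l\<bar>)"
      by (rule sum_mono)
    also have "\<dots> = (\<Sum>l\<in>UNIV. cmod (A t $ k $ l - (complex_of_real (P $ k $ l)
          + \<i> * t * B1 $ k $ l - t\<^sup>2 / 2 * B2 $ k $ l))) + t * (\<Sum>l\<in>UNIV. \<bar>B1 $ k $ l\<bar>) + t * (\<Sum>l\<in>UNIV. \<bar>B2 $ k $ l\<bar>)"
      by (simp add: sum.distrib sum_distrib_left)
    also have "\<dots> \<le> K * t ^ 3 + t * K + t * K"
      using assms by (intro add_mono R mult_left_mono B1 B2) auto
    also have "K * t ^ 3 \<le> K * t"
      using assms K power_decreasing[of 1 3 t] by (intro mult_left_mono) auto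
    finally show ?thesis by (simp add: algebra_simps)
  qed
  from vec_sup_norm_mult_vec[OF this, of x] show ?thesis
    by (simp add: matrix_vector_mult_diff_rdistrib)
qed

text \<open>One factor is replaced at a time: the perturbed and the stochastic matrix are both
  contractions for the sup norm, so each of the \<open>n\<close> replacements costs 3 K t.\<close>

lemma Apow_minus_Ppow:
  assumes "0 \<le> t" "t \<le> 1"
  shows "vec_sup_norm (Apow t n x - cmat (mat_pow P n) *v x) \<le> real n * (3 * K * t) * vec_sup_norm x"
proof (induction n)
  case 0
  show ?case using cmat_mat_pow[where m=0 and P=P and x=x] by (simp add: vec_sup_norm_0)
next
  case (Suc n)
  let ?y = "cmat (mat_pow P n) *v x"
  have "cmat (mat_pow P (Suc n)) *v x = cmat P *v ?y"
    by (simp add: mat_pow_Suc cmat_mult matrix_vector_mul_assoc)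
  then have "Apow t (Suc n) x - cmat (mat_pow P (Suc n)) *v x = A t *v (Apow t n x - ?y) + (A t *v ?y - cmat P *v ?y)"
    by (simp add: Apow_Suc matrix_vector_mult_diff_distrib)
  also have "vec_sup_norm \<dots> \<le> vec_sup_norm (Apow t n x - ?y) + 3 * K * t * vec_sup_norm ?y"
    by (rule order_trans[OF vec_sup_norm_add], intro add_mono A_contr A_minus_P assms)
  also have "3 * K * t * vec_sup_norm ?y \<le> 3 * K * t * vec_sup_norm x"
    using assms K by (intro mult_left_mono stochastic_vec_sup_norm stochastic_mat_pow st) auto
  finally show ?case using Suc by (simp add: algebra_simps)
qed

text \<open>\<open>G\<close> bounds the perturbation during one block of \<open>m\<close> steps. For
  t <= \<delta> a the product G t is at most a/2 and \<theta>/2: the first keeps cubic errors below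
  half of the decay a t^2 along the approximate eigenvector, the second preserves the contraction of
  the complement. In \<open>Ca\<close>, V (2 + V) compares the adapted norm with the sup norm and
  exp 1 pays for an incomplete block; \<open>C1\<close> adds the four errors of the final
  expansion.\<close>

definition "G = real m * (C0 + 3 * K) * (2 + V) + H + 1"
definition "Ca = V * (2 + V) * exp 1"
definition "C1 = Ca * (U + W) + Ca * C0 * exp 1 + (U + W) + H\<^sup>2 * exp 1"
definition "\<delta> a = min 1 (min (a / (2 * G)) (\<theta> / (2 * G)))"

lemma G_pos: "1 \<le> G" "H \<le> G" "real m * (C0 + 3 * K) * (2 + V) \<le> G"
  using const_nonneg K by (auto simp: G_def)

context
  fixes u w h assumes cor: "corrector u w h"
begin

text \<open>Since \<open>p\<close> annihilates both correctors, x -> pf(x) v is a projection onto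
  the line of v, and x - pf(x) v is centered.\<close>

lemma pf_approx_vec: "pf (approx_vec u w t) = 1"
proof -
  have "pf (approx_vec u w t) = (\<Sum>k\<in>UNIV. complex_of_real (p $ k) + \<i> * t * (p $ k * u $ k) + t\<^sup>2 * (p $ k * w $ k))"
    by (simp add: pf_def approx_vec_def algebra_simps)
  also have "\<dots> = complex_of_real (\<Sum>k\<in>UNIV. p $ k) + \<i> * t * complex_of_real (p \<bullet> u) + t\<^sup>2 * complex_of_real (p \<bullet> w)"
    by (simp add: sum.distrib sum_distrib_left inner_vec_def mult.assoc)
  also have "\<dots> = 1" using cor p(2) by (simp add: corrector_def)
  finally show ?thesis .
qed

text \<open>The step errors C0 t^3 are added up without any decay, which suffices in two situations:
  for t = 1 / sqrt n, before the sign of \<open>h\<close> is known, and over a single block with b =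
  1.\<close>

lemma Apow_approx_vec_crude:
  assumes t: "0 \<le> t" "t \<le> 1" and b: "\<bar>1 - t\<^sup>2 * h\<bar> \<le> b" "1 \<le> b"
  shows "vec_sup_norm (Apow t n (approx_vec u w t) - (complex_of_real (1 - t\<^sup>2 * h)) ^ n *s approx_vec u w t)
     \<le> real n * (C0 * t ^ 3) * b ^ n"
proof (induction n)
  case 0
  show ?case by (simp add: vec_sup_norm_0)
next
  case (Suc n)
  let ?v = "approx_vec u w t" and ?\<mu> = "complex_of_real (1 - t\<^sup>2 * h)"
  have "Apow t (Suc n) ?v - ?\<mu> ^ Suc n *s ?v
      = Apow t n (A t *v ?v - ?\<mu> *s ?v) + ?\<mu> *s (Apow t n ?v - ?\<mu> ^ n *s ?v)"
    by (simp add: Apow_Suc2 Apow_minus Apow_scale vec_eq_iff algebra_simps del: of_real_diff)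
  also have "vec_sup_norm \<dots> \<le> C0 * t ^ 3 + b * (real n * (C0 * t ^ 3) * b ^ n)"
    apply (rule order_trans[OF vec_sup_norm_add], intro add_mono)
     apply (rule order_trans[OF Apow_contr[OF t] approx_eigenvector[OF cor t]])
    apply (rule order_trans[OF vec_sup_norm_scale], intro mult_mono Suc)
    using b vec_sup_norm_nonneg by (auto simp del: of_real_diff)
  also have "\<dots> \<le> real (Suc n) * (C0 * t ^ 3) * b ^ Suc n"
  proof -
    have "C0 * t ^ 3 * 1 \<le> C0 * t ^ 3 * b ^ Suc n"
      by (intro mult_left_mono one_le_power b(2) mult_nonneg_nonneg) (use const_nonneg t in auto)
    then show ?thesis by (simp add: algebra_simps)
  qed
  finally show ?case .
qed

text \<open>At t = 1 / sqrt n one has n t^2 = 1 and n t^3 = t. The constant vector is replaced by v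
  at the start and back at the end, at a cost of order t, the accumulated step errors are of order t
  as well, and (1 - h/n)^n tends to exp(-h).\<close>

lemma Apow_clt:
  "(\<lambda>n. Apow (1 / sqrt (real n)) n 1 $ k) \<longlonglongrightarrow> complex_of_real (exp (- h))"
proof -
  have hH: "\<bar>h\<bar> \<le> H" using cor by (simp add: corrector_def)
  define \<mu> where "\<mu> n = 1 - h / real n" for n
  have "(\<lambda>n. (1 + (- h) / real n) ^ n) \<longlonglongrightarrow> exp (- h)" by (rule tendsto_exp_limit_sequentially)
  then have mu: "(\<lambda>n. complex_of_real (\<mu> n ^ n)) \<longlonglongrightarrow> complex_of_real (exp (- h))"
    unfolding \<mu>_def by (intro tendsto_of_real) simp
  define err where "err n = (U + W) * (1 / sqrt (real n)) + (C0 * exp H + exp H * (U + W)) * (1 / sqrt (real n))" for n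
  have "err \<longlonglongrightarrow> 0" unfolding err_def by real_asymp
  moreover have "\<forall>\<^sub>F n in sequentially. norm (Apow (1 / sqrt (real n)) n 1 $ k - complex_of_real (\<mu> n ^ n)) \<le> err n"
    using eventually_gt_at_top[of 0]
  proof eventually_elim
    case (elim n)
    define t where "t = 1 / sqrt (real n)"
    have t: "0 \<le> t" "t \<le> 1" using elim by (auto simp: t_def)
    have t2: "t\<^sup>2 = 1 / real n" by (simp add: t_def power_divide)
    have nt3: "real n * t ^ 3 = t" using elim by (simp add: power3_eq_cube t_def)
    let ?v = "approx_vec u w t"
    \<comment> \<open>The growth bound per step is chosen so that its n-th power is the constant exp
      H.\<close>
    define b where "b = exp (H / real n)"
    have "\<bar>h / real n\<bar> \<le> H / real n" using hH by (simp add: divide_right_mono)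
    then have mb: "\<bar>1 - t\<^sup>2 * h\<bar> \<le> b" 
    proof -
      have "t\<^sup>2 * h = h / real n" by (simp add: t2)
      moreover have "1 + H / real n \<le> b" unfolding b_def by (rule exp_ge_add_one_self)
      ultimately show ?thesis using \<open>\<bar>h / real n\<bar> \<le> H / real n\<close> by linarith
    qed
    have b1: "1 \<le> b" using const_nonneg by (simp add: b_def)
    have bn: "b ^ n = exp H" using elim by (simp add: b_def flip: exp_of_nat_mult)
    have m1: "complex_of_real (1 - t\<^sup>2 * h) = complex_of_real (\<mu> n)" by (simp add: t2 \<mu>_def)
    have mn: "\<bar>\<mu> n\<bar> ^ n \<le> exp H" using power_mono[OF mb, of n] bn by (simp add: t2 \<mu>_def)
    have "Apow t n 1 - complex_of_real (\<mu> n) ^ n *s 1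
       = - Apow t n (?v - 1) + (Apow t n ?v - complex_of_real (\<mu> n) ^ n *s ?v) + complex_of_real (\<mu> n) ^ n *s (?v - 1)"
      by (simp add: Apow_minus vec_eq_iff algebra_simps)
    then have "vec_sup_norm (Apow t n 1 - complex_of_real (\<mu> n) ^ n *s 1)
       \<le> vec_sup_norm (- Apow t n (?v - 1)) + vec_sup_norm (Apow t n ?v - complex_of_real (\<mu> n) ^ n *s ?v) + vec_sup_norm (complex_of_real (\<mu> n) ^ n *s (?v - 1))"
      by (simp only:) (intro order_trans[OF vec_sup_norm_add] add_mono order_refl)
    also have "\<dots> \<le> (U + W) * t + real n * (C0 * t ^ 3) * b ^ n + exp H * ((U + W) * t)"
    proof (intro add_mono)
      have "vec_sup_norm (- Apow t n (?v - 1)) = vec_sup_norm (Apow t n (?v - 1))"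
        by (simp add: vec_sup_norm_def)
      also have "\<dots> \<le> (U + W) * t"
        by (rule order_trans[OF Apow_contr[OF t] approx_vec_diff_1[OF cor t]])
      finally show "vec_sup_norm (- Apow t n (?v - 1)) \<le> (U + W) * t" .
      show "vec_sup_norm (Apow t n ?v - complex_of_real (\<mu> n) ^ n *s ?v) \<le> real n * (C0 * t ^ 3) * b ^ n"
        using Apow_approx_vec_crude[OF t mb b1, of n] unfolding m1 .
      show "vec_sup_norm (complex_of_real (\<mu> n) ^ n *s (?v - 1)) \<le> exp H * ((U + W) * t)"
        by (rule order_trans[OF vec_sup_norm_scale], intro mult_mono approx_vec_diff_1[OF cor t])
           (auto simp: norm_power mn vec_sup_norm_nonneg)
    qed
    also have "real n * (C0 * t ^ 3) * b ^ n = C0 * exp H * t" using nt3 bn by (simp add: mult_ac)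
    finally have "vec_sup_norm (Apow t n 1 - complex_of_real (\<mu> n) ^ n *s 1) \<le> err n"
      by (simp add: err_def t_def algebra_simps)
    with vec_sup_norm_ge[of "Apow t n 1 - complex_of_real (\<mu> n) ^ n *s 1" k]
    show ?case by (simp add: t_def)
  qed
  ultimately have "(\<lambda>n. Apow (1 / sqrt (real n)) n 1 $ k - complex_of_real (\<mu> n ^ n)) \<longlonglongrightarrow> 0"
    by (rule Lim_null_comparison[rotated])
  from tendsto_add[OF this mu] show ?thesis by simp
qed

context
  fixes a t :: real
  assumes a: "0 < a" "a \<le> h" and t: "0 \<le> t" "t \<le> \<delta> a"
begin

lemma t_small: "t \<le> 1" "G * t \<le> a / 2" "G * t \<le> \<theta> / 2" "H * t\<^sup>2 \<le> \<theta> / 2" "h * t\<^sup>2 \<le> 1 / 2" "a * t\<^sup>2 \<le> \<theta> / 2"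
proof -
  show t1: "t \<le> 1" using t by (simp add: \<delta>_def)
  show "G * t \<le> a / 2" using t G_pos by (simp add: \<delta>_def field_simps)
  show G: "G * t \<le> \<theta> / 2" using t G_pos by (simp add: \<delta>_def field_simps)
  have "H * t\<^sup>2 \<le> H * t" using t(1) t1 const_nonneg by (intro mult_left_mono) (auto simp: power2_eq_square mult_left_le)
  also have "\<dots> \<le> G * t" using G_pos t by (intro mult_right_mono) auto
  finally show Ht: "H * t\<^sup>2 \<le> \<theta> / 2" using G by simp
  have "h * t\<^sup>2 \<le> H * t\<^sup>2" using cor by (intro mult_right_mono) (auto simp: corrector_def)
  with Ht show h: "h * t\<^sup>2 \<le> 1 / 2" using \<theta> by simp
  have "a * t\<^sup>2 \<le> h * t\<^sup>2" using a by (intro mult_right_mono) auto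
  with \<open>h * t\<^sup>2 \<le> H * t\<^sup>2\<close> Ht show "a * t\<^sup>2 \<le> \<theta> / 2" by simp
qed

lemma mu_bounds: "0 \<le> 1 - t\<^sup>2 * h" "1 - t\<^sup>2 * h \<le> 1 - a * t\<^sup>2" "1 - t\<^sup>2 * h \<le> 1"
proof -
  show "0 \<le> 1 - t\<^sup>2 * h" using t_small(5) by (simp add: mult.commute)
  have "a * t\<^sup>2 \<le> h * t\<^sup>2" "0 \<le> a * t\<^sup>2" using a by (auto intro: mult_right_mono)
  then show "1 - t\<^sup>2 * h \<le> 1 - a * t\<^sup>2" "1 - t\<^sup>2 * h \<le> 1" by (auto simp: mult.commute)
qed

definition nrm :: "complex^'n \<Rightarrow> real" where
  "nrm x = cmod (pf x) + vec_sup_norm (x - pf x *s approx_vec u w t)"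

text \<open>Write x = \<alpha> v + z with \<open>z\<close> centered. Over a block the first part
  shrinks by 1 - a t^2 and leaks only O(t^3) elsewhere; the second shrinks by 1 - \<theta> and leaks
  O(t). In a sum of two norms each leak is charged to the part it comes from, so the larger leak is
  paid by the fixed gap \<theta> and the smaller one by half of a t^2.\<close>

lemma nrm_contr: "nrm (Apow t m x) \<le> (1 - a * t\<^sup>2 / 2) * nrm x"
proof -
  let ?v = "approx_vec u w t" and ?\<mu> = "complex_of_real (1 - t\<^sup>2 * h)"
  define \<alpha> where "\<alpha> = pf x"
  define z where "z = x - \<alpha> *s ?v"
  have pz: "pf z = 0" by (simp add: z_def pf_diff pf_scale pf_approx_vec \<alpha>_def)
  define E where "E = Apow t m ?v - ?\<mu> ^ m *s ?v"
  define F where "F = Apow t m z - cmat (mat_pow P m) *v z"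
  define y where "y = cmat (mat_pow P m) *v z"
  have N: "vec_sup_norm ?v \<le> V" using approx_vec_bound[OF cor t(1) t_small(1)] .
  have E: "vec_sup_norm E \<le> real m * (C0 * t ^ 3)"
    using Apow_approx_vec_crude[OF t(1) t_small(1), of 1 m] mu_bounds by (simp add: E_def)
  have F: "vec_sup_norm F \<le> real m * (3 * K * t) * vec_sup_norm z"
    using Apow_minus_Ppow[OF t(1) t_small(1)] by (simp add: F_def)
  have py: "pf y = 0" by (simp add: y_def pf_cmat_pow pz)
  have y: "vec_sup_norm y \<le> (1 - \<theta>) * vec_sup_norm z"
    unfolding y_def by (rule doeblin_contraction[OF stochastic_mat_pow[OF st] p(1,2) minor]) (use \<theta> pz in \<open>auto simp: pf_def\<close>)
  have x: "x = \<alpha> *s ?v + z" by (simp add: z_def)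
  have Ax: "Apow t m x = \<alpha> *s (?\<mu> ^ m *s ?v) + \<alpha> *s E + (y + F)"
    by (subst x) (simp add: Apow_plus Apow_scale E_def F_def y_def vec_eq_iff algebra_simps del: of_real_diff)
  have pA: "pf (Apow t m x) = \<alpha> * ?\<mu> ^ m + \<alpha> * pf E + pf F"
    by (simp add: Ax pf_add pf_scale pf_approx_vec py del: of_real_diff)
  have rest: "Apow t m x - pf (Apow t m x) *s ?v = \<alpha> *s E + (y + F) - (\<alpha> * pf E + pf F) *s ?v"
    unfolding pA by (simp add: Ax vec_eq_iff algebra_simps del: of_real_diff)
  define g where "g = cmod (\<alpha>)"
  define f where "f = vec_sup_norm z"
  have gf: "0 \<le> g" "0 \<le> f" by (auto simp: g_def f_def vec_sup_norm_nonneg)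
  have mum: "cmod (?\<mu> ^ m) \<le> 1 - a * t\<^sup>2"
  proof -
    have "cmod (?\<mu> ^ m) = (1 - t\<^sup>2 * h) ^ m" using mu_bounds by (simp add: norm_power del: of_real_diff)
    also have "\<dots> \<le> (1 - t\<^sup>2 * h) ^ 1" using mu_bounds m by (intro power_decreasing) auto
    finally show ?thesis using mu_bounds by simp
  qed
  have s: "cmod (\<alpha> * pf E + pf F) \<le> g * (real m * (C0 * t ^ 3)) + real m * (3 * K * t) * f"
    using order_trans[OF pf_le E] order_trans[OF pf_le F]
    by (intro order_trans[OF norm_triangle_ineq] add_mono) (auto simp: norm_mult g_def f_def intro: mult_left_mono)
  have 1: "cmod (pf (Apow t m x)) \<le> g * (1 - a * t\<^sup>2) + (g * (real m * (C0 * t ^ 3)) + real m * (3 * K * t) * f)"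
    unfolding pA add.assoc using mum s
    by (intro order_trans[OF norm_triangle_ineq add_mono[OF _ s]]) (auto simp: norm_mult g_def intro: mult_left_mono simp del: of_real_diff)
  have 2: "vec_sup_norm (Apow t m x - pf (Apow t m x) *s ?v)
     \<le> (g * (real m * (C0 * t ^ 3)) + ((1 - \<theta>) * f + real m * (3 * K * t) * f)) + (g * (real m * (C0 * t ^ 3)) + real m * (3 * K * t) * f) * V"
    unfolding rest
    using E F y s N gf
    by (intro order_trans[OF vec_sup_norm_diff] order_trans[OF vec_sup_norm_add] order_trans[OF vec_sup_norm_scale] add_mono mult_mono)
       (auto simp: g_def f_def vec_sup_norm_nonneg intro: order_trans[OF norm_ge_zero])
  \<comment> \<open>The factor 2 + V counts a leak once in the coefficient \<open>pf\<close>, once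
    in the remainder, and once more when its component along v is removed from the
    remainder.\<close>
  define Z where "Z = real m * (C0 * t ^ 3) * (2 + V)"
  define Y where "Y = real m * (3 * K * t) * (2 + V)"
  have "nrm (Apow t m x) \<le> g * (1 - a * t\<^sup>2 + Z) + f * (1 - \<theta> + Y)"
    unfolding nrm_def Z_def Y_def using 1 2 by (simp add: algebra_simps)
  also have "\<dots> \<le> g * (1 - a * t\<^sup>2 / 2) + f * (1 - a * t\<^sup>2 / 2)"
  proof (intro add_mono mult_left_mono gf)
    have "Z = real m * C0 * (2 + V) * t * t\<^sup>2" by (simp add: Z_def power3_eq_cube power2_eq_square)
    also have "\<dots> \<le> G * t * t\<^sup>2"
    proof (intro mult_right_mono)
      have "real m * C0 * (2 + V) \<le> real m * (C0 + 3 * K) * (2 + V)"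
        using K const_nonneg by (intro mult_right_mono mult_left_mono) auto
      then show "real m * C0 * (2 + V) \<le> G" using G_pos by simp
    qed (use t in auto)
    also have "\<dots> \<le> a / 2 * t\<^sup>2" by (intro mult_right_mono t_small) auto
    finally show "1 - a * t\<^sup>2 + Z \<le> 1 - a * t\<^sup>2 / 2" by simp
    have "Y = real m * (3 * K) * (2 + V) * t" by (simp add: Y_def)
    also have "\<dots> \<le> G * t"
    proof (intro mult_right_mono)
      have "real m * (3 * K) * (2 + V) \<le> real m * (C0 + 3 * K) * (2 + V)"
        using K const_nonneg by (intro mult_right_mono mult_left_mono) auto
      then show "real m * (3 * K) * (2 + V) \<le> G" using G_pos by simp
    qed (use t in auto)
    finally show "1 - \<theta> + Y \<le> 1 - a * t\<^sup>2 / 2" using t_small \<theta> by simp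
  qed
  also have "\<dots> = (1 - a * t\<^sup>2 / 2) * nrm x"
    by (simp add: nrm_def g_def f_def z_def \<alpha>_def algebra_simps)
  finally show ?thesis .
qed

text \<open>Complete blocks contract the adapted norm, and the remaining n mod m steps are
  contractions of the sup norm. Since a t^2 / 2 <= 1, counting these steps as part of a complete
  block costs at most exp 1.\<close>

lemma Apow_decay: "vec_sup_norm (Apow t n x) \<le> Ca * exp (- (a / (2 * real m)) * real n * t\<^sup>2) * vec_sup_norm x"
proof -
  let ?v = "approx_vec u w t"
  have N: "vec_sup_norm ?v \<le> V" using approx_vec_bound[OF cor t(1) t_small(1)] .
  have pvv: "vec_sup_norm (pf x *s ?v) \<le> cmod (pf x) * V" for x
    by (rule order_trans[OF vec_sup_norm_scale]) (intro mult_left_mono N, simp)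
  have up: "vec_sup_norm x \<le> V * nrm x" for x
  proof -
    have "vec_sup_norm x \<le> vec_sup_norm (pf x *s ?v) + vec_sup_norm (x - pf x *s ?v)"
      using vec_sup_norm_add[of "pf x *s ?v" "x - pf x *s ?v"] by simp
    also have "\<dots> \<le> cmod (pf x) * V + V * vec_sup_norm (x - pf x *s ?v)"
      using pvv[of x] mult_right_mono[OF const_nonneg(4) vec_sup_norm_nonneg[of "x - pf x *s ?v"]] by simp
    finally show ?thesis by (simp add: nrm_def algebra_simps)
  qed
  have low: "nrm x \<le> (2 + V) * vec_sup_norm x" for x
  proof -
    have "nrm x \<le> vec_sup_norm x + (vec_sup_norm x + cmod (pf x) * V)"
      unfolding nrm_def using pf_le[of x] vec_sup_norm_diff[of x "pf x *s ?v"] pvv[of x] by linarith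
    also have "cmod (pf x) * V \<le> vec_sup_norm x * V" using const_nonneg by (intro mult_right_mono pf_le) auto
    finally show ?thesis by (simp add: algebra_simps)
  qed
  define q where "q = 1 - a * t\<^sup>2 / 2"
  have q0: "0 \<le> q" using t_small \<theta> by (simp add: q_def)
  have "q \<le> exp (- (a * t\<^sup>2 / 2))" using exp_ge_add_one_self[of "- (a * t\<^sup>2 / 2)"] by (simp add: q_def)
  then have qj: "q ^ j \<le> exp (- (a * t\<^sup>2 / 2)) ^ j" for j using q0 by (intro power_mono)
  have blk: "nrm (Apow t (m * j) x) \<le> q ^ j * nrm x" for j
  proof (induction j)
    case (Suc j)
    have "nrm (Apow t (m * Suc j) x) \<le> q * nrm (Apow t (m * j) x)"
      using nrm_contr[of "Apow t (m * j) x"] by (simp add: Apow_add q_def)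
    also have "\<dots> \<le> q * (q ^ j * nrm x)" by (intro mult_left_mono Suc q0)
    finally show ?case by simp
  qed simp
  define j where "j = n div m"
  have nj: "n = n mod m + m * j" by (simp add: j_def)
  have "vec_sup_norm (Apow t n x) \<le> vec_sup_norm (Apow t (m * j) x)"
    by (subst nj, subst Apow_add) (rule Apow_contr[OF t(1) t_small(1)])
  also have "\<dots> \<le> V * (q ^ j * nrm x)"
    using const_nonneg by (intro order_trans[OF up] mult_left_mono blk) auto
  also have "\<dots> \<le> V * (exp (- (a * t\<^sup>2 / 2)) ^ j * ((2 + V) * vec_sup_norm x))"
    using const_nonneg by (intro mult_left_mono mult_mono qj low) (auto simp: nrm_def vec_sup_norm_nonneg)
  also have "exp (- (a * t\<^sup>2 / 2)) ^ j \<le> exp 1 * exp (- (a / (2 * real m)) * real n * t\<^sup>2)"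
  proof -
    have "real n \<le> real m * (real j + 1)"
    proof -
      have "n \<le> m * (j + 1)" using nj mod_less_divisor[of m n] m by (subst distrib_left) linarith
      then show ?thesis by (metis of_nat_mult of_nat_le_iff of_nat_add of_nat_1)
    qed
    then have "a * t\<^sup>2 / (2 * real m) * real n \<le> a * t\<^sup>2 / (2 * real m) * (real m * (real j + 1))"
      using a by (intro mult_left_mono) auto
    also have "\<dots> = a * t\<^sup>2 / 2 * (real j + 1)" using m by simp
    also have "\<dots> \<le> a * t\<^sup>2 / 2 * real j + 1" using t_small \<theta> by (simp add: algebra_simps)
    finally have "- (a * t\<^sup>2 / 2) * real j \<le> 1 - (a / (2 * real m)) * real n * t\<^sup>2" by (simp add: mult_ac)
    then have "exp (- (a * t\<^sup>2 / 2) * real j) \<le> exp (1 - (a / (2 * real m)) * real n * t\<^sup>2)" by simp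
    also have "\<dots> = exp 1 * exp (- (a / (2 * real m)) * real n * t\<^sup>2)" by (simp add: exp_add[symmetric])
    finally show ?thesis by (simp add: exp_of_nat_mult[symmetric] mult.commute)
  qed
  finally show ?thesis using const_nonneg by (simp add: Ca_def mult_ac vec_sup_norm_nonneg mult_left_mono mult_right_mono)
qed

text \<open>The telescoping of the crude estimate is repeated with decay: each step error is carried
  by powers that already decay. The four contributions are v - 1 at the start and at the end, the
  step errors, and the replacement of (1 - t^2 h)^n by exp(-n h t^2).\<close>

lemma Apow_expansion:
  "vec_sup_norm (Apow t n 1 - complex_of_real (exp (- real n * (h * t\<^sup>2))) *s 1)
     \<le> C1 * (t + real n * t ^ 3) * exp (- (a / (2 * real m)) * real n * t\<^sup>2)"
proof -
  let ?v = "approx_vec u w t"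
  define \<mu> where "\<mu> = 1 - t\<^sup>2 * h"
  define c where "c = a / (2 * real m) * t\<^sup>2"
  define L where "L = exp (- (h * t\<^sup>2))"
  have Ca0: "0 \<le> Ca" using const_nonneg by (simp add: Ca_def)
  have c0: "0 \<le> c" using a by (simp add: c_def)
  have ca: "c \<le> a * t\<^sup>2"
  proof -
    have "c = a * t\<^sup>2 * (1 / (2 * real m))" by (simp add: c_def)
    also have "\<dots> \<le> a * t\<^sup>2 * 1" using m a by (intro mult_left_mono) auto
    finally show ?thesis by simp
  qed
  have ah: "a * t\<^sup>2 \<le> h * t\<^sup>2" using a by (intro mult_right_mono) auto
  have c1: "c \<le> 1" using ca t_small \<theta> by simp
  \<comment> \<open>An error made in one step is only multiplied by the decay of the other steps;
    the missing factor exp(-c) is supplied by exp 1 because c <= 1.\<close>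
  have e1: "1 \<le> exp 1 * exp (- c)" using c1 by (simp flip: exp_add)
  have Lc: "L \<le> exp (- c)" using ca ah by (simp add: L_def)
  have L0: "0 < L" by (simp add: L_def)
  have mu0: "0 \<le> \<mu>" using mu_bounds by (simp add: \<mu>_def)
  have muL: "\<mu> \<le> L" using exp_ge_add_one_self[of "- (h * t\<^sup>2)"] by (simp add: \<mu>_def L_def mult.commute)
  have muc: "\<mu> \<le> exp (- c)" using muL Lc by simp
  define e where "e n = exp (- c) ^ n" for n :: nat
  have e: "exp (- (a / (2 * real m)) * real n * t\<^sup>2) = e n" for n
    by (simp add: e_def c_def mult_ac flip: exp_of_nat_mult)
  have e_pos: "0 \<le> e n" for n by (simp add: e_def)
  have eS: "e (Suc n) = exp (- c) * e n" for n by (simp add: e_def)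
  have step: "g * e n + \<mu> * (real n * (g * exp 1) * e n) \<le> real (Suc n) * (g * exp 1) * e (Suc n)" if "0 \<le> g" for g n
  proof -
    have "g * e n * 1 \<le> g * e n * (exp 1 * exp (- c))" using that e_pos by (intro mult_left_mono e1) auto
    moreover have "\<mu> * (real n * (g * exp 1) * e n) \<le> exp (- c) * (real n * (g * exp 1) * e n)"
      using that e_pos by (intro mult_right_mono muc) auto
    ultimately show ?thesis by (simp add: eS algebra_simps)
  qed
  have d: "vec_sup_norm (Apow t n ?v - complex_of_real \<mu> ^ n *s ?v) \<le> real n * (Ca * (C0 * t ^ 3) * exp 1) * e n" for n
  proof (induction n)
    case 0
    show ?case by (simp add: vec_sup_norm_0)
  next
    case (Suc n)
    have "Apow t (Suc n) ?v - complex_of_real \<mu> ^ Suc n *s ?v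
        = Apow t n (A t *v ?v - complex_of_real \<mu> *s ?v) + complex_of_real \<mu> *s (Apow t n ?v - complex_of_real \<mu> ^ n *s ?v)"
      by (simp add: Apow_Suc2 Apow_minus Apow_scale vec_eq_iff algebra_simps)
    also have "vec_sup_norm \<dots> \<le> Ca * e n * (C0 * t ^ 3) + \<mu> * (real n * (Ca * (C0 * t ^ 3) * exp 1) * e n)"
    proof (rule order_trans[OF vec_sup_norm_add], intro add_mono)
      have "vec_sup_norm (Apow t n (A t *v ?v - complex_of_real \<mu> *s ?v)) \<le> Ca * e n * vec_sup_norm (A t *v ?v - complex_of_real \<mu> *s ?v)"
        using Apow_decay unfolding e .
      also have "\<dots> \<le> Ca * e n * (C0 * t ^ 3)"
        using approx_eigenvector[OF cor t(1) t_small(1)] Ca0 e_pos unfolding \<mu>_def by (intro mult_left_mono) auto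
      finally show "vec_sup_norm (Apow t n (A t *v ?v - complex_of_real \<mu> *s ?v)) \<le> Ca * e n * (C0 * t ^ 3)" .
      show "vec_sup_norm (complex_of_real \<mu> *s (Apow t n ?v - complex_of_real \<mu> ^ n *s ?v)) \<le> \<mu> * (real n * (Ca * (C0 * t ^ 3) * exp 1) * e n)"
        by (rule order_trans[OF vec_sup_norm_scale], intro mult_mono Suc) (use mu0 vec_sup_norm_nonneg in auto)
    qed
    also have "\<dots> \<le> real (Suc n) * (Ca * (C0 * t ^ 3) * exp 1) * e (Suc n)"
      using step[of "Ca * (C0 * t ^ 3)" n] Ca0 const_nonneg t by (simp add: mult_ac)
    finally show ?case .
  qed
  have Lm: "L - \<mu> \<le> H\<^sup>2 * t ^ 3"
  proof -
    define y where "y = h * t\<^sup>2"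
    have y0: "0 \<le> y" "y \<le> H * t\<^sup>2" using ah a cor by (auto simp: y_def corrector_def intro!: mult_right_mono order_trans[OF _ ah])
    have "exp (- y) \<le> 1 - y + y\<^sup>2"
    proof -
      \<comment> \<open>This product is at least one and 1 + y <= exp y, so exp(-y) differs from 1 -
        y by at most y^2, which is of order t^4.\<close>
      have "(1 - y + y\<^sup>2) * (1 + y) = 1 + y ^ 3" by (simp add: algebra_simps power2_eq_square power3_eq_cube)
      then have "1 \<le> (1 - y + y\<^sup>2) * (1 + y)" using y0 by simp
      also have "\<dots> \<le> (1 - y + y\<^sup>2) * exp y"
      proof (intro mult_left_mono)
        have "1 - y + y\<^sup>2 = (1 - y / 2)\<^sup>2 + 3 / 4 * y\<^sup>2" by (simp add: power2_eq_square algebra_simps)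
        then show "0 \<le> 1 - y + y\<^sup>2" by simp
      qed (simp add: exp_ge_add_one_self add.commute)
      finally show ?thesis by (simp add: exp_minus field_simps)
    qed
    then have "L - \<mu> \<le> y\<^sup>2" by (simp add: L_def \<mu>_def y_def mult.commute)
    also have "\<dots> \<le> (H * t\<^sup>2)\<^sup>2" using y0 by (intro power_mono)
    also have "\<dots> = H\<^sup>2 * t ^ 4" by (simp add: power_mult_distrib flip: power_mult)
    also have "\<dots> \<le> H\<^sup>2 * t ^ 3" using t(1) t_small(1) by (intro mult_left_mono power_decreasing) auto
    finally show ?thesis .
  qed
  have d2: "\<bar>\<mu> ^ n - L ^ n\<bar> \<le> real n * (H\<^sup>2 * t ^ 3 * exp 1) * e n" for n
  proof (induction n)
    case (Suc n)
    have "\<mu> ^ Suc n - L ^ Suc n = L ^ n * (\<mu> - L) + \<mu> * (\<mu> ^ n - L ^ n)" by (simp add: algebra_simps)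
    also have "\<bar>\<dots>\<bar> \<le> L ^ n * \<bar>\<mu> - L\<bar> + \<mu> * \<bar>\<mu> ^ n - L ^ n\<bar>"
      using mu0 L0 by (intro order_trans[OF abs_triangle_ineq]) (simp add: abs_mult)
    also have "\<dots> \<le> e n * (H\<^sup>2 * t ^ 3) + \<mu> * (real n * (H\<^sup>2 * t ^ 3 * exp 1) * e n)"
      unfolding e_def using Lm muL mu0 L0 Suc unfolding e_def by (intro add_mono mult_mono power_mono Lc) auto
    also have "\<dots> \<le> real (Suc n) * (H\<^sup>2 * t ^ 3 * exp 1) * e (Suc n)"
      using step[of "H\<^sup>2 * t ^ 3" n] t by (simp add: mult_ac)
    finally show ?case .
  qed simp
  have Ln: "exp (- real n * (h * t\<^sup>2)) = L ^ n" by (simp add: L_def flip: exp_of_nat_mult)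
  have "Apow t n 1 - complex_of_real (L ^ n) *s 1
     = - Apow t n (?v - 1) + ((Apow t n ?v - complex_of_real \<mu> ^ n *s ?v) + (complex_of_real \<mu> ^ n *s (?v - 1) + complex_of_real (\<mu> ^ n - L ^ n) *s 1))"
    by (simp add: Apow_minus vec_eq_iff algebra_simps)
  then have "vec_sup_norm (Apow t n 1 - complex_of_real (L ^ n) *s 1)
     \<le> vec_sup_norm (- Apow t n (?v - 1)) + (vec_sup_norm (Apow t n ?v - complex_of_real \<mu> ^ n *s ?v)
       + (vec_sup_norm (complex_of_real \<mu> ^ n *s (?v - 1)) + vec_sup_norm (complex_of_real (\<mu> ^ n - L ^ n) *s (1::complex^'n))))"
    by (simp only:) (intro order_trans[OF vec_sup_norm_add] add_mono order_refl)
  also have "vec_sup_norm (- Apow t n (?v - 1)) = vec_sup_norm (Apow t n (?v - 1))"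
    by (simp add: vec_sup_norm_def)
  also have "vec_sup_norm (Apow t n (?v - 1)) + (vec_sup_norm (Apow t n ?v - complex_of_real \<mu> ^ n *s ?v)
       + (vec_sup_norm (complex_of_real \<mu> ^ n *s (?v - 1)) + vec_sup_norm (complex_of_real (\<mu> ^ n - L ^ n) *s (1::complex^'n))))
     \<le> Ca * e n * ((U + W) * t) + (real n * (Ca * (C0 * t ^ 3) * exp 1) * e n + (e n * ((U + W) * t) + real n * (H\<^sup>2 * t ^ 3 * exp 1) * e n))"
  proof (intro add_mono d)
    have D: "vec_sup_norm (?v - 1) \<le> (U + W) * t" by (rule approx_vec_diff_1[OF cor t(1) t_small(1)])
    have "vec_sup_norm (Apow t n (?v - 1)) \<le> Ca * e n * vec_sup_norm (?v - 1)" using Apow_decay unfolding e .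
    also have "\<dots> \<le> Ca * e n * ((U + W) * t)" using Ca0 e_pos by (intro mult_left_mono D) auto
    finally show "vec_sup_norm (Apow t n (?v - 1)) \<le> Ca * e n * ((U + W) * t)" .
    have "cmod (complex_of_real \<mu> ^ n) \<le> e n" using power_mono[OF muc mu0, of n] mu0 by (simp add: norm_power e_def)
    then show "vec_sup_norm (complex_of_real \<mu> ^ n *s (?v - 1)) \<le> e n * ((U + W) * t)"
      by (intro order_trans[OF vec_sup_norm_scale] mult_mono D) (auto simp: e_pos vec_sup_norm_nonneg)
    show "vec_sup_norm (complex_of_real (\<mu> ^ n - L ^ n) *s (1::complex^'n)) \<le> real n * (H\<^sup>2 * t ^ 3 * exp 1) * e n"
      using order_trans[OF vec_sup_norm_scale, of "complex_of_real (\<mu> ^ n - L ^ n)" "1::complex^'n"] d2[of n]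
      by (simp del: of_real_diff of_real_power)
  qed
  also have "\<dots> \<le> C1 * (t + real n * t ^ 3) * e n"
  proof -
    define x1 where "x1 = Ca * (U + W)" define x2 where "x2 = Ca * C0 * exp 1"
    define x3 where "x3 = U + W" define x4 where "x4 = H\<^sup>2 * exp 1"
    define s where "s = real n * t ^ 3"
    have nn: "0 \<le> x1" "0 \<le> x2" "0 \<le> x3" "0 \<le> x4" "0 \<le> s"
      using const_nonneg Ca0 t by (auto simp: x1_def x2_def x3_def x4_def s_def)
    have "Ca * e n * ((U + W) * t) + (real n * (Ca * (C0 * t ^ 3) * exp 1) * e n + (e n * ((U + W) * t) + real n * (H\<^sup>2 * t ^ 3 * exp 1) * e n))
       = (x1 * t + x2 * s + x3 * t + x4 * s) * e n"
      by (simp add: x1_def x2_def x3_def x4_def s_def algebra_simps)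
    also have "\<dots> \<le> ((x1 + x2 + x3 + x4) * (t + s)) * e n"
    proof (intro mult_right_mono e_pos)
      have "0 \<le> x1 * s + x2 * t + x3 * s + x4 * t" using nn t by (intro add_nonneg_nonneg mult_nonneg_nonneg) auto
      then show "x1 * t + x2 * s + x3 * t + x4 * s \<le> (x1 + x2 + x3 + x4) * (t + s)" by (simp add: algebra_simps)
    qed
    also have "x1 + x2 + x3 + x4 = C1" by (simp add: C1_def x1_def x2_def x3_def x4_def)
    finally show ?thesis by (simp add: s_def)
  qed
  finally show ?thesis unfolding Ln e .
qed

end
end
end

section \<open>Markov additive processes\<close>

text \<open>Real and imaginary parts are bounded by \<open>B\<close> and handled separately by
  \<open>integral_bind\<close>; the integrals with respect to the kernel are recombined at the
  end.\<close>

lemma complex_integral_bind: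
  fixes f :: "_ \<Rightarrow> complex"
  assumes [measurable]: "f \<in> borel_measurable K" and B: "\<And>x. x \<in> space K \<Longrightarrow> cmod (f x) \<le> B"
    and N [measurable]: "N \<in> M \<rightarrow>\<^sub>M prob_algebra K" and "prob_space M"
  shows "(LINT x|(M \<bind> N). f x) = (LINT x|M. LINT y|N x. f y)"
proof -
  interpret prob_space M by fact
  have N': "N \<in> M \<rightarrow>\<^sub>M subprob_algebra K" using N by (rule measurable_prob_algebraD)
  have Nx: "prob_space (N x)" "sets (N x) = sets K" if "x \<in> space M" for x
    using measurable_space[OF N that] by (auto simp: space_prob_algebra)
  have b: "AE x in M. emeasure (N x) (space (N x)) \<le> ennreal 1"
    by (intro AE_I2) (simp add: prob_space.emeasure_space_1[OF Nx(1)])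
  have ReB: "\<bar>Re (f x)\<bar> \<le> B" "\<bar>Im (f x)\<bar> \<le> B" if "x \<in> space K" for x
    using B[OF that] abs_Re_le_cmod[of "f x"] abs_Im_le_cmod[of "f x"] by auto
  have int: "integrable (M \<bind> N) (\<lambda>x. Re (f x))" "integrable (M \<bind> N) (\<lambda>x. Im (f x))"
    by (rule integrable_bind[OF _ _ N' finite_measure_axioms b, where B=B]; use ReB in auto)+
  have intN: "integrable (N x) f" if "x \<in> space M" for x
  proof -
    interpret Nx: prob_space "N x" using Nx that by simp
    have [measurable_cong]: "sets (N x) = sets K" using Nx that by simp
    show ?thesis by (rule Nx.integrable_const_bound[of _ B]) (use B sets_eq_imp_space_eq[OF Nx(2)[OF that]] in auto)
  qed
  have intf: "integrable (M \<bind> N) f"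
  proof -
    have "integrable (M \<bind> N) (\<lambda>x. complex_of_real (Re (f x)) + \<i> * complex_of_real (Im (f x)))"
      using int by (intro Bochner_Integration.integrable_add integrable_mult_right integrable_of_real)
    then show ?thesis by (simp add: complex_eq[symmetric])
  qed
  have intM: "integrable M (\<lambda>x. LINT y|N x. f y)"
  proof (rule integrable_const_bound[of _ B])
    show "AE x in M. cmod (LINT y|N x. f y) \<le> B"
    proof (intro AE_I2)
      fix x assume x: "x \<in> space M"
      interpret Nx: prob_space "N x" using Nx x by simp
      have "cmod (LINT y|N x. f y) \<le> (LINT y|N x. cmod (f y))" by (rule integral_norm_bound)
      also have "\<dots> \<le> (LINT y|N x. B)"
        by (intro integral_mono integrable_norm intN x) (use B sets_eq_imp_space_eq[OF Nx(2)[OF x]] in auto)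
      finally show "cmod (LINT y|N x. f y) \<le> B" by (simp add: Nx.prob_space)
    qed
    show "(\<lambda>x. LINT y|N x. f y) \<in> borel_measurable M"
      by (rule measurable_compose[OF N' integral_measurable_subprob_algebra]) measurable
  qed
  show ?thesis
  proof (rule complex_eqI)
    have "Re (LINT x|(M \<bind> N). f x) = (LINT x|(M \<bind> N). Re (f x))" by (rule integral_Re[symmetric, OF intf])
    also have "\<dots> = (LINT x|M. LINT y|N x. Re (f y))"
      by (rule integral_bind[OF _ _ N' finite_measure_axioms b, where B=B]) (use ReB in auto)
    also have "\<dots> = (LINT x|M. Re (LINT y|N x. f y))"
      by (intro Bochner_Integration.integral_cong refl integral_Re intN)
    also have "\<dots> = Re (LINT x|M. LINT y|N x. f y)" by (rule integral_Re[OF intM])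
    finally show "Re (LINT x|(M \<bind> N). f x) = Re (LINT x|M. LINT y|N x. f y)" .
    have "Im (LINT x|(M \<bind> N). f x) = (LINT x|(M \<bind> N). Im (f x))" by (rule integral_Im[symmetric, OF intf])
    also have "\<dots> = (LINT x|M. LINT y|N x. Im (f y))"
      by (rule integral_bind[OF _ _ N' finite_measure_axioms b, where B=B]) (use ReB in auto)
    also have "\<dots> = (LINT x|M. Im (LINT y|N x. f y))"
      by (intro Bochner_Integration.integral_cong refl integral_Im intN)
    also have "\<dots> = Im (LINT x|M. LINT y|N x. f y)" by (rule integral_Im[OF intM])
    finally show "Im (LINT x|(M \<bind> N). f x) = Im (LINT x|M. LINT y|N x. f y)" .
  qed
qed

lemma space_map_space [simp]: "space (map_space :: ('n \<times> (real^'d)) measure) = UNIV"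
  by (simp add: space_pair_measure)

lemma slice_sets: "B \<in> sets borel \<Longrightarrow> {l} \<times> B \<in> sets (map_space :: ('n \<times> (real^'d)) measure)"
  by (intro pair_measureI) auto

text \<open>The translation property of the semigroup is given only on sets {l} x B; as there are
  finitely many states, these sets determine the measure.\<close>

lemma emeasure_slices:
  fixes M :: "('n::finite \<times> (real^'d)) measure"
  assumes M: "sets M = sets map_space" and C: "C \<in> sets map_space"
  shows "emeasure M C = (\<Sum>l\<in>UNIV. emeasure M ({l} \<times> (Pair l -` C)))"
proof -
  have meas: "{l} \<times> (Pair l -` C) \<in> sets M" for l
    unfolding M by (rule slice_sets[OF sets_Pair1[OF C]])
  have "(\<Sum>l\<in>UNIV. emeasure M ({l} \<times> (Pair l -` C))) = emeasure M (\<Union>l\<in>UNIV. {l} \<times> (Pair l -` C))"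
    by (rule sum_emeasure) (auto simp: meas disjoint_family_on_def)
  also have "(\<Union>l\<in>UNIV. {l} \<times> (Pair l -` C)) = C" by auto
  finally show ?thesis ..
qed


locale map_process =
  fixes T :: "real set"
    and Q :: "real \<Rightarrow> 'n::finite \<times> (real^'d) \<Rightarrow> ('n \<times> (real^'d)) measure"
    and Pr :: "'n \<Rightarrow> 'w measure" and X :: "real \<Rightarrow> 'w \<Rightarrow> 'n" and Y :: "real \<Rightarrow> 'w \<Rightarrow> real^'d"
  assumes time: "T = \<nat> \<or> T = {0..}" and MAP: "markov_additive_process T Q Pr X Y"
begin

lemma T: "0 \<in> T" "s \<in> T \<Longrightarrow> t \<in> T \<Longrightarrow> s + t \<in> T" "real n \<in> T" "t \<in> T \<Longrightarrow> 0 \<le> t"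
  "t \<in> T \<Longrightarrow> t - real (nat \<lfloor>t\<rfloor>) \<in> T"
  using time by (auto simp: Nats_add elim!: Nats_cases intro: of_int_floor_le)

lemma Q_measurable: "t \<in> T \<Longrightarrow> Q t \<in> map_space \<rightarrow>\<^sub>M prob_algebra map_space"
  and Q_0: "Q 0 z = return map_space z"
  and Q_add: "s \<in> T \<Longrightarrow> t \<in> T \<Longrightarrow> Q (s + t) z = Q s z \<bind> Q t"
  and Q_additive: "t \<in> T \<Longrightarrow> B \<in> sets borel \<Longrightarrow>
        emeasure (Q t (k, y)) ({l} \<times> B) = emeasure (Q t (k, 0)) ({l} \<times> ((\<lambda>z. z - y) ` B))"
  using MAP by (auto simp: markov_additive_process_def transition_semigroup_def additive_semigroup_def simp del: split_paired_All)

lemma Q_prob: "t \<in> T \<Longrightarrow> prob_space (Q t z)" and sets_Q: "t \<in> T \<Longrightarrow> sets (Q t z) = sets map_space"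
  using measurable_space[OF Q_measurable, of t z] by (auto simp: space_prob_algebra)

lemma space_Q: "t \<in> T \<Longrightarrow> space (Q t z) = UNIV"
  using sets_eq_imp_space_eq[OF sets_Q] by simp

lemma Q_translate:
  assumes t: "t \<in> T"
  shows "Q t (k, y) = distr (Q t (k, 0)) map_space (\<lambda>z. (fst z, snd z + y))"
proof (rule measure_eqI)
  note [measurable_cong] = sets_Q[OF t]
  let ?D = "distr (Q t (k, 0)) map_space (\<lambda>z. (fst z, snd z + y))"
  show "sets (Q t (k, y)) = sets ?D" using sets_Q[OF t] by simp
  fix C assume "C \<in> sets (Q t (k, y))"
  then have C: "C \<in> sets map_space" using sets_Q[OF t] by simp
  have "emeasure (Q t (k, y)) ({l} \<times> (Pair l -` C)) = emeasure ?D ({l} \<times> (Pair l -` C))" for l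
  proof -
    have B: "Pair l -` C \<in> sets borel" by (rule sets_Pair1[OF C])
    have "(\<lambda>z. (fst z, snd z + y)) -` ({l} \<times> (Pair l -` C)) = {l} \<times> ((\<lambda>z. z - y) ` (Pair l -` C))"
    proof -
      have "(\<lambda>z. z - y) ` B = {b. b + y \<in> B}" for B
      proof safe
        fix b assume "b + y \<in> B"
        then have "(b + y) - y \<in> (\<lambda>z. z - y) ` B" by (rule imageI)
        then show "b \<in> (\<lambda>z. z - y) ` B" by simp
      qed auto
      then show ?thesis by auto
    qed
    then show ?thesis
      unfolding Q_additive[OF t B] by (subst emeasure_distr) (auto simp: slice_sets[OF B] space_Q[OF t])
  qed
  then show "emeasure (Q t (k, y)) C = emeasure ?D C"
    by (subst (1 2) emeasure_slices[OF _ C]) (auto simp: sets_Q[OF t])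
qed

lemma Pr_prob: "prob_space (Pr k)"
  and X_meas: "t \<in> T \<Longrightarrow> X t \<in> Pr k \<rightarrow>\<^sub>M count_space UNIV"
  and Y_meas: "t \<in> T \<Longrightarrow> Y t \<in> Pr k \<rightarrow>\<^sub>M borel"
  and start: "AE \<omega> in Pr k. X 0 \<omega> = k \<and> Y 0 \<omega> = 0"
  and markov: "s \<in> T \<Longrightarrow> t \<in> T \<Longrightarrow> S \<in> past T (Pr k) X Y s \<Longrightarrow> C \<in> sets map_space \<Longrightarrow>
           emeasure (Pr k) {\<omega> \<in> S. (X (s + t) \<omega>, Y (s + t) \<omega>) \<in> C}
           = (\<integral>\<^sup>+\<omega>\<in>S. emeasure (Q t (X s \<omega>, Y s \<omega>)) C \<partial>Pr k)"
  using MAP unfolding markov_additive_process_def by blast+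

text \<open>This is the Markov property at time zero with the whole space as past event, where the
  process starts almost surely in (k, 0). It moves statements about the process to the
  kernels.\<close>

lemma law_eq:
  assumes t: "t \<in> T"
  shows "distr (Pr k) map_space (\<lambda>\<omega>. (X t \<omega>, Y t \<omega>)) = Q t (k, 0)"
proof (rule measure_eqI)
  note [measurable] = X_meas[OF t] Y_meas[OF t]
  interpret prob_space "Pr k" by (rule Pr_prob)
  show "sets (distr (Pr k) map_space (\<lambda>\<omega>. (X t \<omega>, Y t \<omega>))) = sets (Q t (k, 0))"
    by (simp add: sets_Q[OF t])
  fix C assume "C \<in> sets (distr (Pr k) map_space (\<lambda>\<omega>. (X t \<omega>, Y t \<omega>)))"
  then have C: "C \<in> sets map_space" by simp
  have "emeasure (distr (Pr k) map_space (\<lambda>\<omega>. (X t \<omega>, Y t \<omega>))) C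
     = emeasure (Pr k) {\<omega> \<in> space (Pr k). (X (0 + t) \<omega>, Y (0 + t) \<omega>) \<in> C}"
    using C by (subst emeasure_distr) (auto intro!: arg_cong2[where f=emeasure])
  also have "\<dots> = (\<integral>\<^sup>+\<omega>\<in>space (Pr k). emeasure (Q t (X 0 \<omega>, Y 0 \<omega>)) C \<partial>Pr k)"
    by (rule markov[OF T(1) t _ C]) (simp add: past_def sigma_sets_top)
  also have "\<dots> = (\<integral>\<^sup>+\<omega>. emeasure (Q t (k, 0)) C \<partial>Pr k)"
    by (rule nn_integral_cong_AE) (use start[of k] in \<open>auto simp: indicator_def\<close>)
  also have "\<dots> = emeasure (Q t (k, 0)) C" by (simp add: emeasure_space_1)
  finally show "emeasure (distr (Pr k) map_space (\<lambda>\<omega>. (X t \<omega>, Y t \<omega>))) C = emeasure (Q t (k, 0)) C" .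
qed

definition \<Phi> :: "real \<Rightarrow> real^'d \<Rightarrow> complex^'n^'n" where
  "\<Phi> t \<zeta> = (\<chi> k l. LINT z|Q t (k, 0). indicator {l} (fst z) * cis (\<zeta> \<bullet> snd z))"

lemma bounded_integrable:
  assumes "t \<in> T" "f \<in> borel_measurable map_space" "\<And>z. norm (f z :: 'b::{banach, second_countable_topology}) \<le> B"
  shows "integrable (Q t z) f"
proof -
  interpret prob_space "Q t z" using assms Q_prob by blast
  note [measurable_cong] = sets_Q[OF assms(1)]
  show ?thesis using assms(2,3) by (intro integrable_const_bound[of _ B]) auto
qed

text \<open>Given the state (j, y) at time \<open>s\<close>, translation invariance takes the factor
  cis(\<zeta>.y) out of the inner integral of the Chapman-Kolmogorov equation; summing over j
  produces the matrix product.\<close>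

lemma \<Phi>_add:
  assumes s: "s \<in> T" and t: "t \<in> T"
  shows "\<Phi> (s + t) \<zeta> = \<Phi> s \<zeta> ** \<Phi> t \<zeta>"
proof -
  note [measurable_cong] = sets_Q[OF s] sets_Q[OF t]
  note [measurable] = Q_measurable[OF t]
  have "(\<Phi> (s + t) \<zeta>) $ k $ l = (\<Phi> s \<zeta> ** \<Phi> t \<zeta>) $ k $ l" for k l
  proof -
    let ?f = "\<lambda>z::'n \<times> (real^'d). indicator {l} (fst z) * cis (\<zeta> \<bullet> snd z)"
    have inner: "(LINT z'|Q t z. ?f z') = (\<Sum>j\<in>UNIV. indicator {j} (fst z) * cis (\<zeta> \<bullet> snd z) * \<Phi> t \<zeta> $ j $ l)" for z
    proof -
      obtain j y where z: "z = (j, y)" by (cases z)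
      have "(LINT z'|Q t z. ?f z') = (LINT z'|Q t (j, 0). ?f (fst z', snd z' + y))"
        unfolding z Q_translate[OF t, of j y] by (subst integral_distr) auto
      also have "\<dots> = (LINT z'|Q t (j, 0). cis (\<zeta> \<bullet> y) * ?f z')"
        by (intro Bochner_Integration.integral_cong refl) (simp add: inner_add_right mult.left_commute cis_mult add.commute)
      also have "\<dots> = cis (\<zeta> \<bullet> y) * \<Phi> t \<zeta> $ j $ l" by (simp add: \<Phi>_def)
      also have "\<dots> = (\<Sum>i\<in>UNIV. if i = j then cis (\<zeta> \<bullet> y) * \<Phi> t \<zeta> $ j $ l else 0)" by simp
      also have "\<dots> = (\<Sum>i\<in>UNIV. indicator {i} (fst z) * cis (\<zeta> \<bullet> snd z) * \<Phi> t \<zeta> $ i $ l)"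
        by (intro sum.cong refl) (auto simp: z indicator_def)
      finally show ?thesis .
    qed
    have "\<Phi> (s + t) \<zeta> $ k $ l = (LINT z|Q s (k, 0). LINT z'|Q t z. ?f z')"
      unfolding \<Phi>_def vec_lambda_beta Q_add[OF s t]
      by (rule complex_integral_bind[where B=1 and K=map_space]) (auto simp: norm_mult indicator_def Q_prob[OF s])
    also have "\<dots> = (\<Sum>j\<in>UNIV. (LINT z|Q s (k, 0). indicator {j} (fst z) * cis (\<zeta> \<bullet> snd z) * \<Phi> t \<zeta> $ j $ l))"
      unfolding inner by (intro Bochner_Integration.integral_sum integrable_mult_left bounded_integrable[OF s, of _ 1])
        (auto simp: norm_mult indicator_def)
    also have "\<dots> = (\<Sum>j\<in>UNIV. \<Phi> s \<zeta> $ k $ j * \<Phi> t \<zeta> $ j $ l)" by (simp add: \<Phi>_def)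
    finally show ?thesis by (simp add: matrix_matrix_mult_def)
  qed
  then show ?thesis by (simp add: vec_eq_iff)
qed

lemma \<Phi>_0: "\<Phi> 0 \<zeta> = mat 1"
proof -
  have "\<Phi> 0 \<zeta> $ k $ l = (mat 1 :: complex^'n^'n) $ k $ l" for k l
    unfolding \<Phi>_def Q_0 vec_lambda_beta
    by (subst integral_return) (auto simp: mat_def)
  then show ?thesis by (simp add: vec_eq_iff)
qed

lemma \<Phi>_pow: "\<Phi> (real n) \<zeta> *v x = ((*v) (\<Phi> 1 \<zeta>) ^^ n) x"
proof (induction n)
  case (Suc n)
  have "\<Phi> (1 + real n) \<zeta> = \<Phi> 1 \<zeta> ** \<Phi> (real n) \<zeta>"
    using \<Phi>_add[of 1 "real n"] T(3)[of 1] T(3)[of n] by simp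
  then show ?case using Suc by (simp flip: matrix_vector_mul_assoc)
qed (simp add: \<Phi>_0)

lemma \<Phi>_at_0: "t \<in> T \<Longrightarrow> \<Phi> t 0 $ k $ l = complex_of_real (measure (Q t (k, 0)) ({l} \<times> UNIV))"
proof -
  assume t: "t \<in> T"
  have "\<Phi> t 0 $ k $ l = (LINT z|Q t (k, 0). complex_of_real (indicator ({l} \<times> UNIV) z))"
    unfolding \<Phi>_def vec_lambda_beta by (intro Bochner_Integration.integral_cong) (auto simp: indicator_def)
  also have "\<dots> = complex_of_real (measure (Q t (k, 0)) ({l} \<times> UNIV))"
    by (subst integral_complex_of_real) (simp add: space_Q[OF t])
  finally show ?thesis .
qed

lemma sum_slices: "t \<in> T \<Longrightarrow> (\<Sum>l\<in>UNIV. measure (Q t (k, 0)) ({l} \<times> UNIV)) = 1"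
proof -
  assume t: "t \<in> T"
  interpret prob_space "Q t (k, 0)" by (rule Q_prob[OF t])
  have "(\<Sum>l\<in>UNIV. measure (Q t (k, 0)) ({l} \<times> UNIV)) = measure (Q t (k, 0)) (\<Union>l\<in>UNIV. {l} \<times> UNIV)"
    by (rule finite_measure_finite_Union[symmetric])
      (auto simp: sets_Q[OF t] slice_sets disjoint_family_on_def)
  also have "(\<Union>l\<in>UNIV. {l} \<times> UNIV) = space (Q t (k, 0))" by (auto simp: space_Q[OF t])
  finally show ?thesis by (simp add: prob_space)
qed

lemma \<Phi>_norm: "t \<in> T \<Longrightarrow> cmod (\<Phi> t \<zeta> $ k $ l) \<le> measure (Q t (k, 0)) ({l} \<times> UNIV)"
proof -
  assume t: "t \<in> T"
  have "cmod (\<Phi> t \<zeta> $ k $ l) \<le> (LINT z|Q t (k, 0). cmod (indicator {l} (fst z) * cis (\<zeta> \<bullet> snd z)))"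
    unfolding \<Phi>_def vec_lambda_beta by (rule integral_norm_bound)
  also have "\<dots> = (LINT z|Q t (k, 0). indicator ({l} \<times> UNIV) z)"
    by (intro Bochner_Integration.integral_cong) (auto simp: indicator_def norm_mult)
  finally show ?thesis by (simp add: space_Q[OF t])
qed

lemma \<Phi>_row: "t \<in> T \<Longrightarrow> (\<Sum>l\<in>UNIV. cmod (\<Phi> t \<zeta> $ k $ l)) \<le> 1"
  using sum_mono[of UNIV "\<lambda>l. cmod (\<Phi> t \<zeta> $ k $ l)" "\<lambda>l. measure (Q t (k, 0)) ({l} \<times> UNIV)", OF \<Phi>_norm] sum_slices[of t k] by simp

lemma \<Phi>_one: "t \<in> T \<Longrightarrow> (\<Phi> t \<zeta> *v 1) $ k = (LINT z|Q t (k, 0). cis (\<zeta> \<bullet> snd z))"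
proof -
  assume t: "t \<in> T"
  have "(LINT z|Q t (k, 0). cis (\<zeta> \<bullet> snd z)) = (LINT z|Q t (k, 0). (\<Sum>l\<in>UNIV. indicator {l} (fst z) * cis (\<zeta> \<bullet> snd z)))"
    by (intro Bochner_Integration.integral_cong refl) (simp add: indicator_def flip: sum_distrib_right)
  also have "\<dots> = (\<Sum>l\<in>UNIV. (LINT z|Q t (k, 0). indicator {l} (fst z) * cis (\<zeta> \<bullet> snd z)))"
    by (intro Bochner_Integration.integral_sum bounded_integrable[OF t, of _ 1]) (auto simp: norm_mult indicator_def)
  finally show ?thesis by (simp add: matrix_vector_mult_def \<Phi>_def)
qed

text \<open>At frequency zero \<open>\<Phi>\<close> is the transition matrix of the driving process,
  so its semigroup law carries over.\<close>

lemma driving_pow: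
  assumes "driving_semigroup Q 1 = P"
  shows "mat_pow P n = driving_semigroup Q (real n)"
proof -
  have D: "\<Phi> (real n) 0 = cmat (driving_semigroup Q (real n))" for n
    using T(3)[of n] by (simp add: vec_eq_iff \<Phi>_at_0 driving_semigroup_def)
  have "cmat (mat_pow P n) = \<Phi> (real n) 0"
  proof (induction n)
    case 0
    show ?case by (simp add: \<Phi>_0 vec_eq_iff mat_def)
  next
    case (Suc n)
    have "\<Phi> (1 + real n) 0 = \<Phi> 1 0 ** \<Phi> (real n) 0"
      using \<Phi>_add[of 1 "real n"] T(3)[of 1] T(3)[of n] by simp
    then show ?case using Suc D[of 1] assms by (simp add: mat_pow_Suc cmat_mult)
  qed
  then show ?thesis unfolding D by (simp add: vec_eq_iff)
qed

lemma additive_law_eq: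
  assumes t: "t \<in> T" and B: "B \<in> sets borel"
  shows "emeasure (additive_law Pr X Y t k l) B = emeasure (Q t (k, 0)) ({l} \<times> B)"
proof -
  note [measurable] = X_meas[OF t, of k] Y_meas[OF t, of k] B
  have S: "{\<omega> \<in> space (Pr k). X t \<omega> = l} \<inter> space (Pr k) \<in> sets (Pr k)" by measurable
  have "emeasure (additive_law Pr X Y t k l) B
     = emeasure (restrict_space (Pr k) {\<omega> \<in> space (Pr k). X t \<omega> = l}) (Y t -` B \<inter> {\<omega> \<in> space (Pr k). X t \<omega> = l})"
    unfolding additive_law_def
    by (subst emeasure_distr) (auto intro!: measurable_restrict_space1 arg_cong2[where f=emeasure] simp: space_restrict_space)
  also have "\<dots> = emeasure (Pr k) (Y t -` B \<inter> {\<omega> \<in> space (Pr k). X t \<omega> = l})"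
    by (rule emeasure_restrict_space[OF S]) auto
  also have "\<dots> = emeasure (distr (Pr k) map_space (\<lambda>\<omega>. (X t \<omega>, Y t \<omega>))) ({l} \<times> B)"
    by (subst emeasure_distr) (auto simp: slice_sets[OF B] intro!: arg_cong2[where f=emeasure])
  finally show ?thesis unfolding law_eq[OF t] .
qed

lemma sets_additive_law [simp]: "sets (additive_law Pr X Y t k l) = sets borel"
  by (simp add: additive_law_def)

lemma finite_additive_law: "t \<in> T \<Longrightarrow> finite_measure (additive_law Pr X Y t k l)"
proof (rule finite_measureI)
  assume t: "t \<in> T"
  interpret prob_space "Q t (k, 0)" by (rule Q_prob[OF t])
  have "space (additive_law Pr X Y t k l) = UNIV" by (simp add: additive_law_def)
  then show "emeasure (additive_law Pr X Y t k l) (space (additive_law Pr X Y t k l)) \<noteq> \<infinity>"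
    by (simp add: additive_law_eq[OF t])
qed

lemma additive_law_distr:
  assumes t: "t \<in> T"
  shows "additive_law Pr X Y t k l = distr (restrict_space (Q t (k, 0)) ({l} \<times> UNIV)) borel snd"
proof (rule measure_eqI)
  fix B assume "B \<in> sets (additive_law Pr X Y t k l)"
  then have B: "B \<in> sets borel" by simp
  note [measurable_cong] = sets_Q[OF t]
  have "emeasure (distr (restrict_space (Q t (k, 0)) ({l} \<times> UNIV)) borel snd) B
     = emeasure (restrict_space (Q t (k, 0)) ({l} \<times> UNIV)) ({l} \<times> B)"
    by (subst emeasure_distr) (auto intro!: measurable_restrict_space1 arg_cong2[where f=emeasure] simp: space_restrict_space space_Q[OF t] B)
  also have "\<dots> = emeasure (Q t (k, 0)) ({l} \<times> B)"
    by (rule emeasure_restrict_space) (auto simp: sets_Q[OF t] space_Q[OF t] slice_sets)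
  finally show "emeasure (additive_law Pr X Y t k l) B = emeasure (distr (restrict_space (Q t (k, 0)) ({l} \<times> UNIV)) borel snd) B"
    by (simp add: additive_law_eq[OF t B])
qed simp

lemma integral_additive_law:
  assumes t: "t \<in> T"
  shows "(LINT y|additive_law Pr X Y t k l. cis (\<zeta> \<bullet> y)) = \<Phi> t \<zeta> $ k $ l"
proof -
  note [measurable_cong] = sets_Q[OF t]
  have S: "({l} \<times> UNIV) \<inter> space (Q t (k, 0)) \<in> sets (Q t (k, 0))"
    by (simp add: sets_Q[OF t] space_Q[OF t] slice_sets)
  have "(LINT y|additive_law Pr X Y t k l. cis (\<zeta> \<bullet> y)) = (LINT z|restrict_space (Q t (k, 0)) ({l} \<times> UNIV). cis (\<zeta> \<bullet> snd z))"
    unfolding additive_law_distr[OF t] by (subst integral_distr) (auto intro!: measurable_restrict_space1)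
  also have "\<dots> = \<Phi> t \<zeta> $ k $ l"
    unfolding \<Phi>_def vec_lambda_beta
    by (subst integral_restrict_space[OF S], intro Bochner_Integration.integral_cong) (auto simp: indicator_def)
  finally show ?thesis .
qed

lemma nn_integral_law:
  assumes t: "t \<in> T" and [measurable]: "f \<in> borel_measurable borel"
  shows "(\<integral>\<^sup>+z. f (snd z) \<partial>Q t (k, 0)) = (\<integral>\<^sup>+\<omega>. f (Y t \<omega>) \<partial>Pr k)"
proof -
  note [measurable] = X_meas[OF t] Y_meas[OF t]
  show ?thesis unfolding law_eq[OF t, symmetric] by (subst nn_integral_distr) auto
qed

lemma nn_integral_additive_law_le:
  assumes t: "t \<in> T" and [measurable]: "f \<in> borel_measurable borel"
  shows "(\<integral>\<^sup>+y. f y \<partial>additive_law Pr X Y t k l) \<le> (\<integral>\<^sup>+z. f (snd z) \<partial>Q t (k, 0))"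
proof -
  note [measurable_cong] = sets_Q[OF t]
  have S: "({l} \<times> UNIV) \<inter> space (Q t (k, 0)) \<in> sets (Q t (k, 0))"
    by (simp add: sets_Q[OF t] space_Q[OF t] slice_sets)
  have "(\<integral>\<^sup>+y. f y \<partial>additive_law Pr X Y t k l) = (\<integral>\<^sup>+z. f (snd z) * indicator ({l} \<times> UNIV) z \<partial>Q t (k, 0))"
    unfolding additive_law_distr[OF t]
    by (subst nn_integral_distr) (auto intro!: measurable_restrict_space1 simp: nn_integral_restrict_space[OF S])
  also have "\<dots> \<le> (\<integral>\<^sup>+z. f (snd z) \<partial>Q t (k, 0))"
    by (intro nn_integral_mono) (auto simp: indicator_def)
  finally show ?thesis .
qed

lemma first_moment_add:
  assumes s: "s \<in> T" and t: "t \<in> T"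
    and a: "\<And>k. (\<integral>\<^sup>+z. ennreal (norm (snd z)) \<partial>Q s (k, 0)) \<le> a"
    and b: "\<And>k. (\<integral>\<^sup>+z. ennreal (norm (snd z)) \<partial>Q t (k, 0)) \<le> b"
  shows "(\<integral>\<^sup>+z. ennreal (norm (snd z)) \<partial>Q (s + t) (k, 0)) \<le> a + b"
proof -
  note [measurable_cong] = sets_Q[OF s] sets_Q[OF t]
  interpret S: prob_space "Q s (k, 0)" by (rule Q_prob[OF s])
  have meas: "Q t \<in> Q s (k, 0) \<rightarrow>\<^sub>M subprob_algebra map_space"
    using measurable_prob_algebraD[OF Q_measurable[OF t]] by measurable
  have inner: "(\<integral>\<^sup>+z'. ennreal (norm (snd z')) \<partial>Q t z) \<le> ennreal (norm (snd z)) + b" for z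
  proof -
    obtain j y where z: "z = (j, y)" by (cases z)
    interpret prob_space "Q t (j, 0)" by (rule Q_prob[OF t])
    have "(\<integral>\<^sup>+z'. ennreal (norm (snd z')) \<partial>Q t z) = (\<integral>\<^sup>+z'. ennreal (norm (snd z' + y)) \<partial>Q t (j, 0))"
      unfolding z Q_translate[OF t, of j y] by (subst nn_integral_distr) auto
    also have "\<dots> \<le> (\<integral>\<^sup>+z'. ennreal (norm y) + ennreal (norm (snd z')) \<partial>Q t (j, 0))"
      by (intro nn_integral_mono) (simp add: norm_triangle_ineq2 add.commute[of _ y] norm_triangle_ineq flip: ennreal_plus)
    also have "\<dots> = ennreal (norm y) + (\<integral>\<^sup>+z'. ennreal (norm (snd z')) \<partial>Q t (j, 0))"
      by (subst nn_integral_add) (auto simp: emeasure_space_1)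
    finally show ?thesis using b[of j] by (simp add: z) (meson add_left_mono order_trans)
  qed
  have "(\<integral>\<^sup>+z. ennreal (norm (snd z)) \<partial>Q (s + t) (k, 0)) = (\<integral>\<^sup>+z. \<integral>\<^sup>+z'. ennreal (norm (snd z')) \<partial>Q t z \<partial>Q s (k, 0))"
    unfolding Q_add[OF s t] by (rule nn_integral_bind[OF _ meas]) measurable
  also have "\<dots> \<le> (\<integral>\<^sup>+z. ennreal (norm (snd z)) + b \<partial>Q s (k, 0))" by (intro nn_integral_mono inner)
  also have "\<dots> = (\<integral>\<^sup>+z. ennreal (norm (snd z)) \<partial>Q s (k, 0)) + b"
    by (subst nn_integral_add) (auto simp: S.emeasure_space_1)
  finally show ?thesis using a[of k] by (meson add_right_mono order_trans)
qed

text \<open>Unit increments add by the triangle inequality. A first moment at a fixed integer time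
  is what limits the mass far from the origin in the large-frequency estimate.\<close>

lemma first_moment_nat:
  assumes "\<And>k. (\<integral>\<^sup>+z. ennreal (norm (snd z)) \<partial>Q 1 (k, 0)) \<le> a"
  shows "(\<integral>\<^sup>+z. ennreal (norm (snd z)) \<partial>Q (real n) (k, 0)) \<le> of_nat n * a"
proof (induction n arbitrary: k)
  case 0
  show ?case by (simp add: Q_0 nn_integral_return)
next
  case (Suc n)
  have "1 \<in> T" using T(3)[of 1] by simp
  from first_moment_add[OF this T(3) assms Suc] show ?case by (simp add: distrib_right)
qed

end

context map_process begin

lemma T_diff: "s \<in> T \<Longrightarrow> t \<in> T \<Longrightarrow> s \<le> t \<Longrightarrow> t - s \<in> T"
  using time by (auto simp: Nats_diff elim!: Nats_cases simp flip: of_nat_diff)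

text \<open>Complete blocks of length \<open>n\<close> contract, and the rest of the time is a
  contraction by the row-sum bound. The condition \<kappa> <= 1 makes 1 - \<kappa> nonnegative and
  bounds the price of the incomplete block by exp 1.\<close>

lemma large_frequency_decay:
  assumes n: "1 \<le> n" and \<kappa>: "0 < \<kappa>" "\<kappa> \<le> 1"
    and row: "\<And>k. (\<Sum>l\<in>UNIV. cmod (\<Phi> (real n) \<zeta> $ k $ l)) \<le> 1 - \<kappa>" and t: "t \<in> T"
  shows "cmod ((\<Phi> t \<zeta> *v 1) $ k) \<le> exp 1 * exp (- (\<kappa> / real n) * t)"
proof -
  have blk: "vec_sup_norm (\<Phi> (real (n * j)) \<zeta> *v x) \<le> (1 - \<kappa>) ^ j * vec_sup_norm x" for j x
  proof (induction j)
    case 0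
    then show ?case by (simp add: \<Phi>_0)
  next
    case (Suc j)
    have "\<Phi> (real (n * Suc j)) \<zeta> = \<Phi> (real n) \<zeta> ** \<Phi> (real (n * j)) \<zeta>"
      using \<Phi>_add[OF T(3) T(3), of n "n * j"] by simp
    then have "vec_sup_norm (\<Phi> (real (n * Suc j)) \<zeta> *v x) \<le> (1 - \<kappa>) * vec_sup_norm (\<Phi> (real (n * j)) \<zeta> *v x)"
      using vec_sup_norm_mult_vec[OF row, of "\<Phi> (real (n * j)) \<zeta> *v x"] by (simp add: matrix_vector_mul_assoc)
    also have "\<dots> \<le> (1 - \<kappa>) * ((1 - \<kappa>) ^ j * vec_sup_norm x)" using \<kappa> by (intro mult_left_mono Suc) auto
    finally show ?case by simp
  qed
  define j where "j = nat \<lfloor>t / real n\<rfloor>"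
  have t0: "0 \<le> t" using T(4)[OF t] .
  have j: "real j \<le> t / real n" "t / real n < real j + 1" using t0 by (auto simp: j_def)
  have le: "real (n * j) \<le> t" using j(1) n by (simp add: field_simps)
  define r where "r = t - real (n * j)"
  have r: "r \<in> T" unfolding r_def by (rule T_diff[OF T(3) t le])
  have "\<Phi> t \<zeta> = \<Phi> (real (n * j)) \<zeta> ** \<Phi> r \<zeta>" using \<Phi>_add[OF T(3) r, of "n * j"] by (simp add: r_def)
  then have "cmod ((\<Phi> t \<zeta> *v 1) $ k) \<le> vec_sup_norm (\<Phi> (real (n * j)) \<zeta> *v (\<Phi> r \<zeta> *v 1))"
    by (simp add: matrix_vector_mul_assoc vec_sup_norm_ge)
  also have "\<dots> \<le> (1 - \<kappa>) ^ j * vec_sup_norm (\<Phi> r \<zeta> *v 1)" by (rule blk)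
  also have "\<dots> \<le> (1 - \<kappa>) ^ j * 1"
    using vec_sup_norm_mult_vec[OF \<Phi>_row[OF r], of \<zeta> 1] \<kappa> by (intro mult_left_mono) auto
  also have "\<dots> \<le> exp (- \<kappa>) ^ j * 1"
    using exp_ge_add_one_self[of "- \<kappa>"] \<kappa> by (intro mult_right_mono power_mono) auto
  also have "\<dots> = exp (- \<kappa> * real j)" by (simp flip: exp_of_nat_mult add: mult.commute)
  also have "\<dots> \<le> exp (1 + (- (\<kappa> / real n) * t))"
  proof -
    have "\<kappa> * (t / real n) \<le> \<kappa> * (real j + 1)" using j \<kappa> by (intro mult_left_mono) auto
    then show ?thesis using \<kappa> by (simp add: algebra_simps)
  qed
  also have "\<dots> = exp 1 * exp (- (\<kappa> / real n) * t)" by (rule exp_add)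
  finally show ?thesis .
qed

end

section \<open>Taylor expansion of the Fourier matrix at frequency zero\<close>

lemma iexp_taylor2: "cmod (cis x - (1 + \<i> * x - x\<^sup>2 / 2)) \<le> \<bar>x\<bar> ^ 3"
proof -
  have eq: "(\<Sum>k\<le>2. (\<i> * complex_of_real x) ^ k / fact k) = 1 + \<i> * x - x\<^sup>2 / 2"
    by (simp add: numeral_2_eq_2 power2_eq_square mult_ac)
  have le: "\<bar>x\<bar> ^ 3 / 6 \<le> \<bar>x\<bar> ^ 3" by simp
  have "cmod (cis x - (\<Sum>k\<le>2. (\<i> * complex_of_real x) ^ k / fact k)) \<le> \<bar>x\<bar> ^ 3 / 6"
    using iexp_approx1[of x 2] by (simp add: cis_conv_exp fact_numeral)
  from order_trans[OF this le] show ?thesis unfolding eq .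
qed

text \<open>One member of the family, together with numbers \<open>M\<close>,
  \<open>\<theta>\<close> and \<open>m\<close> that will be chosen once for all members.
  \<open>moments\<close> and \<open>minor\<close> are the forms in which the uniform third moment
  and the uniform minorization enter.\<close>

locale ergodic_map = map_process T Q Pr X Y
  for T and Q :: "real \<Rightarrow> 'n::finite \<times> (real^'d) \<Rightarrow> ('n \<times> (real^'d)) measure"
    and Pr :: "'n \<Rightarrow> 'w measure" and X :: "real \<Rightarrow> 'w \<Rightarrow> 'n" and Y :: "real \<Rightarrow> 'w \<Rightarrow> real^'d" +
  fixes P :: "real^'n^'n" and S :: "real^'d^'d" and M \<theta> :: real and m :: nat
  assumes driving: "driving_semigroup Q 1 = P" and centered: "centered_MAP P Pr Y"
    and cov: "asymptotic_covariance T Pr Y S" and M: "0 \<le> M"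
    and moments: "\<And>v k. v \<in> T \<Longrightarrow> 0 < v \<Longrightarrow> v \<le> 1 \<Longrightarrow> (\<integral>\<^sup>+\<omega>. ennreal (norm (Y v \<omega>) ^ 3) \<partial>Pr k) \<le> ennreal M"
    and minor: "\<And>k l. \<theta> \<le> mat_pow P m $ k $ l" and \<theta>: "0 < \<theta>" "\<theta> < 1" and m: "1 \<le> m"
begin

lemma T1: "1 \<in> T" using T(3)[of 1] by simp

lemma third_moment:
  assumes v: "v \<in> T" "0 < v" "v \<le> 1"
  shows "integrable (Q v (k, 0)) (\<lambda>z. norm (snd z) ^ 3)" "(LINT z|Q v (k, 0). norm (snd z) ^ 3) \<le> M"
proof -
  note [measurable_cong] = sets_Q[OF v(1)]
  have b: "(\<integral>\<^sup>+z. ennreal (norm (snd z) ^ 3) \<partial>Q v (k, 0)) \<le> ennreal M"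
    using moments[OF v, of k] nn_integral_law[OF v(1), of "\<lambda>y. ennreal (norm y ^ 3)" k] by simp
  show I: "integrable (Q v (k, 0)) (\<lambda>z. norm (snd z) ^ 3)"
    using b by (intro integrableI_nonneg) (auto intro: le_less_trans)
  show "(LINT z|Q v (k, 0). norm (snd z) ^ 3) \<le> M"
    using b M by (subst (asm) nn_integral_eq_integral[OF I]) auto
qed

lemma lower_moments:
  assumes v: "v \<in> T" "0 < v" "v \<le> 1" and j: "j \<le> 3"
  shows "integrable (Q v (k, 0)) (\<lambda>z. norm (snd z) ^ j)" "(LINT z|Q v (k, 0). norm (snd z) ^ j) \<le> 1 + M"
proof -
  interpret prob_space "Q v (k, 0)" by (rule Q_prob[OF v(1)])
  note [measurable_cong] = sets_Q[OF v(1)]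
  have le: "norm y ^ j \<le> 1 + norm y ^ 3" for y :: "real^'d"
  proof (cases "norm y \<le> 1")
    case True
    then have "norm y ^ j \<le> 1" by (intro power_le_one) auto
    then show ?thesis by (simp add: add_increasing2)
  next
    case False
    then have "norm y ^ j \<le> norm y ^ 3" using j by (intro power_increasing) auto
    then show ?thesis by simp
  qed
  have J: "integrable (Q v (k, 0)) (\<lambda>z. 1 + norm (snd z) ^ 3)" using third_moment(1)[OF v] by simp
  show I: "integrable (Q v (k, 0)) (\<lambda>z. norm (snd z) ^ j)"
    by (rule Bochner_Integration.integrable_bound[OF J]) (auto intro!: AE_I2 order_trans[OF le])
  have "(LINT z|Q v (k, 0). norm (snd z) ^ j) \<le> (LINT z|Q v (k, 0). 1 + norm (snd z) ^ 3)"
    by (rule integral_mono[OF I J le])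
  also have "\<dots> \<le> 1 + M" using third_moment[OF v, of k] by (simp add: prob_space)
  finally show "(LINT z|Q v (k, 0). norm (snd z) ^ j) \<le> 1 + M" .
qed

lemma sum_indicator_integral:
  fixes f :: "'n \<times> (real^'d) \<Rightarrow> real"
  assumes t: "t \<in> T" and f: "integrable (Q t (k, 0)) f"
  shows "integrable (Q t (k, 0)) (\<lambda>z. indicator {l} (fst z) * f z)"
    and "(\<Sum>l\<in>UNIV. LINT z|Q t (k, 0). indicator {l} (fst z) * f z) = (LINT z|Q t (k, 0). f z)"
proof -
  note [measurable_cong] = sets_Q[OF t]
  have [measurable]: "f \<in> borel_measurable (Q t (k, 0))" using f by simp
  show I: "integrable (Q t (k, 0)) (\<lambda>z. indicator {l} (fst z) * f z)" for l
    by (rule Bochner_Integration.integrable_bound[OF f]) (auto simp: indicator_def)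
  show "(\<Sum>l\<in>UNIV. LINT z|Q t (k, 0). indicator {l} (fst z) * f z) = (LINT z|Q t (k, 0). f z)"
    by (subst Bochner_Integration.integral_sum[symmetric, OF I], intro Bochner_Integration.integral_cong refl)
       (simp add: indicator_def flip: sum_distrib_right)
qed

lemma stochastic_P: "stochastic P"
  using sum_slices[OF T1] unfolding driving[symmetric] stochastic_def driving_semigroup_def by simp

text \<open>Along the unit vector \<xi>, the first and second derivatives of the Fourier matrix at
  frequency zero are i \<open>B1\<close> and -\<open>B2\<close>.\<close>

definition "B1 \<xi> = (\<chi> k l. LINT z|Q 1 (k, 0). indicator {l} (fst z) * (\<xi> \<bullet> snd z))"
definition "B2 \<xi> = (\<chi> k l. LINT z|Q 1 (k, 0). indicator {l} (fst z) * (\<xi> \<bullet> snd z)\<^sup>2)"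

lemma inner_power_integrable:
  assumes \<xi>: "norm \<xi> = 1" and j: "j \<le> 3"
  shows "integrable (Q 1 (k, 0)) (\<lambda>z. (\<xi> \<bullet> snd z) ^ j)" "(LINT z|Q 1 (k, 0). \<bar>\<xi> \<bullet> snd z\<bar> ^ j) \<le> 1 + M"
proof -
  note [measurable_cong] = sets_Q[OF T1]
  have le: "\<bar>\<xi> \<bullet> y\<bar> ^ j \<le> norm y ^ j" for y
    using Cauchy_Schwarz_ineq2[of \<xi> y] \<xi> by (intro power_mono) auto
  note L = lower_moments[OF T1 zero_less_one order_refl j, of k]
  show "integrable (Q 1 (k, 0)) (\<lambda>z. (\<xi> \<bullet> snd z) ^ j)"
    by (rule Bochner_Integration.integrable_bound[OF L(1)]) (auto simp: power_abs intro!: AE_I2 order_trans[OF le])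
  from integrable_abs[OF this] have "(LINT z|Q 1 (k, 0). \<bar>\<xi> \<bullet> snd z\<bar> ^ j) \<le> (LINT z|Q 1 (k, 0). norm (snd z) ^ j)"
    by (intro integral_mono L le) (simp add: power_abs)
  with L(2) show "(LINT z|Q 1 (k, 0). \<bar>\<xi> \<bullet> snd z\<bar> ^ j) \<le> 1 + M" by simp
qed

lemma B_row:
  assumes \<xi>: "norm \<xi> = 1"
  shows "(\<Sum>l\<in>UNIV. \<bar>B1 \<xi> $ k $ l\<bar>) \<le> 1 + M" "(\<Sum>l\<in>UNIV. \<bar>B2 \<xi> $ k $ l\<bar>) \<le> 1 + M"
proof -
  have g: "(\<Sum>l\<in>UNIV. \<bar>LINT z|Q 1 (k, 0). indicator {l} (fst z) * (\<xi> \<bullet> snd z) ^ j\<bar>) \<le> 1 + M" if "j \<le> 3" for j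
  proof -
    have "\<bar>LINT z|Q 1 (k, 0). indicator {l} (fst z) * (\<xi> \<bullet> snd z) ^ j\<bar>
       \<le> (LINT z|Q 1 (k, 0). indicator {l} (fst z) * \<bar>\<xi> \<bullet> snd z\<bar> ^ j)" for l
      using integral_norm_bound[of "Q 1 (k, 0)" "\<lambda>z. indicator {l} (fst z) * (\<xi> \<bullet> snd z) ^ j"]
      by (simp add: abs_mult power_abs)
    then have "(\<Sum>l\<in>UNIV. \<bar>LINT z|Q 1 (k, 0). indicator {l} (fst z) * (\<xi> \<bullet> snd z) ^ j\<bar>)
       \<le> (\<Sum>l\<in>UNIV. LINT z|Q 1 (k, 0). indicator {l} (fst z) * \<bar>\<xi> \<bullet> snd z\<bar> ^ j)" by (rule sum_mono)
    also have "\<dots> = (LINT z|Q 1 (k, 0). \<bar>\<xi> \<bullet> snd z\<bar> ^ j)"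
      using integrable_abs[OF inner_power_integrable(1)[OF \<xi> that]]
      by (intro sum_indicator_integral(2)[OF T1]) (simp add: power_abs)
    finally show ?thesis using inner_power_integrable(2)[OF \<xi> that, of k] by simp
  qed
  show "(\<Sum>l\<in>UNIV. \<bar>B1 \<xi> $ k $ l\<bar>) \<le> 1 + M" "(\<Sum>l\<in>UNIV. \<bar>B2 \<xi> $ k $ l\<bar>) \<le> 1 + M"
    using g[of 1] g[of 2] by (auto simp: B1_def B2_def)
qed

text \<open>The remainder is estimated under the integral before summing over \<open>l\<close>: the
  indicators of the states add up to one, so the row sum costs one third absolute moment and no
  factor for the number of states.\<close>

lemma \<Phi>_taylor:
  assumes \<xi>: "norm \<xi> = 1" and t: "0 \<le> t"
  shows "(\<Sum>l\<in>UNIV. cmod (\<Phi> 1 (t *\<^sub>R \<xi>) $ k $ l - (complex_of_real (P $ k $ l)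
          + \<i> * t * B1 \<xi> $ k $ l - t\<^sup>2 / 2 * B2 \<xi> $ k $ l))) \<le> (1 + M) * t ^ 3"
proof -
  note [measurable_cong] = sets_Q[OF T1]
  note ip = inner_power_integrable[OF \<xi>]
  let ?ind = "\<lambda>l z. indicator {l} (fst z) :: real"
  have ib: "integrable (Q 1 (k, 0)) (\<lambda>z. ?ind l z * (\<xi> \<bullet> snd z) ^ j)" if "j \<le> 3" for j l
    using ip(1)[OF that] by (rule sum_indicator_integral(1)[OF T1])
  have i3: "integrable (Q 1 (k, 0)) (\<lambda>z. t ^ 3 * \<bar>\<xi> \<bullet> snd z\<bar> ^ 3)"
    using integrable_abs[OF ip(1)[of 3]] by (simp add: power_abs)
  have e: "cmod (\<Phi> 1 (t *\<^sub>R \<xi>) $ k $ l - (complex_of_real (P $ k $ l) + \<i> * t * B1 \<xi> $ k $ l - t\<^sup>2 / 2 * B2 \<xi> $ k $ l))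
     \<le> (LINT z|Q 1 (k, 0). ?ind l z * (t ^ 3 * \<bar>\<xi> \<bullet> snd z\<bar> ^ 3))" for l
  proof -
    let ?c = "\<lambda>j z. complex_of_real (?ind l z * (\<xi> \<bullet> snd z) ^ j)"
    have ic: "integrable (Q 1 (k, 0)) (?c j)" if "j \<le> 3" for j
      using ib[OF that] by (rule integrable_of_real)
    have iP: "integrable (Q 1 (k, 0)) (\<lambda>z. indicator {l} (fst z) * cis ((t *\<^sub>R \<xi>) \<bullet> snd z))"
      by (rule bounded_integrable[OF T1, of _ 1]) (auto simp: norm_mult indicator_def)
    have P: "complex_of_real (P $ k $ l) = (LINT z|Q 1 (k, 0). ?c 0 z)"
    proof -
      have "(LINT z|Q 1 (k, 0). ?c 0 z) = \<Phi> 1 0 $ k $ l"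
        unfolding \<Phi>_def vec_lambda_beta by (intro Bochner_Integration.integral_cong) (auto simp: indicator_def)
      then show ?thesis using \<Phi>_at_0[OF T1, of k l] by (simp add: driving[symmetric] driving_semigroup_def)
    qed
    have B1: "complex_of_real (B1 \<xi> $ k $ l) = (LINT z|Q 1 (k, 0). ?c 1 z)"
      unfolding integral_complex_of_real by (simp add: B1_def)
    have B2: "complex_of_real (B2 \<xi> $ k $ l) = (LINT z|Q 1 (k, 0). ?c 2 z)"
      unfolding integral_complex_of_real by (simp add: B2_def)
    define F where "F z = indicator {l} (fst z) * cis ((t *\<^sub>R \<xi>) \<bullet> snd z) - (?c 0 z + (\<i> * t) * ?c 1 z - complex_of_real (t\<^sup>2 / 2) * ?c 2 z)" for z
    have iF: "integrable (Q 1 (k, 0)) F" unfolding F_def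
      by (intro Bochner_Integration.integrable_diff Bochner_Integration.integrable_add integrable_mult_right ic iP) auto
    have "(LINT z|Q 1 (k, 0). F z) = (LINT z|Q 1 (k, 0). indicator {l} (fst z) * cis ((t *\<^sub>R \<xi>) \<bullet> snd z))
       - ((LINT z|Q 1 (k, 0). ?c 0 z) + (\<i> * t) * (LINT z|Q 1 (k, 0). ?c 1 z) - complex_of_real (t\<^sup>2 / 2) * (LINT z|Q 1 (k, 0). ?c 2 z))"
    proof -
      have a0: "has_bochner_integral (Q 1 (k, 0)) (?c j) (LINT z|Q 1 (k, 0). ?c j z)" if "j \<le> 3" for j
        by (rule has_bochner_integral_integrable[OF ic[OF that]])
      have a1: "has_bochner_integral (Q 1 (k, 0)) (\<lambda>z. indicator {l} (fst z) * cis ((t *\<^sub>R \<xi>) \<bullet> snd z))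
          (LINT z|Q 1 (k, 0). indicator {l} (fst z) * cis ((t *\<^sub>R \<xi>) \<bullet> snd z))"
        by (rule has_bochner_integral_integrable[OF iP])
      show ?thesis unfolding F_def
        by (intro has_bochner_integral_integral_eq has_bochner_integral_diff has_bochner_integral_add
              has_bochner_integral_mult_right a0 a1) auto
    qed
    then have eq: "\<Phi> 1 (t *\<^sub>R \<xi>) $ k $ l - (complex_of_real (P $ k $ l) + \<i> * t * B1 \<xi> $ k $ l - t\<^sup>2 / 2 * B2 \<xi> $ k $ l)
       = (LINT z|Q 1 (k, 0). F z)"
      by (simp add: P B1 B2 \<Phi>_def)
    have le: "cmod (F z) \<le> ?ind l z * (t ^ 3 * \<bar>\<xi> \<bullet> snd z\<bar> ^ 3)" for z
      using iexp_taylor2[of "t * (\<xi> \<bullet> snd z)"] t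
      by (auto simp: F_def indicator_def power_mult_distrib abs_mult mult.assoc)
    show ?thesis unfolding eq
      by (rule order_trans[OF integral_norm_bound integral_mono[OF integrable_norm[OF iF] sum_indicator_integral(1)[OF T1 i3] le]])
  qed
  have "(\<Sum>l\<in>UNIV. cmod (\<Phi> 1 (t *\<^sub>R \<xi>) $ k $ l - (complex_of_real (P $ k $ l) + \<i> * t * B1 \<xi> $ k $ l - t\<^sup>2 / 2 * B2 \<xi> $ k $ l)))
     \<le> (\<Sum>l\<in>UNIV. LINT z|Q 1 (k, 0). ?ind l z * (t ^ 3 * \<bar>\<xi> \<bullet> snd z\<bar> ^ 3))" by (intro sum_mono e)
  also have "\<dots> = (LINT z|Q 1 (k, 0). t ^ 3 * \<bar>\<xi> \<bullet> snd z\<bar> ^ 3)" by (rule sum_indicator_integral(2)[OF T1 i3])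
  also have "\<dots> = t ^ 3 * (LINT z|Q 1 (k, 0). \<bar>\<xi> \<bullet> snd z\<bar> ^ 3)" by simp
  also have "\<dots> \<le> t ^ 3 * (1 + M)" using t by (intro mult_left_mono ip(2)) auto
  finally show ?thesis by (simp add: mult.commute)
qed

text \<open>The condition \<open>center\<close> of the chain is the inner product of \<xi> with the
  stationary mean of Y_1, which vanishes because the process is centered.\<close>

lemma perturbed:
  assumes \<xi>: "norm \<xi> = 1"
  shows "\<exists>p. perturbed_chain P p m \<theta> (1 + M) (B1 \<xi>) (B2 \<xi>) (\<lambda>t. \<Phi> 1 (t *\<^sub>R \<xi>))"
proof -
  obtain p where p: "invariant_prob P p" and c: "(\<Sum>k\<in>UNIV. (p $ k) *\<^sub>R (LINT \<omega>|Pr k. Y 1 \<omega>)) = 0"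
    and Y1: "\<And>k. integrable (Pr k) (Y 1)"
    using centered by (auto simp: centered_MAP_def)
  note [measurable] = X_meas[OF T1] Y_meas[OF T1]
  have "(B1 \<xi> *v 1) $ k = \<xi> \<bullet> (LINT \<omega>|Pr k. Y 1 \<omega>)" for k
  proof -
    have "(B1 \<xi> *v 1) $ k = (LINT z|Q 1 (k, 0). \<xi> \<bullet> snd z)"
      using sum_indicator_integral(2)[OF T1, of k "\<lambda>z. \<xi> \<bullet> snd z"] inner_power_integrable(1)[OF \<xi>, of 1]
      by (simp add: B1_def matrix_vector_mult_def)
    also have "\<dots> = (LINT \<omega>|Pr k. \<xi> \<bullet> Y 1 \<omega>)"
      unfolding law_eq[OF T1, symmetric] by (subst integral_distr) auto
    finally show ?thesis using Y1 by simp
  qed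
  then have "p \<bullet> (B1 \<xi> *v 1) = (\<Sum>k\<in>UNIV. p $ k * (\<xi> \<bullet> (LINT \<omega>|Pr k. Y 1 \<omega>)))"
    by (simp add: inner_vec_def[of p])
  also have "\<dots> = \<xi> \<bullet> (\<Sum>k\<in>UNIV. (p $ k) *\<^sub>R (LINT \<omega>|Pr k. Y 1 \<omega>))" by (simp add: inner_sum_right)
  finally have "p \<bullet> (B1 \<xi> *v 1) = 0" using c by simp
  then have "perturbed_chain P p m \<theta> (1 + M) (B1 \<xi>) (B2 \<xi>) (\<lambda>t. \<Phi> 1 (t *\<^sub>R \<xi>))"
    using stochastic_P p minor \<theta> m M B_row[OF \<xi>] \<Phi>_row[OF T1] \<Phi>_taylor[OF \<xi>] by unfold_locales auto
  then show ?thesis ..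
qed

end

text \<open>With s = sqrt t * r the left side is t^(-1/2) (s + s^3) exp(-c s^2), and half of the
  exponent absorbs the polynomial. This is where the rate t^(-1/2) appears; the other half of the
  exponent stays available for the integration over the frequencies.\<close>

lemma gaussian_cubic_bound:
  fixes c t r :: real
  assumes "0 < c" "0 < t" "0 \<le> r"
  shows "(r + t * r ^ 3) * exp (- c * t * r\<^sup>2)
    \<le> ((2 * c) powr (- 1 / 2) + (2 * c / 3) powr (- 3 / 2)) * t powr (- 1 / 2) * exp (- (c / 2) * t * r\<^sup>2)"
proof -
  define s where "s = sqrt t * r"
  have s0: "0 \<le> s" using assms by (simp add: s_def)
  have s2: "s\<^sup>2 = t * r\<^sup>2" using assms by (simp add: s_def power_mult_distrib)
  have 1: "s \<le> (2 * c) powr (- 1 / 2) * exp (c / 2 * s\<^sup>2)"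
  proof -
    have "sqrt (2 * c) * s \<le> exp ((sqrt (2 * c) * s)\<^sup>2 / 4)" by (rule le_exp_sq)
    also have "(sqrt (2 * c) * s)\<^sup>2 / 4 = c / 2 * s\<^sup>2" using assms by (simp add: power_mult_distrib)
    finally have "s \<le> (1 / sqrt (2 * c)) * exp (c / 2 * s\<^sup>2)" using assms by (simp add: field_simps)
    also have "1 / sqrt (2 * c) = (2 * c) powr (- 1 / 2)" using assms by (simp add: powr_minus_divide powr_half_sqrt)
    finally show ?thesis .
  qed
  have 2: "s ^ 3 \<le> (2 * c / 3) powr (- 3 / 2) * exp (c / 2 * s\<^sup>2)"
  proof -
    \<comment> \<open>This scaling makes the cube of the bound \<open>le_exp_sq\<close> spend
      exactly half of the exponent.\<close>
    define b where "b = sqrt (2 * c / 3)"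
    have b: "0 < b" using assms by (simp add: b_def)
    have "(b * s) ^ 3 \<le> exp ((b * s)\<^sup>2 / 4) ^ 3" using b s0 by (intro power_mono le_exp_sq) auto
    also have "\<dots> = exp (3 * ((b * s)\<^sup>2 / 4))" by (simp flip: exp_of_nat_mult)
    also have "3 * ((b * s)\<^sup>2 / 4) = c / 2 * s\<^sup>2" using assms by (simp add: power_mult_distrib b_def)
    finally have "s ^ 3 \<le> (1 / b ^ 3) * exp (c / 2 * s\<^sup>2)" using b by (simp add: field_simps power_mult_distrib)
    also have "1 / b ^ 3 = (2 * c / 3) powr (- 3 / 2)"
    proof -
      have "b ^ 3 = b powr 3" using b by simp
      also have "\<dots> = (2 * c / 3) powr (3 / 2)" using assms by (simp add: b_def powr_half_sqrt[symmetric] powr_powr)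
      finally show ?thesis by (simp add: powr_minus_divide)
    qed
    finally show ?thesis .
  qed
  have "(r + t * r ^ 3) = t powr (- 1 / 2) * (s + s ^ 3)"
  proof -
    have "t powr (- 1 / 2) * sqrt t = 1" using assms by (simp add: powr_minus_divide powr_half_sqrt)
    moreover have "s ^ 3 = sqrt t * (t * r ^ 3)" using assms by (simp add: s_def power_mult_distrib power3_eq_cube)
    then have "s + s ^ 3 = sqrt t * (r + t * r ^ 3)" by (simp add: s_def distrib_left)
    ultimately show ?thesis by (simp add: mult.assoc[symmetric])
  qed
  then have "(r + t * r ^ 3) * exp (- c * t * r\<^sup>2) = t powr (- 1 / 2) * ((s + s ^ 3) * exp (- c * s\<^sup>2))"
    by (simp add: s2 mult.assoc)
  also have "\<dots> \<le> t powr (- 1 / 2) * ((((2 * c) powr (- 1 / 2) + (2 * c / 3) powr (- 3 / 2)) * exp (c / 2 * s\<^sup>2)) * exp (- c * s\<^sup>2))"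
    using 1 2 by (intro mult_left_mono mult_right_mono) (auto simp: distrib_right)
  also have "\<dots> = ((2 * c) powr (- 1 / 2) + (2 * c / 3) powr (- 3 / 2)) * t powr (- 1 / 2) * (exp (c / 2 * s\<^sup>2) * exp (- c * s\<^sup>2))"
    by (simp only: mult_ac)
  also have "exp (c / 2 * s\<^sup>2) * exp (- c * s\<^sup>2) = exp (- (c / 2) * t * r\<^sup>2)"
    by (simp add: s2 flip: exp_add)
  finally show ?thesis .
qed

section \<open>Small frequencies\<close>

context ergodic_map begin

lemma \<Phi>_one_law: "t \<in> T \<Longrightarrow> (\<Phi> t \<zeta> *v 1) $ k = (LINT \<omega>|Pr k. cis (\<zeta> \<bullet> Y t \<omega>))"
proof -
  assume t: "t \<in> T"
  note [measurable] = X_meas[OF t] Y_meas[OF t]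
  show ?thesis unfolding \<Phi>_one[OF t] law_eq[OF t, symmetric]
    by (subst integral_distr) auto
qed

text \<open>Weak convergence is used along the integers and tested with cos and sin, the real and
  imaginary parts of the bounded continuous function cis.\<close>

lemma clt_limit:
  "(\<lambda>n. (\<Phi> (real n) ((1 / sqrt (real n)) *\<^sub>R \<xi>) *v 1) $ k) \<longlonglongrightarrow> complex_of_real (exp (- (\<xi> \<bullet> (S *v \<xi>)) / 2))"
proof -
  obtain \<nu> where g: "centered_gaussian S \<nu>"
    and w: "\<And>k. converges_weakly (\<lambda>t. distr (Pr k) borel (\<lambda>\<omega>. t powr (- 1 / 2) *\<^sub>R Y t \<omega>)) \<nu> (at_top_along T)"
    using cov by (auto simp: asymptotic_covariance_def)
  interpret N: prob_space \<nu> using g by (simp add: centered_gaussian_def)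
  have [measurable_cong]: "sets \<nu> = sets borel" using g by (simp add: centered_gaussian_def)
  have f: "filterlim real (at_top_along T) sequentially"
    unfolding filterlim_inf filterlim_principal using filterlim_real_sequentially T(3) by auto
  have lim: "(\<lambda>n. LINT \<omega>|Pr k. h ((1 / sqrt (real n)) *\<^sub>R Y (real n) \<omega>)) \<longlonglongrightarrow> (LINT y|\<nu>. h y)"
    if h: "continuous_on UNIV h" "bounded (range h)" for h :: "real^'d \<Rightarrow> real"
  proof -
    have [measurable]: "h \<in> borel_measurable borel" by (rule borel_measurable_continuous_onI[OF h(1)])
    have "(\<lambda>n. LINT y|distr (Pr k) borel (\<lambda>\<omega>. real n powr (- 1 / 2) *\<^sub>R Y (real n) \<omega>). h y) \<longlonglongrightarrow> (LINT y|\<nu>. h y)"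
      using w[of k] h unfolding converges_weakly_def by (intro filterlim_compose[OF _ f]) blast
    moreover have "(LINT y|distr (Pr k) borel (\<lambda>\<omega>. real n powr (- 1 / 2) *\<^sub>R Y (real n) \<omega>). h y)
        = (LINT \<omega>|Pr k. h ((1 / sqrt (real n)) *\<^sub>R Y (real n) \<omega>))" for n
    proof -
      note [measurable] = Y_meas[OF T(3), of n k]
      have "real n powr (- 1 / 2) = 1 / sqrt (real n)"
        by (cases "n = 0") (simp_all add: powr_minus_divide powr_half_sqrt)
      then show ?thesis by (subst integral_distr) simp_all
    qed
    ultimately show ?thesis by simp
  qed
  have c: "(\<lambda>n. LINT \<omega>|Pr k. cos (\<xi> \<bullet> ((1 / sqrt (real n)) *\<^sub>R Y (real n) \<omega>))) \<longlonglongrightarrow> (LINT y|\<nu>. cos (\<xi> \<bullet> y))"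
    by (rule lim) (auto intro!: continuous_intros boundedI[of _ 1])
  have s: "(\<lambda>n. LINT \<omega>|Pr k. sin (\<xi> \<bullet> ((1 / sqrt (real n)) *\<^sub>R Y (real n) \<omega>))) \<longlonglongrightarrow> (LINT y|\<nu>. sin (\<xi> \<bullet> y))"
    by (rule lim) (auto intro!: continuous_intros boundedI[of _ 1])
  have ci: "(LINT x|N. cis (f x)) = Complex (LINT x|N. cos (f x)) (LINT x|N. sin (f x))"
    if "prob_space N" and [measurable]: "f \<in> borel_measurable N" for N :: "'c measure" and f
  proof -
    interpret prob_space N by fact
    have I: "integrable N (\<lambda>x. cis (f x))" by (rule integrable_const_bound[of _ 1]) auto
    show ?thesis using integral_Re[OF I] integral_Im[OF I] by (intro complex_eqI) simp_all
  qed
  have "(\<Phi> (real n) ((1 / sqrt (real n)) *\<^sub>R \<xi>) *v 1) $ k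
      = Complex (LINT \<omega>|Pr k. cos (\<xi> \<bullet> ((1 / sqrt (real n)) *\<^sub>R Y (real n) \<omega>))) (LINT \<omega>|Pr k. sin (\<xi> \<bullet> ((1 / sqrt (real n)) *\<^sub>R Y (real n) \<omega>)))" for n
  proof -
    note [measurable] = Y_meas[OF T(3), of n k]
    show ?thesis
      unfolding \<Phi>_one_law[OF T(3)] inner_scaleR_left inner_scaleR_right
      by (rule ci[OF Pr_prob]) measurable
  qed
  moreover have "complex_of_real (exp (- (\<xi> \<bullet> (S *v \<xi>)) / 2)) = Complex (LINT y|\<nu>. cos (\<xi> \<bullet> y)) (LINT y|\<nu>. sin (\<xi> \<bullet> y))"
    using g ci[OF N.prob_space_axioms, of "\<lambda>y. \<xi> \<bullet> y"] by (simp add: centered_gaussian_def)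
  ultimately show ?thesis using tendsto_Complex[OF c s] by simp
qed

text \<open>At frequency \<xi> / sqrt n, the same sequence tends to exp(-h) by iterating the matrix
  and to exp(-<\<xi>, S \<xi>>/2) by the central limit theorem.\<close>

lemma corrector_variance:
  assumes "perturbed_chain P p m \<theta> (1 + M) (B1 \<xi>) (B2 \<xi>) (\<lambda>t. \<Phi> 1 (t *\<^sub>R \<xi>))"
    and "perturbed_chain.corrector P p m \<theta> (1 + M) (B1 \<xi>) (B2 \<xi>) u w h"
  shows "h = (\<xi> \<bullet> (S *v \<xi>)) / 2"
proof -
  interpret C: perturbed_chain P p m \<theta> "1 + M" "B1 \<xi>" "B2 \<xi>" "\<lambda>t. \<Phi> 1 (t *\<^sub>R \<xi>)" by fact
  have "C.Apow t n 1 = \<Phi> (real n) (t *\<^sub>R \<xi>) *v 1" for t n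
    by (simp add: C.Apow_def \<Phi>_pow)
  with C.Apow_clt[OF assms(2), of undefined] clt_limit[of \<xi> undefined]
  have "complex_of_real (exp (- h)) = complex_of_real (exp (- (\<xi> \<bullet> (S *v \<xi>)) / 2))"
    by (intro LIMSEQ_unique) auto
  then have "exp (- h) = exp (- (\<xi> \<bullet> (S *v \<xi>)) / 2)" by (simp only: of_real_eq_iff)
  then show ?thesis by simp
qed

text \<open>Serves the fractional part of a real time, which moves the constant vector by a multiple
  of the frequency only.\<close>

lemma \<Phi>_one_lipschitz:
  assumes v: "v \<in> T" "0 < v" "v \<le> 1"
  shows "cmod ((\<Phi> v \<zeta> *v 1) $ k - 1) \<le> (1 + M) * norm \<zeta>"
proof -
  interpret prob_space "Q v (k, 0)" by (rule Q_prob[OF v(1)])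
  have i: "integrable (Q v (k, 0)) (\<lambda>z. cis (\<zeta> \<bullet> snd z))"
    by (rule bounded_integrable[OF v(1), of _ 1]) auto
  note L = lower_moments[OF v, of 1 k, simplified]
  have "(\<Phi> v \<zeta> *v 1) $ k - 1 = (LINT z|Q v (k, 0). cis (\<zeta> \<bullet> snd z) - 1)"
    unfolding \<Phi>_one[OF v(1)] using i by (subst Bochner_Integration.integral_diff) (auto simp: prob_space)
  also have "cmod \<dots> \<le> (LINT z|Q v (k, 0). norm \<zeta> * norm (snd z))"
  proof (rule order_trans[OF integral_norm_bound integral_mono])
    fix z :: "'n \<times> (real^'d)"
    have "cmod (cis (\<zeta> \<bullet> snd z) - 1) \<le> \<bar>\<zeta> \<bullet> snd z\<bar>"
      using iexp_approx1[of "\<zeta> \<bullet> snd z" 0] by (simp add: cis_conv_exp)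
    also have "\<dots> \<le> norm \<zeta> * norm (snd z)" by (rule Cauchy_Schwarz_ineq2)
    finally show "cmod (cis (\<zeta> \<bullet> snd z) - 1) \<le> norm \<zeta> * norm (snd z)" .
  qed (use i L in auto)
  also have "\<dots> \<le> norm \<zeta> * (1 + M)" using L by (simp add: mult_left_mono)
  finally show ?thesis by (simp add: mult.commute)
qed

text \<open>The perturbed chain is taken along the ray through \<zeta>, with r = |\<zeta>| as
  parameter, and covers the integer part of \<open>t\<close>. The fractional part moves the constant
  vector by at most K r, and replacing the integer time by \<open>t\<close> in the Gaussian costs at
  most H r; both are absorbed by the linear error. The factor exp 1 replaces the integer time by
  \<open>t\<close> in the decay.\<close>

lemma small_frequency:
  fixes \<alpha> t :: real
  defines "a \<equiv> \<alpha> / 2" and "K \<equiv> 1 + M"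
  assumes \<alpha>: "0 < \<alpha>" "\<And>\<zeta>. \<alpha> * (norm \<zeta>)\<^sup>2 \<le> \<zeta> \<bullet> (S *v \<zeta>)"
    and z: "norm \<zeta> \<le> perturbed_chain.\<delta> m \<theta> K a" and t: "t \<in> T"
  shows "cmod ((\<Phi> t \<zeta> *v 1) $ k - complex_of_real (exp (- t * (\<zeta> \<bullet> (S *v \<zeta>)) / 2)))
     \<le> (perturbed_chain.C1 m \<theta> K + K + perturbed_chain.H m \<theta> K) * exp 1
        * ((norm \<zeta> + t * norm \<zeta> ^ 3) * exp (- (a / (2 * real m)) * t * (norm \<zeta>)\<^sup>2))"
proof (cases "\<zeta> = 0")
  case True
  interpret prob_space "Q t (k, 0)" by (rule Q_prob[OF t])
  show ?thesis using True \<Phi>_one[OF t, of 0 k] by (simp add: prob_space)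
next
  case False
  define r where "r = norm \<zeta>"
  define \<xi> where "\<xi> = (1 / r) *\<^sub>R \<zeta>"
  have r0: "0 < r" using False by (simp add: r_def)
  have \<xi>: "norm \<xi> = 1" using r0 by (simp add: \<xi>_def r_def)
  have z\<xi>: "\<zeta> = r *\<^sub>R \<xi>" using r0 by (simp add: \<xi>_def)
  obtain p where pc: "perturbed_chain P p m \<theta> K (B1 \<xi>) (B2 \<xi>) (\<lambda>t. \<Phi> 1 (t *\<^sub>R \<xi>))"
    using perturbed[OF \<xi>] by (auto simp: K_def)
  interpret C: perturbed_chain P p m \<theta> K "B1 \<xi>" "B2 \<xi>" "\<lambda>t. \<Phi> 1 (t *\<^sub>R \<xi>)" by (rule pc)
  obtain u w h where cor: "C.corrector u w h" using C.corrector_exists by blast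
  have h: "h = (\<xi> \<bullet> (S *v \<xi>)) / 2"
    using corrector_variance[of p \<xi> u w h] pc cor by (simp add: K_def)
  have hr: "h * r\<^sup>2 = (\<zeta> \<bullet> (S *v \<zeta>)) / 2"
    unfolding h z\<xi> by (simp add: matrix_vector_mult_scaleR power2_eq_square)
  have ah: "0 < a" "a \<le> h" using \<alpha>(1) \<alpha>(2)[of \<xi>] \<xi> by (auto simp: a_def h)
  have rd: "0 \<le> r" "r \<le> C.\<delta> a" using z r0 by (auto simp: r_def)
  note small = C.t_small[OF cor ah rd]
  have H: "\<bar>h\<bar> \<le> C.H" using cor by (simp add: C.corrector_def)
  define n where "n = nat \<lfloor>t\<rfloor>"
  define v where "v = t - real n"
  have t0: "0 \<le> t" using T(4)[OF t] .
  have v: "v \<in> T" "0 \<le> v" "v < 1" "t = v + real n"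
  proof -
    show "v \<in> T" unfolding v_def n_def by (rule T(5)[OF t])
    have "real n \<le> t" "t < real n + 1" using t0 by (auto simp: n_def)
    then show "0 \<le> v" "v < 1" "t = v + real n" by (auto simp: v_def)
  qed
  define c where "c = a / (2 * real m) * r\<^sup>2"
  have c0: "0 \<le> c" using ah by (simp add: c_def)
  have ca: "c \<le> a * r\<^sup>2"
  proof -
    have "c = a * r\<^sup>2 * (1 / (2 * real m))" by (simp add: c_def)
    also have "\<dots> \<le> a * r\<^sup>2 * 1" using m ah by (intro mult_left_mono) auto
    finally show ?thesis by simp
  qed
  have c1: "c \<le> 1" using ca small(6) \<theta> by simp
  have ch: "c \<le> h * r\<^sup>2" using ca mult_right_mono[OF ah(2), of "r\<^sup>2"] by simp
  define L where "L = exp (- real n * (h * r\<^sup>2))"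
  have Le: "L \<le> exp (- c * real n)" using mult_right_mono[OF ch, of "real n"] by (simp add: L_def mult.commute)
  have L0: "0 \<le> L" by (simp add: L_def)
  define y where "y = \<Phi> (real n) \<zeta> *v 1 - complex_of_real L *s 1"
  have y: "vec_sup_norm y \<le> C.C1 * (r + real n * r ^ 3) * exp (- c * real n)"
  proof -
    have "y = C.Apow r n 1 - complex_of_real (exp (- real n * (h * r\<^sup>2))) *s 1"
      unfolding y_def L_def C.Apow_def z\<xi> \<Phi>_pow ..
    then show ?thesis using C.Apow_expansion[OF cor ah rd, of n] by (simp add: c_def mult_ac)
  qed
  have C1: "0 \<le> C.C1" using C.const_nonneg by (simp add: C.C1_def C.Ca_def)
  have "\<Phi> t \<zeta> *v 1 = \<Phi> v \<zeta> *v y + complex_of_real L *s (\<Phi> v \<zeta> *v 1)"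
  proof -
    have "\<Phi> t \<zeta> *v 1 = \<Phi> v \<zeta> *v (\<Phi> (real n) \<zeta> *v 1)"
      unfolding v(4) \<Phi>_add[OF v(1) T(3)] by (simp add: matrix_vector_mul_assoc)
    also have "\<Phi> (real n) \<zeta> *v 1 = y + complex_of_real L *s 1" by (simp add: y_def)
    finally show ?thesis by (simp add: matrix_vector_right_distrib vector_scalar_commute)
  qed
  then have "(\<Phi> t \<zeta> *v 1) $ k - complex_of_real (exp (- t * (h * r\<^sup>2)))
     = (\<Phi> v \<zeta> *v y) $ k + (complex_of_real L * ((\<Phi> v \<zeta> *v 1) $ k - 1) + complex_of_real (L - exp (- t * (h * r\<^sup>2))))"
    by (simp add: algebra_simps)
  also have "cmod \<dots> \<le> cmod ((\<Phi> v \<zeta> *v y) $ k) + (cmod (complex_of_real L * ((\<Phi> v \<zeta> *v 1) $ k - 1)) + cmod (complex_of_real (L - exp (- t * (h * r\<^sup>2)))))"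
    by (intro order_trans[OF norm_triangle_ineq] add_mono order_refl)
  also have "\<dots> \<le> C.C1 * (r + real n * r ^ 3) * exp (- c * real n) + (exp (- c * real n) * (K * r) + exp (- c * real n) * (C.H * r))"
  proof (intro add_mono)
    have "cmod ((\<Phi> v \<zeta> *v y) $ k) \<le> 1 * vec_sup_norm y"
      by (rule order_trans[OF vec_sup_norm_ge vec_sup_norm_mult_vec[OF \<Phi>_row[OF v(1)]]])
    with y show "cmod ((\<Phi> v \<zeta> *v y) $ k) \<le> C.C1 * (r + real n * r ^ 3) * exp (- c * real n)" by simp
    have "cmod ((\<Phi> v \<zeta> *v 1) $ k - 1) \<le> K * r"
    proof (cases "v = 0")
      case True
      then show ?thesis using r0 M by (simp add: \<Phi>_0 K_def)
    next
      case False
      then show ?thesis using \<Phi>_one_lipschitz[of v \<zeta> k] v by (simp add: K_def r_def)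
    qed
    then show "cmod (complex_of_real L * ((\<Phi> v \<zeta> *v 1) $ k - 1)) \<le> exp (- c * real n) * (K * r)"
      unfolding norm_mult using Le L0 by (intro mult_mono) auto
    define q where "q = exp (- v * (h * r\<^sup>2))"
    have eq: "exp (- t * (h * r\<^sup>2)) = L * q"
      by (simp add: L_def q_def v(4) algebra_simps flip: exp_add)
    have hn: "0 \<le> h * r\<^sup>2" using c0 ch by simp
    have q1: "q \<le> 1" unfolding q_def using mult_nonneg_nonneg[OF v(2) hn] by simp
    have qH: "1 - q \<le> C.H * r"
    proof -
      have "1 - q \<le> v * (h * r\<^sup>2)" unfolding q_def using exp_ge_add_one_self[of "- v * (h * r\<^sup>2)"] by simp
      also have "\<dots> \<le> 1 * (h * r\<^sup>2)" using v hn by (intro mult_right_mono) auto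
      also have "\<dots> = (h * r) * r" by (simp add: power2_eq_square)
      also have "\<dots> \<le> (C.H * 1) * r"
        using H ah rd(1) small(1) C.const_nonneg by (intro mult_right_mono mult_mono) auto
      finally show ?thesis by simp
    qed
    have "\<bar>L - L * q\<bar> = L * (1 - q)" using L0 q1 by (simp add: right_diff_distrib mult_left_le)
    then show "cmod (complex_of_real (L - exp (- t * (h * r\<^sup>2)))) \<le> exp (- c * real n) * (C.H * r)"
      unfolding norm_of_real eq using Le L0 q1 qH by (simp only:) (intro mult_mono, auto)
  qed
  also have "\<dots> = (C.C1 * (r + real n * r ^ 3) + K * r + C.H * r) * exp (- c * real n)" by (simp add: algebra_simps)
  also have "\<dots> \<le> ((C.C1 + K + C.H) * (r + t * r ^ 3)) * (exp 1 * exp (- c * t))"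
  proof (intro mult_mono)
    have "real n * r ^ 3 \<le> t * r ^ 3" using v r0 by (intro mult_right_mono) auto
    then have "C.C1 * (r + real n * r ^ 3) \<le> C.C1 * (r + t * r ^ 3)" using C1 by (intro mult_left_mono) auto
    moreover have "K * r \<le> K * (r + t * r ^ 3)" "C.H * r \<le> C.H * (r + t * r ^ 3)"
      using C.const_nonneg C.K t0 r0 by (auto intro!: mult_left_mono)
    ultimately show "C.C1 * (r + real n * r ^ 3) + K * r + C.H * r \<le> (C.C1 + K + C.H) * (r + t * r ^ 3)"
      by (simp add: distrib_right)
    have "c * t \<le> c * real n + 1"
    proof -
      have "c * v \<le> 1 * 1" using c0 c1 v by (intro mult_mono) auto
      then show ?thesis by (simp add: v(4) distrib_left)
    qed
    then show "exp (- c * real n) \<le> exp 1 * exp (- c * t)" by (simp flip: exp_add)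
    show "0 \<le> (C.C1 + K + C.H) * (r + t * r ^ 3)"
      using C1 C.const_nonneg C.K t0 r0 by (intro mult_nonneg_nonneg add_nonneg_nonneg) auto
  qed auto
  finally show ?thesis
    by (simp add: hr c_def r_def[symmetric] mult_ac)
qed

end

section \<open>From characteristic functions to densities\<close>

lemma gaussian_density_scale:
  fixes S :: "real^'d^'d"
  assumes S: "posdef S" and t: "0 < t"
  shows "gaussian_density (t *\<^sub>R S) y = t powr (- real CARD('d) / 2) * gaussian_density S (t powr (- 1 / 2) *\<^sub>R y)"
proof -
  obtain W where "det W \<noteq> 0" and W: "transpose W ** S ** W = mat 1"
    using posdef_orthonormalize[OF S] by blast
  have WW: "S ** (W ** transpose W) = mat 1"
    using W by (metis matrix_left_right_inverse matrix_mul_assoc)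
  then have inv: "matrix_inv S = W ** transpose W" by (rule matrix_inv_eqI)
  have "(t *\<^sub>R S) ** ((1 / t) *\<^sub>R V) = S ** V" for V :: "real^'d^'d"
    using t by (simp add: vec_eq_iff matrix_matrix_mult_def)
  then have "(t *\<^sub>R S) ** ((1 / t) *\<^sub>R (W ** transpose W)) = mat 1" using WW by simp
  then have inv': "matrix_inv (t *\<^sub>R S) = (1 / t) *\<^sub>R matrix_inv S" unfolding inv by (rule matrix_inv_eqI)
  have d: "det (t *\<^sub>R S) = t ^ CARD('d) * det S"
  proof -
    have "t *\<^sub>R S = (\<chi> i. t *s row i S)" by (simp add: vec_eq_iff row_def)
    then show ?thesis by (simp add: det_rows_mul row_def)
  qed
  have s: "sqrt (t ^ CARD('d)) = t powr (real CARD('d) / 2)"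
    using t by (simp add: powr_half_sqrt[symmetric] powr_realpow[symmetric] powr_powr)
  have q: "y \<bullet> (((1 / t) *\<^sub>R matrix_inv S) *v y) = (t powr (- 1 / 2) *\<^sub>R y) \<bullet> (matrix_inv S *v (t powr (- 1 / 2) *\<^sub>R y))"
  proof -
    have "t powr (- 1 / 2) * t powr (- 1 / 2) = 1 / t"
      using t by (simp add: powr_add[symmetric] powr_minus_divide)
    then show ?thesis
      by (simp add: matrix_vector_mult_scaleR scaleR_matrix_vector_assoc[symmetric] mult.assoc[symmetric])
  qed
  show ?thesis unfolding gaussian_density_def inv' d q
    using t by (simp add: real_sqrt_mult s powr_minus_divide)
qed

lemma gaussian_density_nonneg: "0 \<le> det S \<Longrightarrow> 0 \<le> gaussian_density S y"
  by (simp add: gaussian_density_def)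

lemma posdef_det_pos:
  assumes "posdef S"
  shows "0 < det S"
proof -
  obtain W where W: "det W \<noteq> 0" "transpose W ** S ** W = mat 1" using posdef_orthonormalize[OF assms] by blast
  then have "det (transpose W ** S ** W) = 1" by simp
  then have "det S * (det W)\<^sup>2 = 1" by (simp add: det_mul power2_eq_square mult_ac)
  then show ?thesis using W(1) by (metis zero_less_mult_pos2 zero_less_one zero_less_power2)
qed

text \<open>Used to collect the singular parts for all final states into one measure, the remainder
  of the law of Y_t beside its density.\<close>

lemma sum_measure_exists:
  fixes \<mu> :: "'n::finite \<Rightarrow> (real^'d) measure"
  assumes "\<And>l. sets (\<mu> l) = sets borel" "\<And>l. finite_measure (\<mu> l)"
  shows "\<exists>\<nu>. sets \<nu> = sets borel \<and> finite_measure \<nu> \<and> (\<forall>B\<in>sets borel. emeasure \<nu> B = (\<Sum>l\<in>UNIV. emeasure (\<mu> l) B))"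
proof -
  define \<nu> where "\<nu> = measure_of UNIV (sets borel) (\<lambda>B::(real^'d) set. \<Sum>l\<in>UNIV. emeasure (\<mu> l) B)"
  have sets: "sets \<nu> = sets borel" unfolding \<nu>_def using sets.sigma_sets_eq[of "borel :: (real^'d) measure"] by simp
  have em: "emeasure \<nu> B = (\<Sum>l\<in>UNIV. emeasure (\<mu> l) B)" if "B \<in> sets borel" for B
    unfolding \<nu>_def
  proof (rule emeasure_measure_of_sigma)
    show "sigma_algebra UNIV (sets (borel :: (real^'d) measure))" using sets.sigma_algebra_axioms[of borel] by simp
    show "positive (sets borel) (\<lambda>B::(real^'d) set. \<Sum>l\<in>UNIV. emeasure (\<mu> l) B)" by (simp add: positive_def)
    show "countably_additive (sets borel) (\<lambda>B::(real^'d) set. \<Sum>l\<in>UNIV. emeasure (\<mu> l) B)"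
    proof (rule countably_additiveI)
      fix A :: "nat \<Rightarrow> (real^'d) set" assume A: "range A \<subseteq> sets borel" "disjoint_family A"
      have "(\<Sum>i. \<Sum>l\<in>UNIV. emeasure (\<mu> l) (A i)) = (\<Sum>l\<in>UNIV. \<Sum>i. emeasure (\<mu> l) (A i))"
        by (rule suminf_sum) simp
      also have "\<dots> = (\<Sum>l\<in>UNIV. emeasure (\<mu> l) (\<Union>i. A i))"
        using A assms(1) by (intro sum.cong refl suminf_emeasure) auto
      finally show "(\<Sum>i. \<Sum>l\<in>UNIV. emeasure (\<mu> l) (A i)) = (\<Sum>l\<in>UNIV. emeasure (\<mu> l) (\<Union>i. A i))" .
    qed
  qed (use that in auto)
  have "finite_measure \<nu>"
  proof (rule finite_measureI)
    have "emeasure \<nu> (space \<nu>) = (\<Sum>l\<in>UNIV. emeasure (\<mu> l) UNIV)"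
      using sets_eq_imp_space_eq[OF sets] em[of UNIV] by simp
    moreover have "emeasure (\<mu> l) UNIV \<noteq> \<infinity>" for l
      using finite_measure.emeasure_finite[OF assms(2)] by auto
    ultimately show "emeasure \<nu> (space \<nu>) \<noteq> \<infinity>" by simp
  qed
  with sets em show ?thesis by blast
qed

lemma lebesgue_decompositionD:
  assumes "lebesgue_decomposition \<nu> g \<mu>"
  shows "g \<in> borel_measurable borel" "0 \<le> g y" "sets \<mu> = sets borel"
    "B \<in> sets borel \<Longrightarrow> emeasure \<nu> B = (\<integral>\<^sup>+y\<in>B. ennreal (g y) \<partial>lborel) + emeasure \<mu> B"
  using assms by (auto simp: lebesgue_decomposition_def lebesgue_singular_def)

lemma lebesgue_decomposition_finite:
  assumes "lebesgue_decomposition \<nu> g \<mu>" "finite_measure \<nu>"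
  shows "finite_measure \<mu>"
proof (rule finite_measureI)
  have "emeasure \<mu> UNIV \<le> emeasure \<nu> UNIV"
    using lebesgue_decompositionD(4)[OF assms(1), of UNIV] by simp
  moreover have "emeasure \<nu> UNIV \<noteq> \<infinity>" using finite_measure.emeasure_finite[OF assms(2), of UNIV] by simp
  moreover have "space \<mu> = UNIV" using sets_eq_imp_space_eq[OF lebesgue_decompositionD(3)[OF assms(1)]] by simp
  ultimately show "emeasure \<mu> (space \<mu>) \<noteq> \<infinity>" by (auto simp: top_unique)
qed

context ergodic_map begin

lemma exists_perturbed:
  "\<exists>\<xi> p. perturbed_chain P p m \<theta> (1 + M) (B1 \<xi>) (B2 \<xi>) (\<lambda>t. \<Phi> 1 (t *\<^sub>R \<xi>))"
  using perturbed[of "axis undefined 1"] by auto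

text \<open>The constants do not depend on the direction, but their signs are facts about an
  instance of \<open>perturbed_chain\<close>; one instance, along an arbitrary unit vector, is
  enough to read them off.\<close>

lemma constants_pos:
  shows "0 < a \<Longrightarrow> 0 < perturbed_chain.\<delta> m \<theta> (1 + M) a" "perturbed_chain.\<delta> m \<theta> (1 + M) a \<le> 1"
    "0 \<le> perturbed_chain.C1 m \<theta> (1 + M)" "0 \<le> perturbed_chain.H m \<theta> (1 + M)"
proof -
  obtain \<xi> p where "perturbed_chain P p m \<theta> (1 + M) (B1 \<xi>) (B2 \<xi>) (\<lambda>t. \<Phi> 1 (t *\<^sub>R \<xi>))"
    using exists_perturbed by blast
  then interpret C: perturbed_chain P p m \<theta> "1 + M" "B1 \<xi>" "B2 \<xi>" "\<lambda>t. \<Phi> 1 (t *\<^sub>R \<xi>)" .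
  show "0 < a \<Longrightarrow> 0 < C.\<delta> a" using C.G_pos(1) \<theta> by (simp add: C.\<delta>_def)
  show "C.\<delta> a \<le> 1" by (simp add: C.\<delta>_def)
  show "0 \<le> C.C1" "0 \<le> C.H" using C.const_nonneg by (simp_all add: C.C1_def C.Ca_def)
qed

text \<open>Each entry carries mass at least \<theta> and a singular part of mass at most
  \<theta>/2, so every entry loses \<open>\<kappa>\<close> and the row sum loses at least as much.
  The conclusion of \<open>fourier_gap\<close> is taken as an assumption at the given frequency, so
  that one \<kappa> can be fixed before the member of the family.\<close>

lemma row_gap:
  assumes gap: "\<And>\<nu> \<mu> h. finite_measure \<nu> \<Longrightarrow> sets \<nu> = sets borel \<Longrightarrow> h \<in> borel_measurable borel \<Longrightarrow>
      (\<And>y. 0 \<le> h y \<and> h y \<le> B) \<Longrightarrow>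
      (\<And>A. A \<in> sets borel \<Longrightarrow> emeasure \<nu> A = (\<integral>\<^sup>+y\<in>A. ennreal (h y) \<partial>lborel) + emeasure \<mu> A) \<Longrightarrow>
      emeasure \<mu> UNIV + ennreal (\<theta> / 2) \<le> emeasure \<nu> UNIV \<Longrightarrow>
      (\<integral>\<^sup>+y. ennreal (norm y) \<partial>\<nu>) \<le> ennreal (real n * (1 + M)) \<Longrightarrow>
      norm (LINT y|\<nu>. cis (\<zeta> \<bullet> y)) \<le> measure \<nu> UNIV - \<kappa>"
    and \<kappa>: "0 \<le> \<kappa>"
    and n: "\<And>k l. \<theta> \<le> mat_pow P n $ k $ l"
    and dec: "\<And>l. lebesgue_decomposition (additive_law Pr X Y (real n) k l) (g l) (\<mu> l)"
    and g: "\<And>l y. g l y \<le> B" and mu: "\<And>l. measure (\<mu> l) UNIV \<le> \<theta> / 2"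
  shows "(\<Sum>l\<in>UNIV. cmod (\<Phi> (real n) \<zeta> $ k $ l)) \<le> 1 - \<kappa>"
proof -
  have each: "cmod (\<Phi> (real n) \<zeta> $ k $ l) \<le> measure (Q (real n) (k, 0)) ({l} \<times> UNIV) - \<kappa>" for l
  proof -
    let ?\<nu> = "additive_law Pr X Y (real n) k l"
    interpret Q: prob_space "Q (real n) (k, 0)" by (rule Q_prob[OF T(3)])
    interpret mu: finite_measure "\<mu> l" by (rule lebesgue_decomposition_finite[OF dec finite_additive_law[OF T(3)]])
    have e: "emeasure ?\<nu> UNIV = emeasure (Q (real n) (k, 0)) ({l} \<times> UNIV)"
      by (rule additive_law_eq[OF T(3)]) simp
    have "mat_pow P n $ k $ l = measure (Q (real n) (k, 0)) ({l} \<times> UNIV)"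
      by (simp add: driving_pow[OF driving] driving_semigroup_def)
    then have "\<theta> \<le> measure (Q (real n) (k, 0)) ({l} \<times> UNIV)" using n[of k l] by simp
    then have "measure (\<mu> l) UNIV + \<theta> / 2 \<le> measure (Q (real n) (k, 0)) ({l} \<times> UNIV)"
      using mu[of l] by simp
    then have "ennreal (measure (\<mu> l) UNIV + \<theta> / 2) \<le> ennreal (measure (Q (real n) (k, 0)) ({l} \<times> UNIV))" by (rule ennreal_leI)
    then have 1: "emeasure (\<mu> l) UNIV + ennreal (\<theta> / 2) \<le> emeasure ?\<nu> UNIV"
      using \<theta> unfolding e by (simp add: mu.emeasure_eq_measure Q.emeasure_eq_measure)
    have "(\<integral>\<^sup>+z. ennreal (norm (snd z)) \<partial>Q 1 (k, 0)) \<le> ennreal (1 + M)" for k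
    proof -
      note L = lower_moments[OF T1 zero_less_one order_refl, of 1 k, simplified]
      show ?thesis using L by (subst nn_integral_eq_integral) (auto intro: ennreal_leI)
    qed
    from first_moment_nat[OF this, of n k]
    have 2: "(\<integral>\<^sup>+y. ennreal (norm y) \<partial>?\<nu>) \<le> ennreal (real n * (1 + M))"
      using nn_integral_additive_law_le[OF T(3), of "\<lambda>y. ennreal (norm y)" n k l] M
      by (simp add: ennreal_mult ennreal_of_nat_eq_real_of_nat del: ennreal_plus)
    have "cmod (LINT y|?\<nu>. cis (\<zeta> \<bullet> y)) \<le> measure ?\<nu> UNIV - \<kappa>"
      by (rule gap[OF finite_additive_law[OF T(3)] sets_additive_law, where h="g l" and \<mu>="\<mu> l"])
        (use lebesgue_decompositionD[OF dec] g 1 2 in auto)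
    then show ?thesis unfolding integral_additive_law[OF T(3)] using e by (simp add: measure_def)
  qed
  have "(\<Sum>l\<in>UNIV. cmod (\<Phi> (real n) \<zeta> $ k $ l)) \<le> (\<Sum>l\<in>UNIV. measure (Q (real n) (k, 0)) ({l} \<times> UNIV) - \<kappa>)"
    by (rule sum_mono) (rule each)
  also have "\<dots> = 1 - real CARD('n) * \<kappa>" using sum_slices[OF T(3), of n k] by (simp add: sum_subtractf)
  also have "\<dots> \<le> 1 - \<kappa>"
  proof -
    have "1 * \<kappa> \<le> real CARD('n) * \<kappa>" using \<kappa> by (intro mult_right_mono) (auto simp: Suc_le_eq)
    then show ?thesis by simp
  qed
  finally show ?thesis .
qed

lemma posdef_S:
  assumes "0 < \<alpha>" "\<And>\<zeta>. \<alpha> * (norm \<zeta>)\<^sup>2 \<le> \<zeta> \<bullet> (S *v \<zeta>)"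
  shows "posdef S"
proof -
  have "transpose S = S" using cov by (auto simp: asymptotic_covariance_def centered_gaussian_def)
  moreover have "0 < x \<bullet> (S *v x)" if "x \<noteq> 0" for x
    using assms(1) that by (intro less_le_trans[OF _ assms(2)]) simp
  ultimately show ?thesis by (auto simp: posdef_def)
qed

text \<open>The constant \<open>c\<close> is the decay rate of the small-frequency expansion for a =
  \<alpha>/2. The three summands of C + 1 + 1/\<delta> come from that expansion, from the smoothing
  factor at small frequencies, and from the Gaussian beyond \<delta>. The characteristic function
  beyond \<delta> and the singular mass are small only through \<open>t\<close>, hence they keep the
  factor given by the kernel.\<close>

lemma local_density:
  fixes \<alpha> t e \<kappa> mb :: real and n :: nat and G :: "real^'d \<Rightarrow> real^'n^'n"
  defines "c \<equiv> \<alpha> / (4 * real m)" and "\<delta> \<equiv> perturbed_chain.\<delta> m \<theta> (1 + M) (\<alpha> / 2)"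
  defines "C \<equiv> (perturbed_chain.C1 m \<theta> (1 + M) + (1 + M) + perturbed_chain.H m \<theta> (1 + M)) * exp 1"
  assumes \<alpha>: "0 < \<alpha>" "\<And>\<zeta>. \<alpha> * (norm \<zeta>)\<^sup>2 \<le> \<zeta> \<bullet> (S *v \<zeta>)"
    and \<kappa>: "0 < \<kappa>" "\<kappa> \<le> 1" and n: "1 \<le> n"
    and row: "\<And>k \<zeta>. \<delta> \<le> norm \<zeta> \<Longrightarrow> (\<Sum>l\<in>UNIV. cmod (\<Phi> (real n) \<zeta> $ k $ l)) \<le> 1 - \<kappa>"
    and t: "t \<in> T" "1 \<le> t" and e: "0 < e" "e \<le> 1"
    and dec: "\<And>l. lebesgue_decomposition (additive_law Pr X Y t k l) (\<lambda>y. G y $ k $ l) (\<mu> l)"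
    and mb: "\<And>l. measure (\<mu> l) UNIV \<le> mb"
  shows "\<bar>(LINT z|lborel. (\<Sum>l\<in>UNIV. G z $ k $ l) * gaussian_density (mat (e\<^sup>2)) (y - z)) - gaussian_density (t *\<^sub>R S) y\<bar>
    \<le> (C + 1 + 1 / \<delta>) * ((2 * c) powr (- 1 / 2) + (2 * c / 3) powr (- 3 / 2)) * t powr (- 1 / 2) * (c * t) powr (- real CARD('d) / 2)
      + (exp 1 * exp (- (\<kappa> / real n) * t) + real CARD('n) * mb) * e powr (- real CARD('d))"
proof -
  define q where "q = ((2 * c) powr (- 1 / 2) + (2 * c / 3) powr (- 3 / 2)) * t powr (- 1 / 2)"
  define b where "b = exp 1 * exp (- (\<kappa> / real n) * t)"
  have c0: "0 < c" using \<alpha> m by (simp add: c_def)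
  have c\<alpha>: "c \<le> \<alpha> / 2"
  proof -
    have "c = \<alpha> / 2 * (1 / (2 * real m))" by (simp add: c_def)
    also have "\<dots> \<le> \<alpha> / 2 * 1" using m \<alpha> by (intro mult_left_mono) auto
    finally show ?thesis by simp
  qed
  have \<delta>: "0 < \<delta>" "\<delta> \<le> 1" unfolding \<delta>_def using constants_pos(1,2) \<alpha> by auto
  have C0: "0 \<le> C" unfolding C_def using constants_pos(3,4) M by simp
  have t0: "0 < t" using t by simp
  have pS: "posdef S" by (rule posdef_S[OF \<alpha>])
  have ptS: "posdef (t *\<^sub>R S)"
    using pS t0 by (auto simp: posdef_def transpose_scalar scaleR_matrix_vector_assoc[symmetric])
  have xtS: "x \<bullet> ((t *\<^sub>R S) *v x) = t * (x \<bullet> (S *v x))" for x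
    by (simp add: scaleR_matrix_vector_assoc[symmetric])
  have q0: "0 \<le> q" by (simp add: q_def)
  have cub: "(r + t * r ^ 3) * exp (- c * t * r\<^sup>2) \<le> q * exp (- (c * t) * r\<^sup>2 / 2)" if "0 \<le> r" for r
    using gaussian_cubic_bound[OF c0 t0 that] by (simp add: q_def)
  have gr: "r * exp (- t * (x \<bullet> (S *v x)) / 2) \<le> q * exp (- (c * t) * r\<^sup>2 / 2)" if r: "r = norm x" for r x
  proof -
    have "c * r\<^sup>2 \<le> (x \<bullet> (S *v x)) / 2"
      using mult_right_mono[OF c\<alpha>, of "r\<^sup>2"] \<alpha>(2)[of x] r by simp
    from mult_left_mono[OF this, of t] have "exp (- t * (x \<bullet> (S *v x)) / 2) \<le> exp (- c * t * r\<^sup>2)"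
      using t0 by (simp add: mult_ac)
    then have "r * exp (- t * (x \<bullet> (S *v x)) / 2) \<le> (r + t * r ^ 3) * exp (- c * t * r\<^sup>2)"
      using r t0 by (intro mult_mono) auto
    also have "\<dots> \<le> q * exp (- (c * t) * r\<^sup>2 / 2)" using r by (intro cub) simp
    finally show ?thesis .
  qed
  define \<nu> where "\<nu> = distr (Q t (k, 0)) borel snd"
  note [measurable_cong] = sets_Q[OF t(1)]
  interpret Q: prob_space "Q t (k, 0)" by (rule Q_prob[OF t(1)])
  have nu: "prob_space \<nu>" "sets \<nu> = sets borel" unfolding \<nu>_def by (auto intro!: Q.prob_space_distr)
  have ch: "(LINT z|\<nu>. cis (x \<bullet> z)) = (\<Phi> t x *v 1) $ k" for x
    unfolding \<nu>_def \<Phi>_one[OF t(1)] by (subst integral_distr) auto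
  define h where "h z = (\<Sum>l\<in>UNIV. G z $ k $ l)" for z
  note D = lebesgue_decompositionD[OF dec]
  have h: "h \<in> borel_measurable borel" "\<And>y. 0 \<le> h y"
    unfolding h_def using D(1,2) by (auto intro!: borel_measurable_sum sum_nonneg)
  have muf: "finite_measure (\<mu> l)" for l
    by (rule lebesgue_decomposition_finite[OF dec finite_additive_law[OF t(1)]])
  obtain \<mu>' where mu': "sets \<mu>' = sets borel" "finite_measure \<mu>'"
    and em: "\<And>B. B \<in> sets borel \<Longrightarrow> emeasure \<mu>' B = (\<Sum>l\<in>UNIV. emeasure (\<mu> l) B)"
    using sum_measure_exists[of \<mu>, OF D(3) muf] by blast
  have mass: "measure \<mu>' UNIV \<le> real CARD('n) * mb"
  proof -
    have "ennreal (measure \<mu>' UNIV) = (\<Sum>l\<in>UNIV. ennreal (measure (\<mu> l) UNIV))"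
      using em[of UNIV] finite_measure.emeasure_eq_measure[OF mu'(2)] finite_measure.emeasure_eq_measure[OF muf] by simp
    then have "measure \<mu>' UNIV = (\<Sum>l\<in>UNIV. measure (\<mu> l) UNIV)"
      by (simp add: sum_ennreal sum_nonneg)
    also have "\<dots> \<le> (\<Sum>l\<in>(UNIV::'n set). mb)" by (intro sum_mono mb)
    finally show ?thesis by simp
  qed
  have dec': "emeasure \<nu> B = (\<integral>\<^sup>+y\<in>B. ennreal (h y) \<partial>lborel) + emeasure \<mu>' B" if B: "B \<in> sets borel" for B
  proof -
    have "emeasure \<nu> B = emeasure (Q t (k, 0)) (UNIV \<times> B)"
      unfolding \<nu>_def using B by (subst emeasure_distr) (auto simp: space_Q[OF t(1)] intro!: arg_cong2[where f=emeasure])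
    also have "\<dots> = (\<Sum>l\<in>UNIV. emeasure (Q t (k, 0)) ({l} \<times> B))"
      using B by (subst emeasure_slices[OF sets_Q[OF t(1)]]) (auto intro!: pair_measureI sum.cong arg_cong2[where f=emeasure])
    also have "\<dots> = (\<Sum>l\<in>UNIV. (\<integral>\<^sup>+y\<in>B. ennreal (G y $ k $ l) \<partial>lborel) + emeasure (\<mu> l) B)"
      using D(4)[OF B] by (simp add: additive_law_eq[OF t(1) B])
    also have "\<dots> = (\<Sum>l\<in>UNIV. \<integral>\<^sup>+y\<in>B. ennreal (G y $ k $ l) \<partial>lborel) + emeasure \<mu>' B"
      by (simp add: sum.distrib em[OF B])
    also have "(\<Sum>l\<in>UNIV. \<integral>\<^sup>+y\<in>B. ennreal (G y $ k $ l) \<partial>lborel) = (\<integral>\<^sup>+y. (\<Sum>l\<in>UNIV. ennreal (G y $ k $ l) * indicator B y) \<partial>lborel)"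
      using D(1) B by (subst nn_integral_sum) auto
    also have "\<dots> = (\<integral>\<^sup>+y\<in>B. ennreal (h y) \<partial>lborel)"
      using D(2) by (simp add: h_def sum_ennreal flip: sum_distrib_right)
    finally show ?thesis .
  qed
  have bound: "norm ((LINT z|\<nu>. cis (x \<bullet> z)) * complex_of_real (exp (- (e\<^sup>2 * (norm x)\<^sup>2) / 2))
          - complex_of_real (exp (- (x \<bullet> ((t *\<^sub>R S) *v x)) / 2)))
        \<le> ((C + 1 + 1 / \<delta>) * q) * exp (- (c * t) * (norm x)\<^sup>2 / 2) + b * exp (- (e\<^sup>2) * (norm x)\<^sup>2 / 2)" for x
  proof -
    define r where "r = norm x"
    define E where "E = exp (- (e\<^sup>2 * r\<^sup>2) / 2)"
    define g where "g = exp (- t * (x \<bullet> (S *v x)) / 2)"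
    define f where "f = (\<Phi> t x *v 1) $ k"
    define z where "z = q * exp (- (c * t) * r\<^sup>2 / 2)"
    have z0: "0 \<le> z" using q0 by (simp add: z_def)
    have r0: "0 \<le> r" by (simp add: r_def)
    have E: "0 \<le> E" "E \<le> 1" by (auto simp: E_def)
    have g0: "0 \<le> g" by (simp add: g_def)
    have b0: "0 \<le> b" by (simp add: b_def)
    have rz: "r * g \<le> z" unfolding g_def z_def by (rule gr) (simp add: r_def)
    have "norm (f * complex_of_real E - complex_of_real g) \<le> (C + 1 + 1 / \<delta>) * z + b * E"
    proof (cases "r \<le> \<delta>")
      case True
      have "f * complex_of_real E - complex_of_real g = (f - complex_of_real g) * complex_of_real E - complex_of_real (g * (1 - E))"
        by (simp add: algebra_simps)
      then have "norm (f * complex_of_real E - complex_of_real g) \<le> norm ((f - complex_of_real g) * complex_of_real E) + norm (complex_of_real (g * (1 - E)))"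
        by (simp only:) (rule norm_triangle_ineq4)
      also have "norm ((f - complex_of_real g) * complex_of_real E) \<le> C * z"
      proof -
        have "norm (f - complex_of_real g) \<le> C * ((r + t * r ^ 3) * exp (- (\<alpha> / 2 / (2 * real m)) * t * r\<^sup>2))"
          using small_frequency[OF \<alpha>, of x t k] True t(1) by (simp add: f_def g_def C_def r_def \<delta>_def)
        also have "\<alpha> / 2 / (2 * real m) = c" by (simp add: c_def)
        also have "C * ((r + t * r ^ 3) * exp (- c * t * r\<^sup>2)) \<le> C * z"
          unfolding z_def by (intro mult_left_mono cub r0 C0)
        finally have "norm (f - complex_of_real g) \<le> C * z" .
        then have "norm (f - complex_of_real g) * E \<le> (C * z) * 1" using E z0 C0 by (intro mult_mono) auto
        then show ?thesis using E by (simp add: norm_mult)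
      qed
      \<comment> \<open>The smoothing factor differs from one by at most e^2 r^2 <= r, so its effect
        is no larger than the linear error term bounded in \<open>rz\<close>.\<close>
      also have "norm (complex_of_real (g * (1 - E))) \<le> z"
      proof -
        have "1 - E \<le> e\<^sup>2 * r\<^sup>2 / 2" using exp_ge_add_one_self[of "- (e\<^sup>2 * r\<^sup>2) / 2"] by (simp add: E_def)
        also have "\<dots> \<le> e\<^sup>2 * r\<^sup>2" by simp
        also have "\<dots> \<le> 1 * r"
        proof (intro mult_mono)
          show "e\<^sup>2 \<le> 1" using e by (simp add: power_le_one)
          show "r\<^sup>2 \<le> r" using True \<delta> r0 by (simp add: power2_eq_square mult_left_le)
        qed auto
        finally have "g * (1 - E) \<le> g * r" using g0 by (intro mult_left_mono) auto
        then show ?thesis unfolding norm_of_real using rz g0 E by (subst abs_of_nonneg) (auto simp: mult.commute)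
      qed
      also have "C * z + z \<le> (C + 1 + 1 / \<delta>) * z + b * E"
        using z0 \<delta> b0 E by (simp add: distrib_right)
      finally show ?thesis by simp
    next
      case False
      have "norm (f * complex_of_real E - complex_of_real g) \<le> norm (f * complex_of_real E) + norm (complex_of_real g)"
        by (rule norm_triangle_ineq4)
      also have "norm (f * complex_of_real E) \<le> b * E"
      proof -
        have "norm f \<le> b" unfolding f_def b_def
          by (rule large_frequency_decay[OF n \<kappa> row t(1)]) (use False in \<open>simp add: r_def\<close>)
        then show ?thesis using E by (simp add: norm_mult mult_right_mono)
      qed
      \<comment> \<open>Beyond \<delta> the factor r / \<delta> exceeds one, so the bound
        \<open>rz\<close> controls the Gaussian itself.\<close>
      also have "norm (complex_of_real g) \<le> 1 / \<delta> * z"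
      proof -
        have "\<delta> * g \<le> r * g" using False g0 by (intro mult_right_mono) auto
        then have "\<delta> * g \<le> z" using rz by simp
        then show ?thesis using \<delta> g0 by (simp add: field_simps)
      qed
      also have "b * E + 1 / \<delta> * z \<le> (C + 1 + 1 / \<delta>) * z + b * E"
        using z0 C0 by (simp add: distrib_right)
      finally show ?thesis by simp
    qed
    then show ?thesis unfolding ch xtS
      by (simp add: f_def E_def g_def z_def r_def mult.assoc)
  qed
  have ct: "0 < c * t" using c0 t0 by simp
  have "\<bar>(LINT z|lborel. h z * gaussian_density (mat (e\<^sup>2)) (y - z)) - gaussian_density (t *\<^sub>R S) y\<bar>
     \<le> ((C + 1 + 1 / \<delta>) * q) * (c * t) powr (- real CARD('d) / 2) + (b + measure \<mu>' UNIV) * e powr (- real CARD('d))"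
    by (rule smoothed_density_bound[OF nu mu'(2,1) h dec' ptS e(1) ct bound])
  also have "\<dots> \<le> ((C + 1 + 1 / \<delta>) * q) * (c * t) powr (- real CARD('d) / 2) + (b + real CARD('n) * mb) * e powr (- real CARD('d))"
    using mass by (intro add_left_mono mult_right_mono add_left_mono) auto
  finally show ?thesis by (simp add: h_def q_def b_def mult.assoc)
qed

end

section \<open>Densities near the boundary of the domain and away from it\<close>

lemma segment_meets_boundary:
  fixes y z :: "'a::euclidean_space"
  assumes "open D" "y \<in> closure D" "z \<notin> D"
  shows "\<exists>b\<in>closure D - D. dist y b \<le> dist y z"
proof (cases "y \<in> D")
  case True
  \<comment> \<open>The segment to a point outside leaves \<open>D\<close> through its frontier,
    which for open \<open>D\<close> is the closure without \<open>D\<close>.\<close>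
  have "closed_segment y z \<inter> frontier D \<noteq> {}"
    by (rule connected_Int_frontier) (use True assms in auto)
  then obtain b where b: "b \<in> closed_segment y z" "b \<in> frontier D" by auto
  then have "b \<in> closure D - D" using assms(1) by (simp add: frontier_def interior_open)
  moreover have "dist y b \<le> dist y z" using dist_in_closed_segment[OF b(1)] by (simp add: dist_commute)
  ultimately show ?thesis by blast
next
  case False
  then show ?thesis using assms by (intro bexI[of _ y]) auto
qed

lemma lipschitz_on_closure:
  fixes f :: "'a::metric_space \<Rightarrow> real"
  assumes cont: "continuous_on (closure D) f"
    and L: "\<And>x y. x \<in> D \<Longrightarrow> y \<in> D \<Longrightarrow> \<bar>f x - f y\<bar> \<le> L * dist x y"
    and x: "x \<in> closure D" and y: "y \<in> closure D"
  shows "\<bar>f x - f y\<bar> \<le> L * dist x y"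
proof -
  obtain a where a: "\<And>n. a n \<in> D" "a \<longlonglongrightarrow> x" using x closure_sequential by metis
  obtain b where b: "\<And>n. b n \<in> D" "b \<longlonglongrightarrow> y" using y closure_sequential by metis
  have "(\<lambda>n. f (a n)) \<longlonglongrightarrow> f x"
    by (rule continuous_on_tendsto_compose[OF cont a(2) x]) (use a(1) closure_subset in \<open>auto intro!: always_eventually\<close>)
  moreover have "(\<lambda>n. f (b n)) \<longlonglongrightarrow> f y"
    by (rule continuous_on_tendsto_compose[OF cont b(2) y]) (use b(1) closure_subset in \<open>auto intro!: always_eventually\<close>)
  ultimately have "(\<lambda>n. \<bar>f (a n) - f (b n)\<bar>) \<longlonglongrightarrow> \<bar>f x - f y\<bar>" by (intro tendsto_intros)
  moreover have "(\<lambda>n. L * dist (a n) (b n)) \<longlonglongrightarrow> L * dist x y" by (intro tendsto_intros a b)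
  ultimately show ?thesis by (rule LIMSEQ_le) (auto intro: L a b)
qed

lemma mat_max_norm_ge: "norm (A $ k $ l) \<le> mat_max_norm A"
  unfolding mat_max_norm_def
proof (rule Max_ge)
  have "{norm (A $ k $ l) | k l. True} = range (\<lambda>(k, l). norm (A $ k $ l))" by auto
  then show "finite {norm (A $ k $ l) | k l. True}" by simp
qed auto

text \<open>This is the mean value inequality on the convex set \<open>D\<close>, with the
  derivative expanded in partial derivatives; the number of states enters through the sum over a
  row.\<close>

lemma partial_derivative_lipschitz:
  fixes F :: "real^'d \<Rightarrow> real^'n^'n"
  assumes D: "open D" "convex D" and diff: "F differentiable_on D"
    and C: "\<And>j y. y \<in> D \<Longrightarrow> mat_max_norm (partial_deriv j F y) \<le> C j"
    and xy: "x \<in> D" "y \<in> D"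
  shows "\<bar>(\<Sum>l\<in>UNIV. F x $ k $ l) - (\<Sum>l\<in>UNIV. F y $ k $ l)\<bar> \<le> real CARD('n) * (\<Sum>j\<in>UNIV. C j) * dist x y"
proof -
  define F' where "F' z = frechet_derivative F (at z)" for z
  have dF: "(F has_derivative F' z) (at z)" if "z \<in> D" for z
    using diff that D(1) unfolding F'_def
    by (simp add: differentiable_on_eq_differentiable_at frechet_derivative_works)
  have part: "F' z (axis j 1) = partial_deriv j F z" if "z \<in> D" for z j
  proof -
    have "((\<lambda>s. z + s *\<^sub>R axis j 1) has_derivative (\<lambda>s. s *\<^sub>R axis j 1)) (at 0)"
      by (auto intro!: derivative_eq_intros)
    from has_derivative_compose[OF this, of F "F' z"] dF[OF that]
    have "((\<lambda>s. F (z + s *\<^sub>R axis j 1)) has_derivative (\<lambda>s. F' z (s *\<^sub>R axis j 1))) (at 0)" by simp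
    moreover have "F' z (s *\<^sub>R axis j 1) = s *\<^sub>R F' z (axis j 1)" for s
      using has_derivative_linear[OF dF[OF that]] by (simp add: linear_cmul)
    ultimately have "((\<lambda>s. F (z + s *\<^sub>R axis j 1)) has_vector_derivative F' z (axis j 1)) (at 0)"
      by (simp add: has_vector_derivative_def)
    then show ?thesis unfolding partial_deriv_def by (rule vector_derivative_at[symmetric])
  qed
  let ?f = "\<lambda>z. \<Sum>l\<in>UNIV. F z $ k $ l"
  let ?f' = "\<lambda>z v. \<Sum>l\<in>UNIV. F' z v $ k $ l"
  have "norm (?f x - ?f y) \<le> real CARD('n) * (\<Sum>j\<in>UNIV. C j) * norm (x - y)"
  proof (rule differentiable_bound[OF D(2), of ?f ?f'])
    fix z assume z: "z \<in> D"
    have "((\<lambda>z. F z $ k) has_derivative (\<lambda>v. F' z v $ k)) (at z)"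
      by (rule bounded_linear.has_derivative[OF bounded_linear_vec_nth dF[OF z]])
    then have d: "((\<lambda>z. F z $ k $ l) has_derivative (\<lambda>v. F' z v $ k $ l)) (at z)" for l
      by (rule bounded_linear.has_derivative[OF bounded_linear_vec_nth])
    show "(?f has_derivative ?f' z) (at z within D)"
      by (rule has_derivative_at_withinI, rule has_derivative_sum, rule d)
    show "onorm (?f' z) \<le> real CARD('n) * (\<Sum>j\<in>UNIV. C j)"
    proof (rule onorm_le)
      fix v
      have lin: "linear (F' z)" using has_derivative_linear[OF dF[OF z]] .
      have "F' z v = F' z (\<Sum>j\<in>UNIV. v $ j *\<^sub>R axis j 1)" using basis_expansion[of v] by (simp only: scalar_mult_eq_scaleR)
      also have "\<dots> = (\<Sum>j\<in>UNIV. v $ j *\<^sub>R partial_deriv j F z)"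
        using lin by (simp add: linear_sum linear_cmul part[OF z])
      finally have Fv: "F' z v = \<dots>" .
      have "\<bar>F' z v $ k $ l\<bar> \<le> (\<Sum>j\<in>UNIV. C j) * norm v" for l
      proof -
        have "\<bar>F' z v $ k $ l\<bar> = \<bar>\<Sum>j\<in>UNIV. v $ j * partial_deriv j F z $ k $ l\<bar>" by (simp add: Fv)
        also have "\<dots> \<le> (\<Sum>j\<in>UNIV. \<bar>v $ j\<bar> * \<bar>partial_deriv j F z $ k $ l\<bar>)"
          by (rule order_trans[OF sum_abs]) (simp add: abs_mult)
        also have "\<dots> \<le> (\<Sum>j\<in>UNIV. norm v * C j)"
          using order_trans[OF mat_max_norm_ge C[OF z]]
          by (intro sum_mono mult_mono component_le_norm_cart) (auto simp flip: real_norm_def)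
        finally show ?thesis by (simp add: sum_distrib_left mult.commute)
      qed
      then have "(\<Sum>l\<in>UNIV. \<bar>F' z v $ k $ l\<bar>) \<le> (\<Sum>l\<in>(UNIV::'n set). (\<Sum>j\<in>UNIV. C j) * norm v)" by (intro sum_mono)
      then show "norm (?f' z v) \<le> real CARD('n) * (\<Sum>j\<in>UNIV. C j) * norm v"
        unfolding real_norm_def by (intro order_trans[OF sum_abs]) (simp add: mult.assoc)
    qed
  qed (use xy in auto)
  then show ?thesis by (simp add: dist_norm)
qed

text \<open>Outside the closure \<open>h\<close> vanishes and only \<open>g y\<close> remains.
  Within distance \<open>r\<close> of the complement, both functions are compared with their values
  at a boundary point, where \<open>h\<close> is at most \<open>b\<close> and the value of
  \<open>g\<close> is kept. If the ball of radius \<open>r\<close> lies in \<open>D\<close>,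
  smoothing applies. The first two cases give the second alternative, with a point outside
  \<open>D\<close>.\<close>

lemma density_comparison:
  fixes h g :: "real^'d \<Rightarrow> real"
  assumes D: "open D" and h: "h \<in> borel_measurable borel" "\<And>y. 0 \<le> h y" "\<And>y. h y \<le> B"
    and out: "\<And>y. y \<notin> closure D \<Longrightarrow> h y = 0"
    and lip: "\<And>x y. x \<in> closure D \<Longrightarrow> y \<in> closure D \<Longrightarrow> \<bar>h x - h y\<bar> \<le> L * dist x y" and L: "0 \<le> L"
    and bdry: "\<And>y. y \<in> closure D - D \<Longrightarrow> h y \<le> b"
    and g: "\<And>y. 0 \<le> g y" and glip: "\<And>x y. \<bar>g x - g y\<bar> \<le> Lg * dist x y" and Lg: "0 \<le> Lg"
    and r: "0 < r" and e: "0 < e"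
    and conv: "\<bar>(LINT z|lborel. h z * gaussian_density (mat (e\<^sup>2)) (y - z)) - g y\<bar> \<le> E"
  defines "R \<equiv> max 0 b + (L + Lg) * r + (L + B / r) * (e * 2 powr (real CARD('d) / 2)) + E"
  shows "\<bar>h y - g y\<bar> \<le> R \<or> (\<exists>z. z \<notin> D \<and> \<bar>h y - g y\<bar> \<le> R + g z)"
proof -
  have B: "0 \<le> B" using order_trans[OF h(2,3)] .
  have E: "0 \<le> E" using order_trans[OF abs_ge_zero conv] .
  have p1: "0 \<le> (L + Lg) * r" and p2: "0 \<le> (L + B / r) * (e * 2 powr (real CARD('d) / 2))"
    using L Lg r e B by auto
  consider (out) "y \<notin> closure D" | (near) z where "y \<in> closure D" "z \<notin> D" "dist y z \<le> r" | (inside) "ball y r \<subseteq> D"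
    by (cases "ball y r \<subseteq> D") (force simp: less_imp_le)+
  then show ?thesis
  proof cases
    case out
    then have "y \<notin> D" using closure_subset by blast
    moreover have "\<bar>h y - g y\<bar> \<le> R + g y" using assms(5)[OF out] g[of y] p1 p2 E by (simp add: R_def)
    ultimately show ?thesis by blast
  next
    case near
    obtain w where w: "w \<in> closure D - D" "dist y w \<le> dist y z"
      using segment_meets_boundary[OF D near(1,2)] by blast
    have "\<bar>h y - h w\<bar> \<le> L * r"
      using lip[OF near(1), of w] w near(3) L by (meson DiffD1 mult_left_mono order_trans)
    then have "h y \<le> b + L * r" using bdry[OF w(1)] by simp
    moreover have "\<bar>g y - g w\<bar> \<le> Lg * r"
      using glip[of y w] w near(3) Lg by (meson mult_left_mono order_trans)
    moreover have "0 \<le> L * r" using L r by simp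
    moreover have "0 \<le> Lg * r" using Lg r by simp
    ultimately have "\<bar>h y - g y\<bar> \<le> R + g w"
      using h(2)[of y] g[of y] g[of w] p1 p2 E unfolding R_def distrib_right[of L Lg] by linarith
    then show ?thesis using w by blast
  next
    case inside
    have y: "y \<in> closure D" using inside r closure_subset by (metis centre_in_ball subsetD)
    \<comment> \<open>Beyond distance \<open>r\<close> the function may jump by \<open>B\<close>,
      which a slope B/r accommodates.\<close>
    have "\<bar>h y - h z\<bar> \<le> (L + B / r) * norm (y - z)" for z
    proof (cases "dist y z < r")
      case True
      then have "z \<in> closure D" using inside closure_subset by (metis mem_ball subsetD)
      then have "\<bar>h y - h z\<bar> \<le> L * norm (y - z)" using lip[OF y] by (simp add: dist_norm)
      also have "\<dots> \<le> (L + B / r) * norm (y - z)" using B r by (intro mult_right_mono) auto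
      finally show ?thesis .
    next
      case False
      have "\<bar>h y - h z\<bar> \<le> B" using h(2,3)[of y] h(2,3)[of z] by linarith
      also have "B = B / r * r" using r by simp
      also have "\<dots> \<le> B / r * norm (y - z)" using False B r by (intro mult_left_mono) (auto simp: dist_norm)
      also have "\<dots> \<le> (L + B / r) * norm (y - z)" using L by (intro mult_right_mono) auto
      finally show ?thesis .
    qed
    then have "\<bar>h y - (LINT z|lborel. h z * gaussian_density (mat (e\<^sup>2)) (y - z))\<bar> \<le> (L + B / r) * (e * 2 powr (real CARD('d) / 2))"
      by (rule smoothing_error[OF e h(1), of y _ B]) (use h in auto)
    then have "\<bar>h y - g y\<bar> \<le> R" using conv p1 unfolding R_def by linarith
    then show ?thesis by blast
  qed
qed

section \<open>The pointwise estimate at a given time\<close>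

context ergodic_map begin

text \<open>This is the coefficient of t^(-(d+1)/2) in the smoothed estimate once the powers of
  \<open>t\<close> are split off. Apart from the dimension it depends on \<open>M\<close>,
  \<open>\<theta>\<close>, \<open>m\<close> and \<open>\<alpha>\<close> only, hence it is common to
  the family.\<close>

definition K1 :: "real \<Rightarrow> real" where
  "K1 \<alpha> = (let c = \<alpha> / (4 * real m); \<delta> = perturbed_chain.\<delta> m \<theta> (1 + M) (\<alpha> / 2);
     C = (perturbed_chain.C1 m \<theta> (1 + M) + (1 + M) + perturbed_chain.H m \<theta> (1 + M)) * exp 1 in
     (C + 1 + 1 / \<delta>) * ((2 * c) powr (- 1 / 2) + (2 * c / 3) powr (- 3 / 2)) * c powr (- real CARD('d) / 2))"

text \<open>The comparison is made at the unscaled point \<open>Y\<close>, with distance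
  \<open>w\<close> and kernel width w^2; multiplication by t^(d/2) produces the rate and turns the
  Gaussian of covariance t S into that of \<open>S\<close>. The assumption \<open>tail\<close>
  collects the exponentially small terms, already multiplied by the bound for the height of the
  kernel.\<close>

lemma pointwise_estimate:
  fixes \<alpha> t \<kappa> mb Bg L b :: real and n :: nat and G :: "real^'d \<Rightarrow> real^'n^'n" and y :: "real^'d"
  defines "w \<equiv> t powr (- (real CARD('d) + 1) / 2)"
  defines "Lg \<equiv> (1 / sqrt \<alpha>) * (4 * pi / \<alpha>) powr (real CARD('d) / 2) / (2 * pi) ^ CARD('d)"
  defines "R \<equiv> b + (L + Lg) + (L + real CARD('n) * Bg) * 2 powr (real CARD('d) / 2) + K1 \<alpha> + 1"
  assumes \<alpha>: "0 < \<alpha>" "\<And>\<zeta>. \<alpha> * (norm \<zeta>)\<^sup>2 \<le> \<zeta> \<bullet> (S *v \<zeta>)"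
    and \<kappa>: "0 < \<kappa>" "\<kappa> \<le> 1" and n: "1 \<le> n"
    and row: "\<And>k \<zeta>. perturbed_chain.\<delta> m \<theta> (1 + M) (\<alpha> / 2) \<le> norm \<zeta> \<Longrightarrow> (\<Sum>l\<in>UNIV. cmod (\<Phi> (real n) \<zeta> $ k $ l)) \<le> 1 - \<kappa>"
    and t: "t \<in> T" "1 \<le> t"
    and dec: "\<And>l. lebesgue_decomposition (additive_law Pr X Y t k l) (\<lambda>y. G y $ k $ l) (\<mu> l)"
    and mb: "\<And>l. measure (\<mu> l) UNIV \<le> mb"
    and tail: "(exp 1 * exp (- (\<kappa> / real n) * t) + real CARD('n) * mb) * (w\<^sup>2) powr (- real CARD('d)) \<le> w"
    and D: "open D" and Bg: "\<And>y l. G y $ k $ l \<le> Bg" and out: "\<And>y. y \<notin> closure D \<Longrightarrow> G y = 0"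
    and lip: "\<And>x y. x \<in> closure D \<Longrightarrow> y \<in> closure D \<Longrightarrow>
        \<bar>(\<Sum>l\<in>UNIV. G x $ k $ l) - (\<Sum>l\<in>UNIV. G y $ k $ l)\<bar> \<le> L * dist x y" and L: "0 \<le> L"
    and bdry: "\<And>y. y \<in> closure D - D \<Longrightarrow> (\<Sum>l\<in>UNIV. G y $ k $ l) \<le> b * w" and b: "0 \<le> b"
  defines "f \<equiv> t powr (real CARD('d) / 2) * (\<Sum>l\<in>UNIV. G (t powr (1 / 2) *\<^sub>R y) $ k $ l)"
  shows "\<bar>f - gaussian_density S y\<bar> \<le> R * t powr (- 1 / 2) \<or>
     (\<exists>z. z \<notin> D \<and> \<bar>f - gaussian_density S y\<bar> \<le> R * t powr (- 1 / 2) + gaussian_density S (t powr (- 1 / 2) *\<^sub>R z))"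
proof -
  let ?d = "real CARD('d)" and ?N = "real CARD('n)"
  define c where "c = \<alpha> / (4 * real m)"
  define h where "h z = (\<Sum>l\<in>UNIV. G z $ k $ l)" for z
  define g where "g = gaussian_density (t *\<^sub>R S)"
  define e where "e = w\<^sup>2"
  define A where "A = K1 \<alpha>"
  have t0: "0 < t" using t by simp
  have c0: "0 < c" using \<alpha> m by (simp add: c_def)
  have w0: "0 < w" using t0 by (simp add: w_def)
  have w1: "w \<le> 1" unfolding w_def using powr_mono[of "- (?d + 1) / 2" 0 t] t by simp
  have e: "0 < e" "e \<le> w" "e \<le> 1" using w0 w1 by (auto simp: e_def power2_eq_square mult_left_le mult_le_one)
  have pS: "posdef S" by (rule posdef_S[OF \<alpha>])
  have ptS: "posdef (t *\<^sub>R S)"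
    using pS t0 by (auto simp: posdef_def transpose_scalar scaleR_matrix_vector_assoc[symmetric])
  have gs: "g x = t powr (- ?d / 2) * gaussian_density S (t powr (- 1 / 2) *\<^sub>R x)" for x
    unfolding g_def by (rule gaussian_density_scale[OF pS t0])
  have g0: "0 \<le> g x" for x unfolding g_def using posdef_det_pos[OF ptS] by (intro gaussian_density_nonneg) simp
  have td: "t powr (?d / 2) * w = t powr (- 1 / 2)"
    unfolding w_def by (simp add: powr_add[symmetric] field_simps)
  have tdi: "t powr (?d / 2) * t powr (- ?d / 2) = 1"
    using t0 by (simp add: powr_add[symmetric])
  have th: "t powr (- 1 / 2) * t powr (1 / 2) = 1"
    using t0 by (simp add: powr_add[symmetric])
  have Lg0: "0 \<le> Lg" unfolding Lg_def using \<alpha> by simp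
  have glip: "\<bar>g x - g z\<bar> \<le> Lg * dist x z" for x z
    unfolding g_def Lg_def dist_norm
  proof (rule gaussian_density_lipschitz[OF ptS \<alpha>(1)])
    fix x
    \<comment> \<open>For t >= 1 the covariance t S keeps the lower bound \<alpha>, so the Lipschitz
      constant of its density does not depend on \<open>t\<close>.\<close>
    have "1 * (x \<bullet> (S *v x)) \<le> t * (x \<bullet> (S *v x))"
      using t \<alpha>(2)[of x] \<alpha>(1) by (intro mult_right_mono order_trans[OF _ \<alpha>(2)]) auto
    then show "\<alpha> * (norm x)\<^sup>2 \<le> x \<bullet> (t *\<^sub>R S *v x)"
      using \<alpha>(2)[of x] by (simp add: scaleR_matrix_vector_assoc[symmetric])
  qed
  note Dec = lebesgue_decompositionD[OF dec]
  have h: "h \<in> borel_measurable borel" "\<And>y. 0 \<le> h y"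
    unfolding h_def using Dec(1,2) by (auto intro!: borel_measurable_sum sum_nonneg)
  have hB: "h y \<le> ?N * Bg" for y
    unfolding h_def using sum_mono[of UNIV "\<lambda>l. G y $ k $ l" "\<lambda>_. Bg"] Bg by simp
  have Bg0: "0 \<le> ?N * Bg" using order_trans[OF h(2) hB] .
  define Y where "Y = t powr (1 / 2) *\<^sub>R y"
  define E where "E = A * w + w"
  have conv: "\<bar>(LINT z|lborel. h z * gaussian_density (mat (e\<^sup>2)) (Y - z)) - g Y\<bar> \<le> E"
  proof -
    have "t powr (- 1 / 2) * (c * t) powr (- ?d / 2) = c powr (- ?d / 2) * w"
    proof -
      have "- 1 / 2 + (- ?d / 2) = - (?d + 1) / 2" by (simp add: field_simps)
      then have "t powr (- 1 / 2) * t powr (- ?d / 2) = w" by (simp only: w_def powr_add[symmetric])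
      moreover have "(c * t) powr (- ?d / 2) = c powr (- ?d / 2) * t powr (- ?d / 2)" by (rule powr_mult)
      ultimately show ?thesis by (simp only: mult.left_commute[of "t powr (- 1 / 2)" "c powr (- ?d / 2)"])
    qed
    then have "((perturbed_chain.C1 m \<theta> (1 + M) + (1 + M) + perturbed_chain.H m \<theta> (1 + M)) * exp 1 + 1 + 1 / perturbed_chain.\<delta> m \<theta> (1 + M) (\<alpha> / 2))
       * ((2 * c) powr (- 1 / 2) + (2 * c / 3) powr (- 3 / 2)) * t powr (- 1 / 2) * (c * t) powr (- ?d / 2) = A * w"
      by (simp add: A_def K1_def Let_def c_def[symmetric] mult.assoc)
    then show ?thesis
      using local_density[OF \<alpha> \<kappa> n row t e(1,3) dec mb, of Y] tail
      by (simp add: h_def g_def c_def[symmetric] E_def e_def)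
  qed
  have hl: "x \<in> closure D \<Longrightarrow> z \<in> closure D \<Longrightarrow> \<bar>h x - h z\<bar> \<le> L * dist x z" for x z
    unfolding h_def by (rule lip)
  have ho: "x \<notin> closure D \<Longrightarrow> h x = 0" for x unfolding h_def by (simp add: out)
  have hb: "x \<in> closure D - D \<Longrightarrow> h x \<le> b * w" for x unfolding h_def by (rule bdry)
  define R' where "R' = max 0 (b * w) + (L + Lg) * w + (L + (?N * Bg) / w) * (e * 2 powr (?d / 2)) + E"
  have dc: "\<bar>h Y - g Y\<bar> \<le> R' \<or> (\<exists>z. z \<notin> D \<and> \<bar>h Y - g Y\<bar> \<le> R' + g z)"
    unfolding R'_def by (rule density_comparison[OF D h hB ho hl L hb g0 glip Lg0 w0 e(1) conv])
  have "R' \<le> R * w"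
  proof -
    \<comment> \<open>The slope of order 1/w caused by a possible jump at distance \<open>w\<close>
      is compensated by the kernel width w^2.\<close>
    have "(L + (?N * Bg) / w) * e = L * e + ?N * Bg * w" using w0 by (simp add: e_def power2_eq_square distrib_right)
    also have "\<dots> \<le> L * w + ?N * Bg * w" using e L by (intro add_right_mono mult_left_mono) auto
    finally have "(L + (?N * Bg) / w) * e * 2 powr (?d / 2) \<le> (L * w + ?N * Bg * w) * 2 powr (?d / 2)"
      by (intro mult_right_mono) auto
    moreover have "max 0 (b * w) = b * w" using b w0 by simp
    ultimately show ?thesis unfolding R'_def R_def E_def A_def by (simp add: algebra_simps)
  qed
  then have "t powr (?d / 2) * R' \<le> t powr (?d / 2) * (R * w)" by (intro mult_left_mono) auto
  also have "\<dots> = R * t powr (- 1 / 2)" using td by (simp add: mult.left_commute)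
  finally have RR: "t powr (?d / 2) * R' \<le> R * t powr (- 1 / 2)" .
  have "gaussian_density S y = t powr (?d / 2) * g Y"
    unfolding gs Y_def using tdi th by (simp add: mult.assoc[symmetric])
  then have fe: "\<bar>f - gaussian_density S y\<bar> = t powr (?d / 2) * \<bar>h Y - g Y\<bar>"
    by (simp add: f_def h_def Y_def abs_mult flip: right_diff_distrib)
  have gz: "t powr (?d / 2) * g z = gaussian_density S (t powr (- 1 / 2) *\<^sub>R z)" for z
    unfolding gs using tdi by (simp add: mult.assoc[symmetric])
  from dc show ?thesis
  proof
    assume "\<bar>h Y - g Y\<bar> \<le> R'"
    then have "t powr (?d / 2) * \<bar>h Y - g Y\<bar> \<le> t powr (?d / 2) * R'" by (intro mult_left_mono) auto
    then show ?thesis using RR fe by simp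
  next
    assume "\<exists>z. z \<notin> D \<and> \<bar>h Y - g Y\<bar> \<le> R' + g z"
    then obtain z where z: "z \<notin> D" "\<bar>h Y - g Y\<bar> \<le> R' + g z" by blast
    then have "t powr (?d / 2) * \<bar>h Y - g Y\<bar> \<le> t powr (?d / 2) * (R' + g z)" by (intro mult_left_mono) auto
    also have "\<dots> = t powr (?d / 2) * R' + gaussian_density S (t powr (- 1 / 2) *\<^sub>R z)"
      by (simp add: distrib_left gz)
    finally show ?thesis using z(1) RR fe by auto
  qed
qed

end

section \<open>Uniform constants and the final estimate\<close>

lemma ennreal_SUP_bound:
  assumes "(SUP x\<in>A. F x) < (\<infinity>::ennreal)"
  shows "\<exists>C\<ge>0. \<forall>x\<in>A. F x \<le> ennreal C"
proof -
  have "(SUP x\<in>A. F x) = ennreal (enn2real (SUP x\<in>A. F x))" using assms by (simp add: less_top)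
  then have "\<forall>x\<in>A. F x \<le> ennreal (enn2real (SUP x\<in>A. F x))" by (metis SUP_upper)
  then show ?thesis using enn2real_nonneg by blast
qed

text \<open>After division by the right side, exponentials times a power of \<open>t\<close> remain;
  the exponent \<open>p\<close> adds the cost (d+1) d of the kernel and (d+1)/2 for the required
  precision.\<close>

lemma exponential_tail:
  fixes \<kappa> \<rho> a b :: real
  assumes "0 < \<kappa>" "0 < \<rho>" "\<rho> < 1"
  shows "\<forall>\<^sub>F t in at_top. (exp 1 * exp (- \<kappa> * t) + a * (b * \<rho> powr t)) * ((t powr (- (real d + 1) / 2))\<^sup>2) powr (- real d) \<le> t powr (- (real d + 1) / 2)"
proof -
  define s where "s = - ln \<rho>"
  have s: "0 < s" using assms by (simp add: s_def)
  define p where "p = (real d + 1) * real d + (real d + 1) / 2"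
  have "((\<lambda>t. (exp 1 * exp (- \<kappa> * t) + a * b * exp (- s * t)) * t powr p) \<longlongrightarrow> 0) at_top"
  proof -
    have l: "((\<lambda>t. exp (- q * t) * t powr p) \<longlongrightarrow> 0) at_top" if "0 < q" for q :: real
      using that by real_asymp
    have "((\<lambda>t. exp 1 * (exp (- \<kappa> * t) * t powr p) + a * b * (exp (- s * t) * t powr p)) \<longlongrightarrow> exp 1 * 0 + a * b * 0) at_top"
      by (intro tendsto_intros l assms s)
    then show ?thesis by (simp add: algebra_simps)
  qed
  then have "\<forall>\<^sub>F t in at_top. (exp 1 * exp (- \<kappa> * t) + a * b * exp (- s * t)) * t powr p < 1"
    by (rule order_tendstoD) simp
  then show ?thesis using eventually_gt_at_top[of 0]
  proof eventually_elim
    case (elim t)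
    define x where "x = t powr (- (real d + 1) / 2)"
    have x: "0 < x" using elim by (simp add: x_def)
    have r: "\<rho> powr t = exp (- s * t)" using assms by (simp add: powr_def s_def mult.commute)
    have "(x\<^sup>2) powr (- real d) = t powr ((real d + 1) * real d)"
    proof -
      have "- (real d + 1) / 2 + - (real d + 1) / 2 = - (real d + 1)" by (simp only: field_sum_of_halves)
      then have "x\<^sup>2 = t powr (- (real d + 1))" by (simp only: x_def power2_eq_square powr_add[symmetric])
      then show ?thesis by (simp only: powr_powr minus_mult_minus)
    qed
    moreover have "t powr p * x = t powr ((real d + 1) * real d)"
    proof -
      have "p + - (real d + 1) / 2 = (real d + 1) * real d" by (simp add: p_def field_simps)
      then show ?thesis by (simp only: x_def powr_add[symmetric])
    qed
    ultimately have "(exp 1 * exp (- \<kappa> * t) + a * (b * \<rho> powr t)) * (x\<^sup>2) powr (- real d)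
       = ((exp 1 * exp (- \<kappa> * t) + a * b * exp (- s * t)) * t powr p) * x"
      by (simp add: r mult.assoc)
    also have "\<dots> \<le> 1 * x" using elim x by (intro mult_right_mono) auto
    finally show ?case by (simp add: x_def)
  qed
qed

text \<open>\<open>ennreal\<close> truncates at zero, so splitting a sum can only increase
  it.\<close>

lemma ennreal_plus_le: "ennreal (x + y) \<le> ennreal x + ennreal y"
proof (cases "0 \<le> x")
  case True
  show ?thesis
  proof (cases "0 \<le> y")
    case True
    then show ?thesis using \<open>0 \<le> x\<close> by simp
  next
    case False
    then show ?thesis by (intro add_increasing2 ennreal_leI) auto
  qed
next
  case False
  then show ?thesis by (intro add_increasing ennreal_leI) auto
qed

theorem theorem6p1:
  fixes T :: "real set"
    and P0 :: "(real ^ 'n ^ 'n) set"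
    and Q :: "real ^ 'n ^ 'n \<Rightarrow> real \<Rightarrow> 'n \<times> (real ^ 'd) \<Rightarrow> ('n \<times> (real ^ 'd)) measure"
    and Pr :: "real ^ 'n ^ 'n \<Rightarrow> 'n \<Rightarrow> 'w measure"
    and X :: "real ^ 'n ^ 'n \<Rightarrow> real \<Rightarrow> 'w \<Rightarrow> 'n"
    and Y :: "real ^ 'n ^ 'n \<Rightarrow> real \<Rightarrow> 'w \<Rightarrow> real ^ 'd"
    and \<Sigma> :: "real ^ 'n ^ 'n \<Rightarrow> real ^ 'd ^ 'd"
    and G :: "real ^ 'n ^ 'n \<Rightarrow> real \<Rightarrow> real ^ 'd \<Rightarrow> real ^ 'n ^ 'n"
    and \<mu> :: "real ^ 'n ^ 'n \<Rightarrow> real \<Rightarrow> 'n \<Rightarrow> 'n \<Rightarrow> (real ^ 'd) measure"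
    and D :: "real \<Rightarrow> (real ^ 'd) set"
  assumes time: "T = \<nat> \<or> T = {0..}"
    and compact: "compactin ergodic_topology P0"
    and MAP: "\<And>P. P \<in> P0 \<Longrightarrow> markov_additive_process T (Q P) (Pr P) (X P) (Y P)"
    and driving: "\<And>P. P \<in> P0 \<Longrightarrow> driving_semigroup (Q P) 1 = P"
    and centered: "\<And>P. P \<in> P0 \<Longrightarrow> centered_MAP P (Pr P) (Y P)"
    and covariance: "\<And>P. P \<in> P0 \<Longrightarrow> asymptotic_covariance T (Pr P) (Y P) (\<Sigma> P)"
    and decomposition: "\<And>P t k l. P \<in> P0 \<Longrightarrow> t \<in> T \<Longrightarrow> t > 0 \<Longrightarrow>
          lebesgue_decomposition (additive_law (Pr P) (X P) (Y P) t k l)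
            (\<lambda>y. G P t y $ k $ l) (\<mu> P t k l)"
    and continuity: "\<And>k l. continuous_map (subtopology ergodic_topology P0) tv_topology
          (\<lambda>P. additive_law (Pr P) (X P) (Y P) 1 k l)"
    and nondegenerate: "\<exists>\<alpha>>0. \<exists>\<beta>>0. \<forall>P\<in>P0. \<forall>\<zeta>.
          \<alpha> * (norm \<zeta>)\<^sup>2 \<le> \<zeta> \<bullet> (\<Sigma> P *v \<zeta>) \<and> \<zeta> \<bullet> (\<Sigma> P *v \<zeta>) \<le> \<beta> * (norm \<zeta>)\<^sup>2"
    and moments: "(SUP P\<in>P0. SUP k. SUP v\<in>{0<..1} \<inter> T.
          \<integral>\<^sup>+\<omega>. ennreal (norm (Y P v \<omega>) ^ 3) \<partial>Pr P k) < \<infinity>"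
    and ac_decay: "\<exists>c>0. \<exists>\<rho>. 0 < \<rho> \<and> \<rho> < 1 \<and>
          (\<forall>t\<in>T. t > 0 \<longrightarrow>
            (SUP P\<in>P0. ennreal (mat_max_norm (\<chi> k l. measure (\<mu> P t k l) UNIV)))
              \<le> ennreal (c * \<rho> powr t)) \<and>
          (\<exists>t0>0. \<rho> powr t0 * max 2 (c * real CARD('n)) \<le> 1 / 4 \<and>
            ((\<lambda>\<zeta>. SUP P\<in>P0. SUP w\<in>{t0..<2 * t0} \<inter> T.
                ennreal (mat_max_norm (mat_fourier (G P w) \<zeta>))) \<longlongrightarrow> 0) at_infinity)"
    and domain: "\<And>t. t \<in> T \<Longrightarrow> t > 0 \<Longrightarrow> open (D t) \<and> convex (D t)"
    and regularity: "\<And>P t. P \<in> P0 \<Longrightarrow> t \<in> T \<Longrightarrow> t > 0 \<Longrightarrow>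
          (\<forall>y. y \<notin> closure (D t) \<longrightarrow> G P t y = 0) \<and>
          continuous_on (closure (D t)) (G P t) \<and> G P t differentiable_on D t"
    and density_bound: "(SUP P\<in>P0. SUP t\<in>T \<inter> {0<..}. SUP y\<in>closure (D t).
          ennreal (mat_max_norm (G P t y))) < \<infinity>"
    and boundary_bound: "\<exists>C. \<forall>\<^sub>F t in at_top_along T.
          (SUP P\<in>P0. SUP y\<in>closure (D t) - D t. ennreal (mat_max_norm (G P t y)))
            \<le> ennreal (C * t powr (- (real CARD('d) + 1) / 2))"
    and derivative_bound: "\<And>j. (SUP P\<in>P0. SUP t\<in>T \<inter> {0<..}. SUP y\<in>D t.
          ennreal (mat_max_norm (partial_deriv j (G P t) y))) < \<infinity>"
  shows "\<forall>k. \<exists>C1 C2. \<forall>\<^sub>F t in at_top_along T.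
          (SUP P\<in>P0. SUP y. ennreal \<bar>rescaled_density (G P) k t y - gaussian_density (\<Sigma> P) y\<bar>)
            \<le> ennreal (C1 * t powr (- 1 / 2))
              + ennreal C2 * (SUP P\<in>P0. SUP y\<in>- D t.
                  ennreal (gaussian_density (\<Sigma> P) (t powr (- 1 / 2) *\<^sub>R y)))"
\<comment> \<open>Over the empty family all suprema vanish. Otherwise one member is available from
  which the signs of the common constants can be read off.\<close>
proof (cases "P0 = {}")
  case True
  then show ?thesis by (auto intro!: exI[of _ 0])
next
  case False
  let ?d = "real CARD('d)" and ?N = "real CARD('n)"
  obtain \<alpha> where \<alpha>: "0 < \<alpha>" "\<And>P \<zeta>. P \<in> P0 \<Longrightarrow> \<alpha> * (norm \<zeta>)\<^sup>2 \<le> \<zeta> \<bullet> (\<Sigma> P *v \<zeta>)"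
    using nondegenerate by blast
  obtain m \<theta> where \<theta>: "0 < \<theta>" "\<theta> < 1" and m: "1 \<le> m"
    and minor: "\<And>P n k l. P \<in> P0 \<Longrightarrow> m \<le> n \<Longrightarrow> \<theta> \<le> mat_pow P n $ k $ l"
    using uniform_minorization[OF compact] by blast
  obtain M where M: "0 \<le> M" and "\<forall>P\<in>P0. (SUP k. SUP v\<in>{0<..1} \<inter> T. \<integral>\<^sup>+\<omega>. ennreal (norm (Y P v \<omega>) ^ 3) \<partial>Pr P k) \<le> ennreal M"
    using ennreal_SUP_bound[OF moments] by blast
  then have mom: "(\<integral>\<^sup>+\<omega>. ennreal (norm (Y P v \<omega>) ^ 3) \<partial>Pr P k) \<le> ennreal M" if "P \<in> P0" "v \<in> T" "0 < v" "v \<le> 1" for P v k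
    using that by (auto simp: SUP_le_iff)
  have em: "ergodic_map T (Q P) (Pr P) (X P) (Y P) P (\<Sigma> P) M \<theta> m" if P: "P \<in> P0" for P
    by unfold_locales (use time MAP[OF P] driving[OF P] centered[OF P] covariance[OF P] M mom[OF P] minor[OF P] \<theta> m in auto)
  obtain c0 \<rho> where c0: "0 < c0" and \<rho>: "0 < \<rho>" "\<rho> < 1"
    and mass: "\<And>t. t \<in> T \<Longrightarrow> 0 < t \<Longrightarrow> (SUP P\<in>P0. ennreal (mat_max_norm (\<chi> k l. measure (\<mu> P t k l) UNIV))) \<le> ennreal (c0 * \<rho> powr t)"
    using ac_decay by blast
  have mu: "measure (\<mu> P t k l) UNIV \<le> c0 * \<rho> powr t" if "P \<in> P0" "t \<in> T" "0 < t" for P t k l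
  proof -
    have "ennreal (mat_max_norm (\<chi> k l. measure (\<mu> P t k l) UNIV)) \<le> ennreal (c0 * \<rho> powr t)"
      using mass[OF that(2,3)] that(1) by (auto simp: SUP_le_iff)
    then have "mat_max_norm (\<chi> k l. measure (\<mu> P t k l) UNIV) \<le> c0 * \<rho> powr t"
      using c0 by (simp add: ennreal_le_iff)
    then show ?thesis using mat_max_norm_ge[of "\<chi> k l. measure (\<mu> P t k l) UNIV" k l] by simp
  qed
  obtain Bg where Bg: "0 \<le> Bg" and "\<forall>P\<in>P0. (SUP t\<in>T \<inter> {0<..}. SUP y\<in>closure (D t). ennreal (mat_max_norm (G P t y))) \<le> ennreal Bg"
    using ennreal_SUP_bound[OF density_bound] by blast
  then have Gc: "mat_max_norm (G P t y) \<le> Bg" if "P \<in> P0" "t \<in> T" "0 < t" "y \<in> closure (D t)" for P t y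
    using that by (auto simp: SUP_le_iff)
  have GB: "G P t y $ k $ l \<le> Bg" if "P \<in> P0" "t \<in> T" "0 < t" for P t y k l
  proof (cases "y \<in> closure (D t)")
    case True
    then show ?thesis using Gc[OF that True] mat_max_norm_ge[of "G P t y" k l] by simp
  next
    case False
    then have "G P t y = 0" using regularity[OF that] by blast
    then show ?thesis using Bg by simp
  qed
  have "\<forall>j. \<exists>C. 0 \<le> C \<and> (\<forall>P\<in>P0. (SUP t\<in>T \<inter> {0<..}. SUP y\<in>D t. ennreal (mat_max_norm (partial_deriv j (G P t) y))) \<le> ennreal C)"
    using ennreal_SUP_bound[OF derivative_bound] by blast
  from choice[OF this] obtain Cd where Cd0: "\<forall>j. 0 \<le> Cd j \<and>
      (\<forall>P\<in>P0. (SUP t\<in>T \<inter> {0<..}. SUP y\<in>D t. ennreal (mat_max_norm (partial_deriv j (G P t) y))) \<le> ennreal (Cd j))"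
    by (elim exE) (rule that)
  then have Cd: "0 \<le> Cd j" for j by blast
  have part: "mat_max_norm (partial_deriv j (G P t) y) \<le> Cd j" if "P \<in> P0" "t \<in> T" "0 < t" "y \<in> D t" for P t y j
  proof -
    have "ennreal (mat_max_norm (partial_deriv j (G P t) y)) \<le> ennreal (Cd j)"
    proof -
      have "t \<in> T \<inter> {0<..}" using that by simp
      then show ?thesis using Cd0 that(1,4) unfolding SUP_le_iff by blast
    qed
    then show ?thesis using Cd[of j] by (simp add: ennreal_le_iff)
  qed
  define L where "L = ?N * (\<Sum>j\<in>UNIV. Cd j)"
  have L: "0 \<le> L" unfolding L_def using Cd by (simp add: sum_nonneg)
  have lip: "\<bar>(\<Sum>l\<in>UNIV. G P t x $ k $ l) - (\<Sum>l\<in>UNIV. G P t y $ k $ l)\<bar> \<le> L * dist x y"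
    if P: "P \<in> P0" "t \<in> T" "0 < t" and xy: "x \<in> closure (D t)" "y \<in> closure (D t)" for P t x y k
  proof (rule lipschitz_on_closure[OF _ _ xy])
    show "continuous_on (closure (D t)) (\<lambda>x. \<Sum>l\<in>UNIV. G P t x $ k $ l)"
      using regularity[OF P] by (intro continuous_on_sum continuous_on_component) auto
    show "\<bar>(\<Sum>l\<in>UNIV. G P t x $ k $ l) - (\<Sum>l\<in>UNIV. G P t y $ k $ l)\<bar> \<le> L * dist x y"
      if "x \<in> D t" "y \<in> D t" for x y
      unfolding L_def using domain[OF P(2,3)] regularity[OF P] that
      by (intro partial_derivative_lipschitz[where C=Cd and D="D t"] part[OF P]) auto
  qed
  \<comment> \<open>The time \<open>n\<close> must be late enough for the minorization and for the
    singular mass to be at most \<theta>/2; then every entry has an absolutely continuous part of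
    mass at least \<theta>/2.\<close>
  have "\<exists>n. m \<le> n \<and> c0 * \<rho> powr real n \<le> \<theta> / 2"
  proof -
    have "(\<lambda>n. c0 * \<rho> ^ n) \<longlonglongrightarrow> c0 * 0" using \<rho> by (intro tendsto_intros LIMSEQ_power_zero) auto
    then have "\<forall>\<^sub>F n in sequentially. c0 * \<rho> ^ n < \<theta> / 2" using \<theta> by (intro order_tendstoD) auto
    then have "\<forall>\<^sub>F n in sequentially. m \<le> n \<and> c0 * \<rho> powr real n \<le> \<theta> / 2"
      using eventually_ge_at_top[of m] by eventually_elim (use \<rho> in \<open>simp add: powr_realpow\<close>)
    then show ?thesis by (rule eventually_happens'[OF sequentially_bot])
  qed
  then obtain n where n: "m \<le> n" "c0 * \<rho> powr real n \<le> \<theta> / 2" by blast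
  have n1: "1 \<le> n" using n m by simp
  define \<delta> where "\<delta> = perturbed_chain.\<delta> m \<theta> (1 + M) (\<alpha> / 2)"
  obtain P1 where "P1 \<in> P0" using False by blast
  have \<delta>: "0 < \<delta>" unfolding \<delta>_def using ergodic_map.constants_pos(1)[OF em[OF \<open>P1 \<in> P0\<close>]] \<alpha> by simp
  have C: "0 \<le> real n * (1 + M)" and \<theta>2: "0 < \<theta> / 2" using M \<theta> by auto
  \<comment> \<open>All parameters of the gap are common to the family, hence so is \<kappa>;
    \<delta> is the frequency up to which the expansion at small frequencies holds.\<close>
  from fourier_gap[OF Bg \<theta>2 C \<delta>, where 'd='d] obtain \<kappa> where \<kappa>: "0 < \<kappa>"
    and gap: "\<forall>\<nu> \<mu> h. \<forall>\<zeta>::real^'d.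
    finite_measure \<nu> \<longrightarrow> sets \<nu> = sets borel \<longrightarrow> h \<in> borel_measurable borel \<longrightarrow> (\<forall>y. 0 \<le> h y \<and> h y \<le> Bg) \<longrightarrow>
    (\<forall>B\<in>sets borel. emeasure \<nu> B = (\<integral>\<^sup>+y\<in>B. ennreal (h y) \<partial>lborel) + emeasure \<mu> B) \<longrightarrow>
    emeasure \<mu> UNIV + ennreal (\<theta> / 2) \<le> emeasure \<nu> UNIV \<longrightarrow> (\<integral>\<^sup>+y. ennreal (norm y) \<partial>\<nu>) \<le> ennreal (real n * (1 + M)) \<longrightarrow> \<delta> \<le> norm \<zeta> \<longrightarrow>
    norm (LINT y|\<nu>. cis (\<zeta> \<bullet> y)) \<le> measure \<nu> UNIV - \<kappa>"
    by (elim exE conjE) (rule that)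
  define \<kappa>' where "\<kappa>' = min \<kappa> 1"
  have \<kappa>': "0 < \<kappa>'" "\<kappa>' \<le> 1" "\<kappa>' \<le> \<kappa>" using \<kappa> by (auto simp: \<kappa>'_def)
  have nT: "real n \<in> T" "0 < real n" using n1 time by auto
  have row: "(\<Sum>l\<in>UNIV. cmod (map_process.\<Phi> (Q P) (real n) \<zeta> $ k $ l)) \<le> 1 - \<kappa>'"
    if P: "P \<in> P0" and z: "\<delta> \<le> norm \<zeta>" for P k \<zeta>
  proof -
    have "(\<Sum>l\<in>UNIV. cmod (map_process.\<Phi> (Q P) (real n) \<zeta> $ k $ l)) \<le> 1 - \<kappa>"
    proof (rule ergodic_map.row_gap[OF em[OF P], where B=Bg and g="\<lambda>l y. G P (real n) y $ k $ l" and \<mu>="\<mu> P (real n) k"])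
      show "lebesgue_decomposition (additive_law (Pr P) (X P) (Y P) (real n) k l) (\<lambda>y. G P (real n) y $ k $ l) (\<mu> P (real n) k l)" for l
        by (rule decomposition[OF P nT])
      show "measure (\<mu> P (real n) k l) UNIV \<le> \<theta> / 2" for l using mu[OF P nT, of k l] n(2) by simp
      fix \<nu> \<mu>' :: "(real^'d) measure" and h
      assume a: "finite_measure \<nu>" "sets \<nu> = sets borel" "h \<in> borel_measurable borel" "\<And>y. 0 \<le> h y \<and> h y \<le> Bg"
        "\<And>A. A \<in> sets borel \<Longrightarrow> emeasure \<nu> A = (\<integral>\<^sup>+y\<in>A. ennreal (h y) \<partial>lborel) + emeasure \<mu>' A"
        "emeasure \<mu>' UNIV + ennreal (\<theta> / 2) \<le> emeasure \<nu> UNIV"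
        "(\<integral>\<^sup>+y. ennreal (norm y) \<partial>\<nu>) \<le> ennreal (real n * (1 + M))"
      show "norm (LINT y|\<nu>. cis (\<zeta> \<bullet> y)) \<le> measure \<nu> UNIV - \<kappa>"
        by (rule gap[rule_format, OF a z])
    qed (use \<kappa> minor[OF P n(1)] GB[OF P nT] in auto)
    then show ?thesis using \<kappa>' by simp
  qed
  obtain Cb where Cb: "\<forall>\<^sub>F t in at_top_along T.
          (SUP P\<in>P0. SUP y\<in>closure (D t) - D t. ennreal (mat_max_norm (G P t y)))
            \<le> ennreal (Cb * t powr (- (?d + 1) / 2))"
    using boundary_bound by blast
  \<comment> \<open>\<open>Cb\<close> is obtained without a sign, while the pointwise estimate takes
    a nonnegative boundary constant.\<close>
  define b where "b = ?N * max Cb 0"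
  define R where "R = b + (L + (1 / sqrt \<alpha>) * (4 * pi / \<alpha>) powr (?d / 2) / (2 * pi) ^ CARD('d)) + (L + ?N * Bg) * 2 powr (?d / 2)
     + ergodic_map.K1 TYPE('d) M \<theta> m \<alpha> + 1"
  have tail: "\<forall>\<^sub>F t in at_top_along T. (exp 1 * exp (- (\<kappa>' / real n) * t) + ?N * (c0 * \<rho> powr t))
      * ((t powr (- (?d + 1) / 2))\<^sup>2) powr (- ?d) \<le> t powr (- (?d + 1) / 2)"
    by (rule filter_leD[OF inf_le1]) (use \<kappa>' nT \<rho> in \<open>intro exponential_tail; simp\<close>)
  have T1: "\<forall>\<^sub>F t in at_top_along T. t \<in> T \<and> 1 \<le> t"
    unfolding eventually_inf_principal by (rule eventually_mono[OF eventually_ge_at_top[of 1]]) simp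
  show ?thesis
  \<comment> \<open>The constants \<open>R\<close> and 1 serve every initial state.\<close>
  proof (intro allI exI)
    fix k
    show "\<forall>\<^sub>F t in at_top_along T.
          (SUP P\<in>P0. SUP y. ennreal \<bar>rescaled_density (G P) k t y - gaussian_density (\<Sigma> P) y\<bar>)
            \<le> ennreal (R * t powr (- 1 / 2))
              + ennreal 1 * (SUP P\<in>P0. SUP y\<in>- D t.
                  ennreal (gaussian_density (\<Sigma> P) (t powr (- 1 / 2) *\<^sub>R y)))"
      using Cb tail T1
    proof eventually_elim
      case (elim t)
      then have t: "t \<in> T" "1 \<le> t" "0 < t" by auto
      let ?S = "SUP P\<in>P0. SUP y\<in>- D t. ennreal (gaussian_density (\<Sigma> P) (t powr (- 1 / 2) *\<^sub>R y))"
      have bd: "(\<Sum>l\<in>UNIV. G P t y $ k $ l) \<le> b * t powr (- (?d + 1) / 2)" if P: "P \<in> P0" and y: "y \<in> closure (D t) - D t" for P y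
      proof -
        have "ennreal (mat_max_norm (G P t y)) \<le> ennreal (Cb * t powr (- (?d + 1) / 2))"
          using elim(1) P y by (auto simp: SUP_le_iff)
        also have "\<dots> \<le> ennreal (max Cb 0 * t powr (- (?d + 1) / 2))" by (intro ennreal_leI mult_right_mono) auto
        finally have "mat_max_norm (G P t y) \<le> max Cb 0 * t powr (- (?d + 1) / 2)" by (simp add: ennreal_le_iff)
        then have "G P t y $ k $ l \<le> max Cb 0 * t powr (- (?d + 1) / 2)" for l
          using mat_max_norm_ge[of "G P t y" k l] by simp
        then have "(\<Sum>l\<in>UNIV. G P t y $ k $ l) \<le> (\<Sum>l\<in>(UNIV::'n set). max Cb 0 * t powr (- (?d + 1) / 2))" by (rule sum_mono)
        then show ?thesis by (simp add: b_def)
      qed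
      have "ennreal \<bar>rescaled_density (G P) k t y - gaussian_density (\<Sigma> P) y\<bar> \<le> ennreal (R * t powr (- 1 / 2)) + ennreal 1 * ?S"
        if P: "P \<in> P0" for P y
      proof -
        have b0: "0 \<le> b" by (simp add: b_def)
        have "\<bar>rescaled_density (G P) k t y - gaussian_density (\<Sigma> P) y\<bar> \<le> R * t powr (- 1 / 2) \<or>
          (\<exists>z. z \<notin> D t \<and> \<bar>rescaled_density (G P) k t y - gaussian_density (\<Sigma> P) y\<bar> \<le> R * t powr (- 1 / 2) + gaussian_density (\<Sigma> P) (t powr (- 1 / 2) *\<^sub>R z))"
          unfolding rescaled_density_def R_def
        proof (rule ergodic_map.pointwise_estimate[OF em[OF P] \<alpha>(1) \<alpha>(2)[OF P] \<kappa>'(1,2) n1 row[OF P] t(1,2)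
              decomposition[OF P t(1,3)] mu[OF P t(1,3)] elim(2)])
          show "open (D t)" using domain[OF t(1,3)] by simp
          show "x \<notin> closure (D t) \<Longrightarrow> G P t x = 0" for x using regularity[OF P t(1,3)] by blast
        qed (use GB[OF P t(1,3)] lip[OF P t(1,3)] L bd[OF P] b0 in \<open>auto simp: \<delta>_def\<close>)
        then show ?thesis
        proof
          assume "\<bar>rescaled_density (G P) k t y - gaussian_density (\<Sigma> P) y\<bar> \<le> R * t powr (- 1 / 2)"
          then show ?thesis by (intro add_increasing2 ennreal_leI) auto
        next
          assume "\<exists>z. z \<notin> D t \<and> \<bar>rescaled_density (G P) k t y - gaussian_density (\<Sigma> P) y\<bar> \<le> R * t powr (- 1 / 2) + gaussian_density (\<Sigma> P) (t powr (- 1 / 2) *\<^sub>R z)"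
          then obtain z where z: "z \<notin> D t" and le: "\<bar>rescaled_density (G P) k t y - gaussian_density (\<Sigma> P) y\<bar> \<le> R * t powr (- 1 / 2) + gaussian_density (\<Sigma> P) (t powr (- 1 / 2) *\<^sub>R z)"
            by blast
          have "ennreal \<bar>rescaled_density (G P) k t y - gaussian_density (\<Sigma> P) y\<bar>
             \<le> ennreal (R * t powr (- 1 / 2)) + ennreal (gaussian_density (\<Sigma> P) (t powr (- 1 / 2) *\<^sub>R z))"
            by (rule order_trans[OF ennreal_leI[OF le] ennreal_plus_le])
          also have "ennreal (gaussian_density (\<Sigma> P) (t powr (- 1 / 2) *\<^sub>R z)) \<le> ?S"
            using P z by (intro SUP_upper2[of P] SUP_upper2[of z]) auto
          finally show ?thesis by (simp add: add_left_mono)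
        qed
      qed
      then show ?case by (auto simp: SUP_le_iff)
    qed
  qed
qed

end
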